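(* Let $u,w\in W$ and let $u=s_{i_1}\cdots s_{i_\ell}$ be a (not necessarily reduced) expression of $u$ in simple reflections. For $J\subseteq\{1,\ldots,\ell\}$ and $1\le j\le\ell$ let $\epsilon_j=1$ if $j\in J$, $\epsilon_j=0$ if $j\notin J$, and $$w(J)=s_{i_1}^{\epsilon_1}\cdots s_{i_\ell}^{\epsilon_\ell},\qquad \beta_j=s_{i_1}\cdots s_{i_{j-1}}\alpha_{i_j},\qquad \check\gamma_j^J=s_{i_\ell}^{\epsilon_\ell}\cdots s_{i_{j+1}}^{\epsilon_{j+1}}\alpha^\vee_{i_j}.$$ Then $$\mathbf{E}^P_w(u)=\sum_{J}\prod_{j=1}^\ell\begin{cases}[\mathsf{Q}(\lambda_{\check\gamma_j^J},z_{\beta_j})]_P,& j\in J,\\ [\mathsf{P}(\lambda_{\check\gamma_j^J},z_{\beta_j})]_P,& j\notin J,\end{cases}$$ where the sum is over all $J\subseteq\{1,\ldots,\ell\}$ with $w(J)=w$ such that $s_{i_j}^{\epsilon_j}\cdots s_{i_\ell}^{\epsilon_\ell}\in W^P$ for every $j=1,\ldots,\ell$. In particular, $\mathbf{E}_w^P(u)=0$ unless $w\in W^P$.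
   Context: For a lattice $\Lambda$, $\mathbb{Q}[\Lambda]=\bigoplus_{\mu\in\Lambda}\mathbb{Q}\,e^{\pi i\mu}$ is the group algebra (formal symbols $e^{\pi i\mu}$). For $u\in\Lambda$, $\theta(u)=(e^{\pi iu}-e^{-\pi iu})\prod_{n>0}(1-q^ne^{2\pi iu})(1-q^ne^{-2\pi iu})\in\mathbb{Q}[\Lambda][[q]]$. Define $$\mathsf{P}(x,y)=\frac{\theta(x-y)\theta(\hbar)}{\theta(y+\hbar)\theta(x)},\qquad \mathsf{Q}(x,y)=\frac{\theta(x+\hbar)\theta(y)}{\theta(y+\hbar)\theta(x)}.$$ Let $G$ be a (complex, connected) simply connected semisimple group, so that $X_*(T)=\bigoplus_{\alpha\in\Sigma}\mathbb{Z}\alpha^\vee$ is the coroot lattice; $B$ a Borel subgroup, $T$ a maximal torus, $\Sigma$ the simple roots $\alpha_i$, $s_i$ simple reflections, $W$ the Weyl group. Let $\Lambda=X^*(T)\oplus X_*(T)\oplus\mathbb{Z}\hbar$, $\mathcal{Q}=\operatorname{Frac}\mathbb{Q}[\Lambda][[q]]$. For $\alpha\in X^*(T)$ (resp. $\beta^\vee\in X_*(T)$) write $z_\alpha$ (resp. $\lambda_{\beta^\vee}$) for the corresponding element of $\Lambda$. $W\times W$ acts on $\mathcal{Q}$ by ${}^{wv^{\mathsf d}}z_\alpha=z_{w\alpha}$, ${}^{wv^{\mathsf d}}\lambda_{\beta^\vee}=\lambda_{v\beta^\vee}$, fixing $\hbar,q$. $\mathcal{Q}_{W^2}$ is the free left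 $\mathcal{Q}$-module with basis $\{\delta_w\delta_v^{\mathsf d}\}$ and product $a\,\delta_w\delta_v^{\mathsf d}\cdot a'\,\delta_{w'}\delta_{v'}^{\mathsf d}=a\cdot{}^{wv^{\mathsf d}}a'\,\delta_{ww'}\delta_{vv'}^{\mathsf d}$. For a simple root $\alpha$ let $T_\alpha=\delta_{s_\alpha}^{\mathsf d}\big(\mathsf{P}(z_\alpha,\lambda_{\alpha^\vee})+\mathsf{Q}(z_\alpha,\lambda_{\alpha^\vee})\delta_{s_\alpha}\big)$; these satisfy the Weyl group relations (known), so $T_w$ is defined for $w\in W$. Define $b_{u,w}\in\mathcal{Q}$ by $\delta_u=\sum_{w\le u}b_{u,w}\,\delta^{\mathsf d}_{w^{-1}}T_w$ (and $b_{u,w}=0$ if $w\not\le u$). Let $P\supseteq B$ be a parabolic subgroup, corresponding to $\Sigma_P\subseteq\Sigma$; $W_P$ is the subgroup generated by $s_\alpha$, $\alpha\in\Sigma_P$, and $W^P$ the set of minimal length representatives of the left cosets $W/W_P$. Let $\Lambda^P=X^*(T)\oplus\bigoplus_{\alpha\in\Sigma\setminus\Sigma_P}\mathbb{Z}\alpha^\vee\oplus\mathbb{Z}\hbar$ and $\mathcal{Q}^P=\operatorname{Frac}\mathbb{Q}[\Lambda^P][[q]]$. The lattice map $\Lambda\to\Lambda^P$ that is the identity on $X^*(T)$, on $\hbar$ and on $\alpha^\vee$ for $\alpha\in\Sigma\setminus\Sigma_P$, and sends $\alpha^\vee\mapsto-\hbar$ for $\alpha\in\Sigma_P$, induces a ring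 map $f\mapsto[f]_P$, $\mathbb{Q}[\Lambda][[q]]\to\mathbb{Q}[\Lambda^P][[q]]$; for $c=f/g\in\mathcal{Q}$ with $[g]_P\neq0$ set $[c]_P=[f]_P/[g]_P\in\mathcal{Q}^P$ (specialization of $\lambda_{\alpha^\vee}$ to $-\hbar$ for $\alpha\in\Sigma_P$). All $b_{u,w}$ can be so specialized. Set $\mathbf{E}^P_w(u)=[b_{u,w}]_P$ (for $w\in W^P$ this is the parabolic elliptic Schubert class). *)

theory Defs
  imports
    Complex_Main
    "HOL-Library.Poly_Mapping"
    "HOL-Library.Product_Plus"
    "HOL-Library.Product_Lexorder"
    "HOL-Library.Sublist"
    "HOL-Computational_Algebra.Formal_Power_Series"
    "HOL-Computational_Algebra.Fraction_Field"
begin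

unbundle fps_syntax

subsection \<open>Group algebras of lattices, power series in q, and theta\<close>

text \<open>
  Lattices are types of class \<^class>\<open>linordered_ab_group_add\<close>.  Every free abelian group admits
  such an order (a lexicographic one).  The order is never referred to: it is only what
  the library uses to know that the group algebra is an integral domain.
\<close>

instance prod :: (linordered_ab_group_add, linordered_ab_group_add) linordered_ab_group_add
  by intro_classes (auto simp: less_eq_prod_def less_prod_def)

text \<open>The power series ring over the rational group algebra, the variable q being \<^term>\<open>fps_X\<close>.\<close>

type_synonym 'a gseries = "('a \<Rightarrow>\<^sub>0 rat) fps"

text \<open>The formal symbol e^(pi i mu); hence e^(2 pi i mu) is \<open>ex (mu + mu)\<close>.\<close>

definition ex :: "'a::linordered_ab_group_add \<Rightarrow> ('a \<Rightarrow>\<^sub>0 rat)"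
  where "ex \<mu> = Poly_Mapping.single \<mu> 1"

definition theta_factor :: "'a::linordered_ab_group_add \<Rightarrow> nat \<Rightarrow> 'a gseries"
  where "theta_factor u n =
    (1 - fps_X ^ n * fps_const (ex (u + u))) * (1 - fps_X ^ n * fps_const (ex (- (u + u))))"

text \<open>The infinite product is the limit of its partial products in the q-adic topology.\<close>

definition theta :: "'a::linordered_ab_group_add \<Rightarrow> 'a gseries"
  where "theta u = fps_const (ex u - ex (- u)) * lim (\<lambda>N. \<Prod>n=1..N. theta_factor u n)"

lemma theta_factor_nth:
  assumes "0 < k" "k < n"
  shows "theta_factor u n $ k = 0"
proof -
  have *: "(1 - x * a) * (1 - x * b) = 1 + x * (x * a * b - a - b)"
    for x a b :: "'a gseries"
    by (simp add: algebra_simps)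
  show ?thesis
    using assms unfolding theta_factor_def * by (simp add: fps_X_power_mult_nth)
qed

lemma theta_factor_nth_0: "0 < n \<Longrightarrow> theta_factor u n $ 0 = 1"
  by (simp add: theta_factor_def)

lemma theta_product_convergent: "convergent (\<lambda>N. \<Prod>n=1..N. theta_factor u n)"
proof -
  let ?p = "\<lambda>N. \<Prod>n=1..N. theta_factor u n"
  have step_eq: "?p (Suc N) $ k = ?p N $ k" if "k \<le> N" for N k
  proof -
    have "?p (Suc N) $ k = (?p N * theta_factor u (Suc N)) $ k"
      by (simp add: atLeastAtMostSuc_conv mult.commute)
    also have "\<dots> = (\<Sum>i=0..k. ?p N $ i * theta_factor u (Suc N) $ (k - i))"
      by (simp add: fps_mult_nth)
    also have "\<dots> = (\<Sum>i=0..k. if i = k then ?p N $ i else 0)"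
      using that by (intro sum.cong refl) (auto simp: theta_factor_nth theta_factor_nth_0)
    also have "\<dots> = ?p N $ k" by simp
    finally show ?thesis .
  qed
  have stable: "?p N $ k = ?p k $ k" if "k \<le> N" for N k
    using that
  proof (induction N rule: dec_induct)
    case base
    then show ?case by simp
  next
    case (step n)
    then show ?case using step_eq[of k n] by simp
  qed
  have "?p \<longlonglongrightarrow> Abs_fps (\<lambda>k. ?p k $ k)"
  proof (rule tendsto_fpsI)
    fix k
    show "\<forall>\<^sub>F N in sequentially. ?p N $ k = Abs_fps (\<lambda>k. ?p k $ k) $ k"
      using eventually_ge_at_top[of k] by (rule eventually_mono) (unfold fps_nth_Abs_fps, rule stable)
  qed
  then show ?thesis by (auto simp: convergent_def)
qed

definition alg_map :: "('a \<Rightarrow> 'b) \<Rightarrow> ('a \<Rightarrow>\<^sub>0 rat) \<Rightarrow> ('b \<Rightarrow>\<^sub>0 rat)"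
  where "alg_map \<phi> f =
    (\<Sum>\<mu>\<in>Poly_Mapping.keys f. Poly_Mapping.single (\<phi> \<mu>) (Poly_Mapping.lookup f \<mu>))"

definition series_map :: "('a \<Rightarrow> 'b) \<Rightarrow> 'a gseries \<Rightarrow> 'b gseries"
  where "series_map \<phi> F = Abs_fps (\<lambda>n. alg_map \<phi> (F $ n))"

text \<open>
  The substitution induced by a lattice map on those fractions f/g for which the image
  of g is nonzero; it does not depend on the chosen f and g.  For an injective lattice
  map it is defined everywhere.
\<close>

definition subst_frac ::
  "('a \<Rightarrow> 'b) \<Rightarrow> 'a::linordered_ab_group_add gseries fract \<Rightarrow> 'b::linordered_ab_group_add gseries fract"
  where "subst_frac \<phi> c =
    (THE d. \<exists>f g. c = Fract f g \<and> series_map \<phi> g \<noteq> 0 \<and>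
                  d = Fract (series_map \<phi> f) (series_map \<phi> g))"


subsection \<open>Simply connected semisimple groups: based root data\<close>

definition zscale :: "int \<Rightarrow> 'a::ab_group_add \<Rightarrow> 'a"  (infixr "\<bullet>" 75)
  where "k \<bullet> x = (if 0 \<le> k then (((+) x) ^^ nat k) 0 else - ((((+) x) ^^ nat (- k)) 0))"

text \<open>
  The types \<open>'x\<close> and \<open>'y\<close> are the character lattice and the cocharacter lattice of T;
  \<open>simples\<close> is the set of simple roots determined by B.
\<close>

record ('x, 'y) root_datum =
  pairing :: "'x \<Rightarrow> 'y \<Rightarrow> int"
  roots :: "'x set"
  coroot :: "'x \<Rightarrow> 'y"
  simples :: "'x set"

definition refl :: "('x::ab_group_add, 'y) root_datum \<Rightarrow> 'x \<Rightarrow> 'x \<Rightarrow> 'x"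
  where "refl D \<alpha> x = x - pairing D x (coroot D \<alpha>) \<bullet> \<alpha>"

definition corefl :: "('x, 'y::ab_group_add) root_datum \<Rightarrow> 'x \<Rightarrow> 'y \<Rightarrow> 'y"
  where "corefl D \<alpha> y = y - pairing D \<alpha> y \<bullet> coroot D \<alpha>"

text \<open>
  The triples (G, B, T) with G complex, connected, semisimple and simply connected are
  classified by the following data: a reduced root datum with a base such that the simple
  coroots form a basis of the cocharacter lattice.
\<close>

locale simply_connected_root_datum =
  fixes D :: "('x::linordered_ab_group_add, 'y::linordered_ab_group_add) root_datum"
  assumes pairing_add_left: "additive (\<lambda>x. pairing D x y)"
    and pairing_add_right: "additive (\<lambda>y. pairing D x y)"
    and perfect_left: "additive f \<Longrightarrow> \<exists>!x. \<forall>y. pairing D x y = f y"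
    and perfect_right: "additive g \<Longrightarrow> \<exists>!y. \<forall>x. pairing D x y = g x"
    and finite_roots: "finite (roots D)"
    and coroot_inj: "inj_on (coroot D) (roots D)"
    and pairing_coroot: "\<alpha> \<in> roots D \<Longrightarrow> pairing D \<alpha> (coroot D \<alpha>) = 2"
    and refl_root: "\<alpha> \<in> roots D \<Longrightarrow> \<beta> \<in> roots D \<Longrightarrow> refl D \<alpha> \<beta> \<in> roots D"
    and corefl_coroot:
      "\<alpha> \<in> roots D \<Longrightarrow> \<beta> \<in> roots D \<Longrightarrow> corefl D \<alpha> (coroot D \<beta>) \<in> coroot D ` roots D"
    and reduced_roots: "\<alpha> \<in> roots D \<Longrightarrow> \<alpha> + \<alpha> \<notin> roots D"
    and simples_roots: "simples D \<subseteq> roots D"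
    and simples_independent:
      "(\<Sum>\<beta>\<in>simples D. c \<beta> \<bullet> \<beta>) = 0 \<Longrightarrow> \<beta> \<in> simples D \<Longrightarrow> c \<beta> = 0"
    and root_pos_or_neg:
      "\<alpha> \<in> roots D \<Longrightarrow> \<exists>c. (\<forall>\<beta>. 0 \<le> c \<beta>) \<and>
         (\<alpha> = (\<Sum>\<beta>\<in>simples D. c \<beta> \<bullet> \<beta>) \<or> \<alpha> = - (\<Sum>\<beta>\<in>simples D. c \<beta> \<bullet> \<beta>))"
    and coroot_basis:
      "\<exists>!c. (\<forall>\<beta>. \<beta> \<notin> simples D \<longrightarrow> c \<beta> = 0) \<and> y = (\<Sum>\<beta>\<in>simples D. c \<beta> \<bullet> coroot D \<beta>)"

definition coroot_coord :: "('x, 'y::ab_group_add) root_datum \<Rightarrow> 'y \<Rightarrow> 'x \<Rightarrow> int"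
  where "coroot_coord D y =
    (THE c. (\<forall>\<beta>. \<beta> \<notin> simples D \<longrightarrow> c \<beta> = 0) \<and> y = (\<Sum>\<beta>\<in>simples D. c \<beta> \<bullet> coroot D \<beta>))"


subsection \<open>The Weyl group\<close>

text \<open>Elements of the Weyl group are represented by their action on the character lattice.\<close>

definition word_prod :: "('x::ab_group_add, 'y) root_datum \<Rightarrow> 'x list \<Rightarrow> 'x \<Rightarrow> 'x"
  where "word_prod D \<alpha>s = foldr (\<circ>) (map (refl D) \<alpha>s) id"

definition weyl_gen :: "('x::ab_group_add, 'y) root_datum \<Rightarrow> 'x set \<Rightarrow> ('x \<Rightarrow> 'x) set"
  where "weyl_gen D A = word_prod D ` lists A"

abbreviation weyl :: "('x::ab_group_add, 'y) root_datum \<Rightarrow> ('x \<Rightarrow> 'x) set"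
  where "weyl D \<equiv> weyl_gen D (simples D)"

text \<open>The action of w on cocharacters, characterized by the invariance of the pairing.\<close>

definition coact :: "('x, 'y) root_datum \<Rightarrow> ('x \<Rightarrow> 'x) \<Rightarrow> 'y \<Rightarrow> 'y"
  where "coact D w y = (THE y'. \<forall>x. pairing D (w x) y' = pairing D x y)"

definition len :: "('x::ab_group_add, 'y) root_datum \<Rightarrow> ('x \<Rightarrow> 'x) \<Rightarrow> nat"
  where "len D w = (LEAST n. \<exists>\<alpha>s\<in>lists (simples D). word_prod D \<alpha>s = w \<and> length \<alpha>s = n)"

definition reduced_word :: "('x::ab_group_add, 'y) root_datum \<Rightarrow> ('x \<Rightarrow> 'x) \<Rightarrow> 'x list \<Rightarrow> bool"
  where "reduced_word D w \<alpha>s \<longleftrightarrow>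
    \<alpha>s \<in> lists (simples D) \<and> word_prod D \<alpha>s = w \<and> length \<alpha>s = len D w"

definition bruhat_le :: "('x::ab_group_add, 'y) root_datum \<Rightarrow> ('x \<Rightarrow> 'x) \<Rightarrow> ('x \<Rightarrow> 'x) \<Rightarrow> bool"
  where "bruhat_le D w u \<longleftrightarrow>
    (\<exists>\<alpha>s \<beta>s. reduced_word D u \<alpha>s \<and> subseq \<beta>s \<alpha>s \<and> word_prod D \<beta>s = w)"

definition min_coset_reps :: "('x::ab_group_add, 'y) root_datum \<Rightarrow> 'x set \<Rightarrow> ('x \<Rightarrow> 'x) set"
  where "min_coset_reps D SP = {w \<in> weyl D. \<forall>v\<in>weyl_gen D SP. len D w \<le> len D (w \<circ> v)}"


subsection \<open>The functions P and Q\<close>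

type_synonym ('x, 'y) lat = "'x \<times> 'y \<times> int"

type_synonym ('x, 'y) ell = "('x, 'y) lat gseries fract"

definition hb :: "('x::zero, 'y::zero) lat"
  where "hb = (0, 0, 1)"

definition zz :: "'x \<Rightarrow> ('x, 'y::zero) lat"
  where "zz \<alpha> = (\<alpha>, 0, 0)"

definition la :: "'y \<Rightarrow> ('x::zero, 'y) lat"
  where "la \<beta> = (0, \<beta>, 0)"

definition PP :: "('x::linordered_ab_group_add, 'y::linordered_ab_group_add) lat
    \<Rightarrow> ('x, 'y) lat \<Rightarrow> ('x, 'y) ell"
  where "PP x y = Fract (theta (x - y) * theta hb) (theta (y + hb) * theta x)"

definition QQ :: "('x::linordered_ab_group_add, 'y::linordered_ab_group_add) lat
    \<Rightarrow> ('x, 'y) lat \<Rightarrow> ('x, 'y) ell"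
  where "QQ x y = Fract (theta (x + hb) * theta y) (theta (y + hb) * theta x)"


subsection \<open>The twisted group algebra of W x W\<close>

text \<open>
  A finitely supported function on pairs (w, v) stands for the sum of its values times
  \<open>\<delta>\<^sub>w \<delta>\<^sup>d\<^sub>v\<close>; only supports inside W x W occur.
\<close>

type_synonym ('x, 'y) twisted = "(('x \<Rightarrow> 'x) \<times> ('x \<Rightarrow> 'x)) \<Rightarrow>\<^sub>0 ('x, 'y) ell"

definition lat_act :: "('x, 'y) root_datum \<Rightarrow> ('x \<Rightarrow> 'x) \<times> ('x \<Rightarrow> 'x) \<Rightarrow> ('x, 'y) lat \<Rightarrow> ('x, 'y) lat"
  where "lat_act D p m = (case (p, m) of ((w, v), (x, y, k)) \<Rightarrow> (w x, coact D v y, k))"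

definition tmul :: "('x::linordered_ab_group_add, 'y::linordered_ab_group_add) root_datum
    \<Rightarrow> ('x, 'y) twisted \<Rightarrow> ('x, 'y) twisted \<Rightarrow> ('x, 'y) twisted"
  where "tmul D f g =
    (\<Sum>p\<in>Poly_Mapping.keys f. \<Sum>p'\<in>Poly_Mapping.keys g.
       Poly_Mapping.single (fst p \<circ> fst p', snd p \<circ> snd p')
         (Poly_Mapping.lookup f p * subst_frac (lat_act D p) (Poly_Mapping.lookup g p')))"

definition scal :: "('x::linordered_ab_group_add, 'y::linordered_ab_group_add) ell \<Rightarrow> ('x, 'y) twisted"
  where "scal a = Poly_Mapping.single (id, id) a"

definition delta :: "('x \<Rightarrow> 'x) \<Rightarrow> ('x::linordered_ab_group_add, 'y::linordered_ab_group_add) twisted"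
  where "delta w = Poly_Mapping.single (w, id) 1"

definition delta_d :: "('x \<Rightarrow> 'x) \<Rightarrow> ('x::linordered_ab_group_add, 'y::linordered_ab_group_add) twisted"
  where "delta_d v = Poly_Mapping.single (id, v) 1"

definition T_simple :: "('x::linordered_ab_group_add, 'y::linordered_ab_group_add) root_datum
    \<Rightarrow> 'x \<Rightarrow> ('x, 'y) twisted"
  where "T_simple D \<alpha> = tmul D (delta_d (refl D \<alpha>))
    (scal (PP (zz \<alpha>) (la (coroot D \<alpha>)))
      + tmul D (scal (QQ (zz \<alpha>) (la (coroot D \<alpha>)))) (delta (refl D \<alpha>)))"

text \<open>
  The Weyl group relations \<open>(T\<^sub>\<alpha> T\<^sub>\<beta>)\<^sup>m = 1\<close> for \<open>m\<close> a multiple of the order of \<open>s\<^sub>\<alpha> s\<^sub>\<beta>\<close>;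
  the case of equal simple roots and \<open>m = 1\<close> is the quadratic relation.
\<close>

definition weyl_relations ::
  "('x::linordered_ab_group_add, 'y::linordered_ab_group_add) root_datum \<Rightarrow> bool"
  where "weyl_relations D \<longleftrightarrow>
    (\<forall>\<alpha>\<in>simples D. \<forall>\<beta>\<in>simples D. \<forall>m. (refl D \<alpha> \<circ> refl D \<beta>) ^^ m = id \<longrightarrow>
       (tmul D (tmul D (T_simple D \<alpha>) (T_simple D \<beta>)) ^^ m) (scal 1) = scal 1)"

text \<open>By the Weyl group relations the choice of the reduced word is immaterial.\<close>

definition T_elt :: "('x::linordered_ab_group_add, 'y::linordered_ab_group_add) root_datum
    \<Rightarrow> ('x \<Rightarrow> 'x) \<Rightarrow> ('x, 'y) twisted"
  where "T_elt D w =
    foldr (tmul D) (map (T_simple D) (SOME \<alpha>s. reduced_word D w \<alpha>s)) (scal 1)"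

definition b_coeff :: "('x::linordered_ab_group_add, 'y::linordered_ab_group_add) root_datum
    \<Rightarrow> ('x \<Rightarrow> 'x) \<Rightarrow> ('x \<Rightarrow> 'x) \<Rightarrow> ('x, 'y) ell"
  where "b_coeff D u = (THE b. (\<forall>w. \<not> bruhat_le D w u \<longrightarrow> b w = 0) \<and>
    delta u = (\<Sum>w | bruhat_le D w u. tmul D (scal (b w)) (tmul D (delta_d (inv w)) (T_elt D w))))"


subsection \<open>Parabolic elliptic Schubert classes\<close>

text \<open>
  A standard parabolic is given by the set \<open>SP\<close> of simple roots of its Levi part.  The
  lattice \<open>\<Lambda>\<^sup>P\<close> is regarded as the sublattice of \<open>\<Lambda>\<close> of elements with vanishing
  \<open>\<alpha>\<^sup>\<or>\<close>-coordinates for \<open>\<alpha>\<close> in \<open>SP\<close>, so that \<open>\<Q>\<^sup>P\<close> is regarded as a subfield of \<open>\<Q>\<close>.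
  The lattice map sends the coroot of \<open>\<alpha>\<close> to minus \<open>hb\<close> for \<open>\<alpha>\<close> in \<open>SP\<close>.
\<close>

definition lat_proj :: "('x, 'y::ab_group_add) root_datum \<Rightarrow> 'x set \<Rightarrow> ('x, 'y) lat \<Rightarrow> ('x, 'y) lat"
  where "lat_proj D SP m = (case m of (x, y, k) \<Rightarrow>
    (x, \<Sum>\<alpha>\<in>simples D - SP. coroot_coord D y \<alpha> \<bullet> coroot D \<alpha>, k - (\<Sum>\<alpha>\<in>SP. coroot_coord D y \<alpha>)))"

definition spec_P :: "('x::linordered_ab_group_add, 'y::linordered_ab_group_add) root_datum
    \<Rightarrow> 'x set \<Rightarrow> ('x, 'y) ell \<Rightarrow> ('x, 'y) ell"
  where "spec_P D SP c = subst_frac (lat_proj D SP) c"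

definition ell_class :: "('x::linordered_ab_group_add, 'y::linordered_ab_group_add) root_datum
    \<Rightarrow> 'x set \<Rightarrow> ('x \<Rightarrow> 'x) \<Rightarrow> ('x \<Rightarrow> 'x) \<Rightarrow> ('x, 'y) ell"
  where "ell_class D SP w u = spec_P D SP (b_coeff D u w)"


subsection \<open>Subwords of a fixed expression\<close>

text \<open>
  Below \<open>\<alpha>s\<close> is the list of the simple roots of an expression.  Positions are counted from
  1, so the simple root in position \<open>j\<close> is \<open>\<alpha>s ! (j - 1)\<close>.
\<close>

definition eps_refl :: "('x::ab_group_add, 'y) root_datum \<Rightarrow> 'x list \<Rightarrow> nat set \<Rightarrow> nat \<Rightarrow> 'x \<Rightarrow> 'x"
  where "eps_refl D \<alpha>s J j = (if j \<in> J then refl D (\<alpha>s ! (j - 1)) else id)"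

text \<open>The product of the factors in positions j, ..., l; for j = 1 this is w(J).\<close>

definition sub_suffix :: "('x::ab_group_add, 'y) root_datum \<Rightarrow> 'x list \<Rightarrow> nat set \<Rightarrow> nat \<Rightarrow> 'x \<Rightarrow> 'x"
  where "sub_suffix D \<alpha>s J j = foldr (\<circ>) (map (eps_refl D \<alpha>s J) [j..<Suc (length \<alpha>s)]) id"

definition beta_root :: "('x::ab_group_add, 'y) root_datum \<Rightarrow> 'x list \<Rightarrow> nat \<Rightarrow> 'x"
  where "beta_root D \<alpha>s j = word_prod D (take (j - 1) \<alpha>s) (\<alpha>s ! (j - 1))"

definition gamma_coroot :: "('x::ab_group_add, 'y) root_datum \<Rightarrow> 'x list \<Rightarrow> nat set \<Rightarrow> nat \<Rightarrow> 'y"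
  where "gamma_coroot D \<alpha>s J j =
    coact D (foldr (\<circ>) (map (eps_refl D \<alpha>s J) (rev [Suc j..<Suc (length \<alpha>s)])) id)
      (coroot D (\<alpha>s ! (j - 1)))"

end

theory Submission
  imports Defs
begin

text \<open>
  The quadratic identities between P and Q turn the definition of \<open>T\<^sub>\<alpha>\<close> into
  \<open>\<delta>\<^sub>s = P(\<lambda>, z) + Q(\<lambda>, z) \<delta>\<^sup>d\<^sub>s T\<^sub>s\<close>, where s is the reflection in \<open>\<alpha>\<close>.  Hence left multiplication by \<open>\<delta>\<^sub>s\<close>
  sends \<open>\<delta>\<^sup>d\<close> of the inverse of v, times \<open>T\<^sub>v\<close>, to a combination of this element and the one
  for \<open>s v\<close>, with coefficients P and Q evaluated at the cocharacter obtained by applying the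
  inverse of v to the coroot of \<open>\<alpha>\<close>.  Multiplying the letters of an expression of u from right to left,
  one expands \<open>\<delta>\<^sub>u\<close> into a sum over all subwords, and the elements \<open>\<delta>\<^sup>d T\<^sub>v\<close> are linearly independent
  because they are triangular for the length, so this sum computes the coefficients b.
  If the suffixes of a subword do not all lie in \<open>W\<^sup>P\<close>, then at the last position where this fails
  \<open>s v = v s'\<close> with \<open>s'\<close> a simple reflection of P; the corresponding factor is Q evaluated at a simple coroot of P,
  and it specializes to 0 because \<open>\<theta>(0) = 0\<close>.
\<close>

subsection \<open>Integer multiples in abelian groups\<close>

text \<open>Two obstacles shape the proof. A factor can be specialized only if its denominator,
  theta(beta + hbar) theta(gamma) with gamma a coroot, survives. It does because the simple-coroot
  coordinates of a coroot have a common sign. The axioms give signs only for roots; an invariant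
  form carries them over to coroots, once the axioms have been shown to force \<open>coroot D (refl
  D \<alpha> \<beta>) = corefl D \<alpha> (coroot D \<beta>)\<close>. Second, \<open>T_elt\<close>
  depends on a chosen reduced word and \<open>b_coeff\<close> is described by its support in a
  Bruhat interval. The rule T_s T_w = T_(s w) therefore rests on Matsumoto's theorem for operators.
  Since subwords of an unreduced expression of u may fail to lie below u, the coefficients are
  identified on a reduced expression first and then transferred by linear independence.\<close>

lemma zscale_0_left [simp]: "0 \<bullet> x = 0"
  by (simp add: zscale_def)

lemma zscale_plus_1: "(k + 1) \<bullet> x = x + k \<bullet> x"
proof (cases "0 \<le> k")
  case True
  then show ?thesis by (simp add: zscale_def nat_add_distrib)
next
  case False
  define m where "m = nat (- (k + 1))"
  have k: "k = - int (Suc m)" using False by (simp add: m_def)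
  show ?thesis
    by (cases m) (simp_all add: k zscale_def nat_add_distrib)
qed

lemma zscale_minus_1: "(k - 1) \<bullet> x = k \<bullet> x - x"
  using zscale_plus_1[of "k - 1" x] by simp

lemma zscale_add_left: "(k + l) \<bullet> x = k \<bullet> x + l \<bullet> x"
proof (induction l rule: int_induct[where k = 0])
  case base
  show ?case by simp
next
  case (step1 i)
  have "(k + (i + 1)) \<bullet> x = ((k + i) + 1) \<bullet> x" by (simp add: algebra_simps)
  then show ?case unfolding zscale_plus_1 step1 by (simp add: algebra_simps)
next
  case (step2 i)
  have "(k + (i - 1)) \<bullet> x = ((k + i) - 1) \<bullet> x" by (simp add: algebra_simps)
  then show ?case unfolding zscale_minus_1 step2 by (simp add: algebra_simps)
qed

lemma zscale_minus_left: "(- k) \<bullet> x = - (k \<bullet> x)"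
  using zscale_add_left[of k "- k" x] by (simp add: eq_neg_iff_add_eq_0 add.commute)

lemma zscale_diff_left: "(k - l) \<bullet> x = k \<bullet> x - l \<bullet> x"
  using zscale_add_left[of k "- l" x] by (simp add: zscale_minus_left)

lemma zscale_1 [simp]: "1 \<bullet> x = x"
  using zscale_plus_1[of 0 x] by simp

lemma additive_zscale_arg:
  assumes "additive f"
  shows "f (k \<bullet> x) = k \<bullet> f x"
proof (induction k rule: int_induct[where k = 0])
  case base
  show ?case by (simp add: additive.zero[OF assms])
next
  case (step1 i)
  then show ?case by (simp add: zscale_plus_1 additive.add[OF assms])
next
  case (step2 i)
  then show ?case by (simp add: zscale_minus_1 additive.diff[OF assms])
qed

lemma zscale_int [simp]: "k \<bullet> (m::int) = k * m"
proof (induction k rule: int_induct[where k = 0])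
  case (step1 i)
  then show ?case unfolding zscale_plus_1 by (simp add: algebra_simps)
next
  case (step2 i)
  then show ?case unfolding zscale_minus_1 by (simp add: algebra_simps)
qed simp

lemma additive_zscale: "additive (\<lambda>x. k \<bullet> x)"
proof
  fix x y :: 'a
  show "k \<bullet> (x + y) = k \<bullet> x + k \<bullet> y"
  proof (induction k rule: int_induct[where k = 0])
    case (step1 i)
    then show ?case unfolding zscale_plus_1 by (simp add: algebra_simps)
  next
    case (step2 i)
    then show ?case unfolding zscale_minus_1 by (simp add: algebra_simps)
  qed simp
qed

lemmas zscale_0_right [simp] = additive.zero[OF additive_zscale]
  and zscale_minus_right = additive.minus[OF additive_zscale]
  and zscale_sum_right = additive.sum[OF additive_zscale]

lemma additive_zscale_left: "additive (\<lambda>k. k \<bullet> x)"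
  by standard (rule zscale_add_left)

lemma zscale_mult: "(k * l) \<bullet> x = k \<bullet> l \<bullet> x"
  using additive_zscale_arg[OF additive_zscale_left, of k l x] by simp

lemma zscale_pos:
  fixes x :: "'a::linordered_ab_group_add"
  assumes "0 < k" "0 < x"
  shows "0 < k \<bullet> x"
  using assms(1)
proof (induction k rule: int_gr_induct)
  case base
  then show ?case using assms by (simp add: zscale_plus_1)
next
  case (step i)
  then show ?case using assms by (simp add: zscale_plus_1 add_pos_pos)
qed

text \<open>A linearly ordered group is torsion-free: positive multiples of positive elements stay
  positive, and changes of sign reduce the other cases to this one.\<close>

lemma zscale_eq_0_iff [simp]:
  fixes x :: "'a::linordered_ab_group_add"
  shows "k \<bullet> x = 0 \<longleftrightarrow> k = 0 \<or> x = 0"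
proof
  assume *: "k \<bullet> x = 0"
  have "l \<bullet> y \<noteq> 0" if "0 < l" "y \<noteq> 0" for l and y :: 'a
  proof (cases "0 < y")
    case True
    with zscale_pos[OF that(1)] show ?thesis by force
  next
    case False
    then have "0 < - y" using that by auto
    from zscale_pos[OF that(1) this] show ?thesis by (auto simp: zscale_minus_right)
  qed
  from this[of k x] this[of "- k" x] * show "k = 0 \<or> x = 0"
    by (cases k "0 :: int" rule: linorder_cases) (auto simp: zscale_minus_left)
qed auto

subsection \<open>Lattice maps on series, theta functions and fractions\<close>

lemma poly_mapping_sum_single:
  assumes "finite S" "Poly_Mapping.keys f \<subseteq> S"
  shows "f = (\<Sum>k\<in>S. Poly_Mapping.single k (Poly_Mapping.lookup f k))"
  using assms
  by (intro poly_mapping_eqI) (auto simp: lookup_sum lookup_single when_def in_keys_iff)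

text \<open>The support is carried along so that the same rule serves the twisted algebra, where
  additivity of the action is available only for supports inside W x W.\<close>

lemma poly_mapping_keys_induct [consumes 1, case_names zero single add]:
  fixes f :: "'a \<Rightarrow>\<^sub>0 'b::comm_monoid_add"
  assumes keys: "Poly_Mapping.keys f \<subseteq> A"
    and zero: "P 0"
    and single: "\<And>k c. k \<in> A \<Longrightarrow> P (Poly_Mapping.single k c)"
    and add: "\<And>f g. Poly_Mapping.keys f \<subseteq> A \<Longrightarrow> Poly_Mapping.keys g \<subseteq> A \<Longrightarrow> P f \<Longrightarrow> P g \<Longrightarrow> P (f + g)"
  shows "P f"
proof -
  let ?s = "\<lambda>S. \<Sum>k\<in>S. Poly_Mapping.single k (Poly_Mapping.lookup f k)"
  have "P (?s S) \<and> Poly_Mapping.keys (?s S) \<subseteq> A" if "finite S" "S \<subseteq> A" for S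
    using that
  proof (induction S rule: finite_induct)
    case empty
    then show ?case using zero by simp
  next
    case (insert k S)
    have 1: "Poly_Mapping.keys (Poly_Mapping.single k (Poly_Mapping.lookup f k)) \<subseteq> A"
      using insert by simp
    with insert have "P (Poly_Mapping.single k (Poly_Mapping.lookup f k) + ?s S)"
      by (intro add single) auto
    moreover have "Poly_Mapping.keys (Poly_Mapping.single k (Poly_Mapping.lookup f k) + ?s S) \<subseteq> A"
      using insert 1 by (meson Poly_Mapping.keys_add le_sup_iff order_trans insert_subset)
    ultimately show ?case using insert by simp
  qed
  from this[OF finite_keys keys] show ?thesis
    using poly_mapping_sum_single[OF finite_keys order_refl, of f] by simp
qed

lemma alg_map_superset:
  assumes "finite S" "Poly_Mapping.keys f \<subseteq> S"
  shows "alg_map \<phi> f = (\<Sum>\<mu>\<in>S. Poly_Mapping.single (\<phi> \<mu>) (Poly_Mapping.lookup f \<mu>))"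
  unfolding alg_map_def using assms by (intro sum.mono_neutral_left) (auto simp: in_keys_iff)

lemma alg_map_single [simp]: "alg_map \<phi> (Poly_Mapping.single \<mu> c) = Poly_Mapping.single (\<phi> \<mu>) c"
  by (subst alg_map_superset[of "{\<mu>}"]) auto

lemma alg_map_0 [simp]: "alg_map \<phi> 0 = 0"
  by (simp add: alg_map_def)

lemma alg_map_add: "alg_map \<phi> (f + g) = alg_map \<phi> f + alg_map \<phi> g"
proof -
  let ?S = "Poly_Mapping.keys f \<union> Poly_Mapping.keys g"
  show ?thesis
    using Poly_Mapping.keys_add[of f g]
    by (subst (1 2 3) alg_map_superset[of ?S])
      (auto simp: lookup_add single_add sum.distrib)
qed

lemma additive_alg_map: "additive (alg_map \<phi>)"
  by standard (rule alg_map_add)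

lemma alg_map_mult:
  assumes "additive \<phi>"
  shows "alg_map \<phi> (f * g) = alg_map \<phi> f * alg_map \<phi> g"
proof -
  have 1: "alg_map \<phi> (Poly_Mapping.single \<mu> c * g) = Poly_Mapping.single (\<phi> \<mu>) c * alg_map \<phi> g" for \<mu> c
    using subset_UNIV[of "Poly_Mapping.keys g"]
    by (induction g rule: poly_mapping_keys_induct)
      (auto simp: mult_single additive.add[OF assms] alg_map_add distrib_left)
  show ?thesis
    using subset_UNIV[of "Poly_Mapping.keys f"]
    by (induction f rule: poly_mapping_keys_induct) (auto simp: 1 alg_map_add distrib_right)
qed

lemma alg_map_1:
  assumes "additive \<phi>"
  shows "alg_map \<phi> 1 = 1"
  unfolding single_one[symmetric] by (simp add: additive.zero[OF assms] del: single_one)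

lemma lookup_alg_map_inj:
  assumes "inj \<phi>"
  shows "Poly_Mapping.lookup (alg_map \<phi> f) (\<phi> \<mu>) = Poly_Mapping.lookup f \<mu>"
proof -
  have "Poly_Mapping.lookup (alg_map \<phi> f) (\<phi> \<mu>) =
      (\<Sum>\<nu>\<in>Poly_Mapping.keys f. if \<nu> = \<mu> then Poly_Mapping.lookup f \<nu> else 0)"
    unfolding alg_map_def lookup_sum
    by (intro sum.cong refl) (use assms in \<open>auto simp: lookup_single when_def inj_eq\<close>)
  then show ?thesis by (simp add: in_keys_iff)
qed

lemma alg_map_id [simp]: "alg_map (\<lambda>x. x) f = f"
  unfolding alg_map_def using poly_mapping_sum_single[OF finite_keys order_refl, of f] by simp

lemma alg_map_comp: "alg_map \<phi> (alg_map \<psi> f) = alg_map (\<lambda>x. \<phi> (\<psi> x)) f"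
  using subset_UNIV[of "Poly_Mapping.keys f"]
  by (induction f rule: poly_mapping_keys_induct) (auto simp: alg_map_add)

lemma series_map_nth [simp]: "series_map \<phi> F $ n = alg_map \<phi> (F $ n)"
  by (simp add: series_map_def)

lemma series_map_0 [simp]: "series_map \<phi> 0 = 0"
  by (rule fps_ext) simp

lemma series_map_add: "series_map \<phi> (F + G) = series_map \<phi> F + series_map \<phi> G"
  by (rule fps_ext) (simp add: alg_map_add)

lemma additive_series_map: "additive (series_map \<phi>)"
  by standard (rule series_map_add)

lemma series_map_mult:
  assumes "additive \<phi>"
  shows "series_map \<phi> (F * G) = series_map \<phi> F * series_map \<phi> G"
  by (rule fps_ext)
    (simp add: fps_mult_nth additive.sum[OF additive_alg_map] alg_map_mult[OF assms])

lemma series_map_const: "series_map \<phi> (fps_const c) = fps_const (alg_map \<phi> c)"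
  by (rule fps_ext) simp

lemma series_map_1:
  assumes "additive \<phi>"
  shows "series_map \<phi> 1 = 1"
  by (simp only: fps_const_1_eq_1[symmetric] series_map_const alg_map_1[OF assms])

lemma series_map_prod:
  assumes "additive \<phi>"
  shows "series_map \<phi> (\<Prod>i\<in>I. F i) = (\<Prod>i\<in>I. series_map \<phi> (F i))"
  by (induction I rule: infinite_finite_induct)
    (simp_all add: series_map_1[OF assms] series_map_mult[OF assms])

lemma series_map_X_power_mult:
  "series_map \<phi> (fps_X ^ n * F) = fps_X ^ n * series_map \<phi> F"
  by (rule fps_ext) (simp add: fps_X_power_mult_nth)

lemma series_map_eq_0_iff:
  assumes "inj \<phi>"
  shows "series_map \<phi> F = 0 \<longleftrightarrow> F = 0"
proof
  assume *: "series_map \<phi> F = 0"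
  have "Poly_Mapping.lookup (F $ n) \<mu> = 0" for n \<mu>
    using lookup_alg_map_inj[OF assms, of "F $ n" \<mu>] arg_cong[OF *, of "\<lambda>G. G $ n"] by simp
  then show "F = 0" by (intro fps_ext poly_mapping_eqI) simp
qed simp

lemma series_map_id [simp]: "series_map (\<lambda>x. x) F = F"
  by (rule fps_ext) simp

lemma series_map_comp: "series_map \<phi> (series_map \<psi> F) = series_map (\<lambda>x. \<phi> (\<psi> x)) F"
  by (rule fps_ext) (simp add: alg_map_comp)

section \<open>Theta functions under lattice maps; oddness and vanishing\<close>

definition theta_prod :: "'a::linordered_ab_group_add \<Rightarrow> 'a gseries"
  where "theta_prod u = lim (\<lambda>N. \<Prod>n=1..N. theta_factor u n)"

lemma tendsto_theta_prod: "(\<lambda>N. \<Prod>n=1..N. theta_factor u n) \<longlonglongrightarrow> theta_prod u"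
  using theta_product_convergent[of u] by (simp add: convergent_LIMSEQ_iff theta_prod_def)

lemma theta_eq: "theta u = fps_const (ex u - ex (- u)) * theta_prod u"
  by (simp add: theta_def theta_prod_def)

lemma theta_prod_nth_0: "theta_prod u $ 0 = 1"
proof -
  have "(\<Prod>n=1..N. theta_factor u n) $ 0 = 1" for N
    by (induction N) (simp_all add: theta_factor_nth_0)
  moreover have "eventually (\<lambda>N. (\<Prod>n=1..N. theta_factor u n) $ 0 = theta_prod u $ 0) sequentially"
    using tendsto_theta_prod[of u] unfolding tendsto_fps_iff by blast
  ultimately show ?thesis by (auto simp: eventually_sequentially)
qed

lemma alg_map_ex: "alg_map \<phi> (ex \<mu>) = ex (\<phi> \<mu>)"
  by (simp add: ex_def)

lemma series_map_theta_factor: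
  assumes "additive \<phi>"
  shows "series_map \<phi> (theta_factor u n) = theta_factor (\<phi> u) n"
  unfolding theta_factor_def
  by (simp add: series_map_mult[OF assms] additive.diff[OF additive_series_map] series_map_1[OF assms]
      series_map_X_power_mult series_map_const alg_map_ex additive.add[OF assms]
      additive.minus[OF assms] additive.diff[OF assms])

text \<open>The map acts coefficientwise, and each coefficient of the partial products is eventually
  constant, so the map commutes with the q-adic limit.\<close>

lemma series_map_theta_prod:
  assumes "additive \<phi>"
  shows "series_map \<phi> (theta_prod u) = theta_prod (\<phi> u)"
proof -
  have "(\<lambda>N. series_map \<phi> (\<Prod>n=1..N. theta_factor u n)) \<longlonglongrightarrow> series_map \<phi> (theta_prod u)"
  proof (rule tendsto_fpsI)
    fix k
    have "eventually (\<lambda>N. (\<Prod>n=1..N. theta_factor u n) $ k = theta_prod u $ k) sequentially"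
      using tendsto_theta_prod[of u] unfolding tendsto_fps_iff by blast
    then show "eventually (\<lambda>N. series_map \<phi> (\<Prod>n=1..N. theta_factor u n) $ k
        = series_map \<phi> (theta_prod u) $ k) sequentially"
      by (rule eventually_mono) simp
  qed
  then have "(\<lambda>N. \<Prod>n=1..N. theta_factor (\<phi> u) n) \<longlonglongrightarrow> series_map \<phi> (theta_prod u)"
    by (simp only: series_map_prod[OF assms] series_map_theta_factor[OF assms])
  then show ?thesis unfolding theta_prod_def by (intro limI[symmetric])
qed

lemma series_map_theta:
  assumes "additive \<phi>"
  shows "series_map \<phi> (theta u) = theta (\<phi> u)"
  unfolding theta_eq
  by (simp add: series_map_mult[OF assms] series_map_theta_prod[OF assms] series_map_const
      additive.diff[OF additive_alg_map] alg_map_ex additive.minus[OF assms])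

lemma theta_0 [simp]: "theta 0 = 0"
  by (simp add: theta_eq)

lemma theta_minus: "theta (- u) = - theta u"
proof -
  have "theta_factor (- u) = theta_factor u"
    by (rule ext) (simp add: theta_factor_def algebra_simps)
  then have "theta_prod (- u) = theta_prod u" by (simp only: theta_prod_def)
  moreover have "fps_const (ex (- u) - ex u) = - fps_const (ex u - ex (- u))"
    by simp
  ultimately show ?thesis unfolding theta_eq by (simp only: minus_minus minus_mult_left)
qed

text \<open>The infinite product has constant term 1, so the coefficient of q^0 in theta is e^(pi i
  u) - e^(-pi i u). This vanishes only for u = -u, which forces u = 0 in an ordered group.\<close>

lemma theta_eq_0_iff [simp]: "theta u = 0 \<longleftrightarrow> u = 0"
proof
  assume "theta u = 0"
  then have "theta u $ 0 = 0" by simp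
  then have "ex u = ex (- u)" by (simp add: theta_eq theta_prod_nth_0)
  then have "Poly_Mapping.lookup (ex u) u = Poly_Mapping.lookup (ex (- u)) u" by simp
  then show "u = 0" by (simp add: ex_def lookup_single when_def split: if_splits)
qed simp

text \<open>For additive \<phi> these are the elements of the localization at the kernel of the
  induced ring map. It is a subring, on which substitution is a ring map; elsewhere the description
  in \<open>subst_frac\<close> has no witness.\<close>

definition specializable :: "('a::linordered_ab_group_add \<Rightarrow> 'b::linordered_ab_group_add) \<Rightarrow> 'a gseries fract \<Rightarrow> bool"
  where "specializable \<phi> c \<longleftrightarrow> (\<exists>f g. c = Fract f g \<and> series_map \<phi> g \<noteq> 0)"

lemma specializableE:
  assumes "specializable \<phi> c"
  obtains f g where "c = Fract f g" "g \<noteq> 0" "series_map \<phi> g \<noteq> 0"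
  using assms unfolding specializable_def by (metis series_map_0)

lemma specializable_Fract: "series_map \<phi> g \<noteq> 0 \<Longrightarrow> specializable \<phi> (Fract f g)"
  by (auto simp: specializable_def)

text \<open>Two fractions for the same element have equal cross products. The series map is
  multiplicative and therefore preserves this equality, so the image does not depend on the
  fraction.\<close>

lemma subst_frac_Fract:
  fixes \<phi> :: "'a::linordered_ab_group_add \<Rightarrow> 'b::linordered_ab_group_add"
  assumes "additive \<phi>" "series_map \<phi> g \<noteq> 0"
  shows "subst_frac \<phi> (Fract f g) = Fract (series_map \<phi> f) (series_map \<phi> g)"
  unfolding subst_frac_def
proof (rule the_equality)
  show "\<exists>f' g'. Fract f g = Fract f' g' \<and> series_map \<phi> g' \<noteq> 0 \<and>
      Fract (series_map \<phi> f) (series_map \<phi> g) = Fract (series_map \<phi> f') (series_map \<phi> g')"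
    using assms by blast
next
  fix d
  assume "\<exists>f' g'. Fract f g = Fract f' g' \<and> series_map \<phi> g' \<noteq> 0 \<and>
      d = Fract (series_map \<phi> f') (series_map \<phi> g')"
  then obtain f' g' where *: "Fract f g = Fract f' g'" "series_map \<phi> g' \<noteq> 0"
    "d = Fract (series_map \<phi> f') (series_map \<phi> g')" by blast
  have "g \<noteq> 0" "g' \<noteq> 0" using assms * by auto
  then have "f * g' = f' * g" using *(1) by (simp add: eq_fract)
  then have "series_map \<phi> f * series_map \<phi> g' = series_map \<phi> f' * series_map \<phi> g"
    by (metis series_map_mult[OF assms(1)])
  then show "d = Fract (series_map \<phi> f) (series_map \<phi> g)"
    using * assms by (simp add: eq_fract)
qed

context
  fixes \<phi> :: "'a::linordered_ab_group_add \<Rightarrow> 'b::linordered_ab_group_add"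
  assumes \<phi>: "additive \<phi>"
begin

lemma specializable_0: "specializable \<phi> 0" and specializable_1: "specializable \<phi> 1"
  by (auto simp: fract_expand series_map_1[OF \<phi>] intro!: specializable_Fract)

lemma subst_frac_0: "subst_frac \<phi> 0 = 0"
  unfolding fract_expand by (simp add: subst_frac_Fract[OF \<phi>] series_map_1[OF \<phi>])

lemma subst_frac_1: "subst_frac \<phi> 1 = 1"
  unfolding fract_expand by (simp add: subst_frac_Fract[OF \<phi>] series_map_1[OF \<phi>])

lemma subst_frac_add:
  assumes "specializable \<phi> c" "specializable \<phi> d"
  shows "subst_frac \<phi> (c + d) = subst_frac \<phi> c + subst_frac \<phi> d" "specializable \<phi> (c + d)"
proof -
  obtain f g where 1: "c = Fract f g" "g \<noteq> 0" "series_map \<phi> g \<noteq> 0"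
    using assms specializableE by blast
  obtain f' g' where 2: "d = Fract f' g'" "g' \<noteq> 0" "series_map \<phi> g' \<noteq> 0"
    using assms specializableE by blast
  show "subst_frac \<phi> (c + d) = subst_frac \<phi> c + subst_frac \<phi> d" "specializable \<phi> (c + d)"
    using 1 2 by (auto simp: subst_frac_Fract[OF \<phi>] series_map_mult[OF \<phi>] series_map_add
        intro!: specializable_Fract)
qed

lemma subst_frac_mult:
  assumes "specializable \<phi> c" "specializable \<phi> d"
  shows "subst_frac \<phi> (c * d) = subst_frac \<phi> c * subst_frac \<phi> d" "specializable \<phi> (c * d)"
proof -
  obtain f g where 1: "c = Fract f g" "g \<noteq> 0" "series_map \<phi> g \<noteq> 0"
    using assms specializableE by blast
  obtain f' g' where 2: "d = Fract f' g'" "g' \<noteq> 0" "series_map \<phi> g' \<noteq> 0"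
    using assms specializableE by blast
  show "subst_frac \<phi> (c * d) = subst_frac \<phi> c * subst_frac \<phi> d" "specializable \<phi> (c * d)"
    using 1 2 by (auto simp: subst_frac_Fract[OF \<phi>] series_map_mult[OF \<phi>]
        intro!: specializable_Fract)
qed

lemma subst_frac_sum:
  assumes "\<And>i. i \<in> I \<Longrightarrow> specializable \<phi> (c i)"
  shows "subst_frac \<phi> (sum c I) = (\<Sum>i\<in>I. subst_frac \<phi> (c i))" "specializable \<phi> (sum c I)"
  using assms
  by (induction I rule: infinite_finite_induct)
    (simp_all add: subst_frac_0 specializable_0 subst_frac_add)

lemma subst_frac_prod:
  assumes "\<And>i. i \<in> I \<Longrightarrow> specializable \<phi> (c i)"
  shows "subst_frac \<phi> (prod c I) = (\<Prod>i\<in>I. subst_frac \<phi> (c i))" "specializable \<phi> (prod c I)"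
  using assms
  by (induction I rule: infinite_finite_induct)
    (simp_all add: subst_frac_1 specializable_1 subst_frac_mult)

end

lemma specializable_inj:
  assumes "inj \<phi>"
  shows "specializable \<phi> c"
  by (cases c) (auto simp: series_map_eq_0_iff[OF assms] intro!: specializable_Fract)

lemma subst_frac_eq_0_iff:
  assumes "additive \<phi>" "inj \<phi>"
  shows "subst_frac \<phi> c = 0 \<longleftrightarrow> c = 0"
proof (cases c)
  case (Fract f g)
  then have "series_map \<phi> g \<noteq> 0" by (simp add: series_map_eq_0_iff[OF assms(2)])
  then show ?thesis using Fract assms
    by (simp add: subst_frac_Fract Zero_fract_def eq_fract series_map_eq_0_iff)
qed

lemma subst_frac_id [simp]: "subst_frac (\<lambda>x. x) c = c"
  by (cases c) (simp add: subst_frac_Fract additive_def)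

lemma subst_frac_comp:
  assumes "additive \<phi>" "inj \<phi>" "additive \<psi>" "inj \<psi>"
  shows "subst_frac \<phi> (subst_frac \<psi> c) = subst_frac (\<lambda>x. \<phi> (\<psi> x)) c"
proof (cases c)
  case (Fract f g)
  have 1: "additive (\<lambda>x. \<phi> (\<psi> x))"
    by standard (simp add: additive.add[OF assms(1)] additive.add[OF assms(3)])
  have 2: "inj (\<lambda>x. \<phi> (\<psi> x))" using assms by (simp add: inj_def)
  show ?thesis using Fract
    by (simp add: subst_frac_Fract 1 assms series_map_eq_0_iff 2 series_map_comp)
qed

text \<open>Both P and Q are quotients of this shape. Substituting in them thus only requires that
  the two arguments in the denominator have nonzero images.\<close>

lemma subst_frac_theta:
  assumes "additive \<phi>" "\<phi> b \<noteq> 0" "\<phi> d \<noteq> 0"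
  shows "subst_frac \<phi> (Fract (theta a * theta a') (theta b * theta d))
      = Fract (theta (\<phi> a) * theta (\<phi> a')) (theta (\<phi> b) * theta (\<phi> d))"
    "specializable \<phi> (Fract (theta a * theta a') (theta b * theta d))"
  using assms
  by (auto simp: subst_frac_Fract series_map_mult series_map_theta intro!: specializable_Fract)

subsection \<open>Root data and positivity of coroots\<close>

text \<open>By torsion-freeness a progression with nonzero difference has infinitely many terms. The
  finiteness of the root system is exploited through this fact.\<close>

lemma arithmetic_progression_constant:
  fixes \<gamma> :: "'a::linordered_ab_group_add"
  assumes "finite A" "\<And>n::nat. x + (int n * k) \<bullet> \<gamma> \<in> A"
  shows "k = 0 \<or> \<gamma> = 0"
proof (rule ccontr)
  assume *: "\<not> (k = 0 \<or> \<gamma> = 0)"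
  have "inj (\<lambda>n::nat. x + (int n * k) \<bullet> \<gamma>)"
  proof (rule injI)
    fix m n :: nat
    assume "x + (int m * k) \<bullet> \<gamma> = x + (int n * k) \<bullet> \<gamma>"
    then have "(int m * k - int n * k) \<bullet> \<gamma> = 0" by (simp add: zscale_diff_left)
    with * show "m = n" by simp
  qed
  then have "infinite (range (\<lambda>n::nat. x + (int n * k) \<bullet> \<gamma>))"
    by (simp add: finite_image_iff)
  moreover have "range (\<lambda>n::nat. x + (int n * k) \<bullet> \<gamma>) \<subseteq> A" using assms(2) by auto
  ultimately show False using assms(1) finite_subset by blast
qed

lemma word_prod_Nil [simp]: "word_prod D [] = id"
  and word_prod_Cons [simp]: "word_prod D (a # as) = refl D a \<circ> word_prod D as"
  by (simp_all add: word_prod_def)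

lemma word_prod_append: "word_prod D (as @ bs) = word_prod D as \<circ> word_prod D bs"
  by (induction as) (simp_all add: comp_assoc)

context simply_connected_root_datum
begin

lemma finite_simples: "finite (simples D)"
  using finite_subset[OF simples_roots finite_roots] .

lemma simple_root: "\<alpha> \<in> simples D \<Longrightarrow> \<alpha> \<in> roots D"
  using simples_roots by blast

lemma pairing_add_l: "pairing D (x + x') y = pairing D x y + pairing D x' y"
  using additive.add[OF pairing_add_left] .

lemma pairing_diff_l: "pairing D (x - x') y = pairing D x y - pairing D x' y"
  using additive.diff[OF pairing_add_left] .

lemma pairing_minus_l: "pairing D (- x) y = - pairing D x y"
  using additive.minus[OF pairing_add_left] .

lemma pairing_0_l: "pairing D 0 y = 0"
  using additive.zero[OF pairing_add_left] .

lemma pairing_zscale_l: "pairing D (k \<bullet> x) y = k * pairing D x y"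
  using additive_zscale_arg[OF pairing_add_left] by simp

lemma pairing_sum_l: "pairing D (\<Sum>i\<in>I. f i) y = (\<Sum>i\<in>I. pairing D (f i) y)"
  using additive.sum[OF pairing_add_left] .

lemma pairing_add_r: "pairing D x (y + y') = pairing D x y + pairing D x y'"
  using additive.add[OF pairing_add_right] .

lemma pairing_diff_r: "pairing D x (y - y') = pairing D x y - pairing D x y'"
  using additive.diff[OF pairing_add_right] .

lemma pairing_0_r: "pairing D x 0 = 0"
  using additive.zero[OF pairing_add_right] .

lemma pairing_zscale_r: "pairing D x (k \<bullet> y) = k * pairing D x y"
  using additive_zscale_arg[OF pairing_add_right] by simp

lemma pairing_sum_r: "pairing D x (\<Sum>i\<in>I. f i) = (\<Sum>i\<in>I. pairing D x (f i))"
  using additive.sum[OF pairing_add_right] .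

lemma pairing_ext_r:
  assumes "\<And>x. pairing D x y = pairing D x y'"
  shows "y = y'"
  using perfect_right[OF pairing_add_left[of y]] assms by metis

lemma root_nonzero: "\<beta> \<in> roots D \<Longrightarrow> \<beta> \<noteq> 0"
  using pairing_coroot[of \<beta>] by (auto simp: pairing_0_l)

lemma coroot_nonzero: "\<beta> \<in> roots D \<Longrightarrow> coroot D \<beta> \<noteq> 0"
  using pairing_coroot[of \<beta>] by (auto simp: pairing_0_r)

lemma additive_refl: "additive (refl D \<alpha>)"
  by standard (simp add: refl_def pairing_add_l zscale_add_left)

lemma refl_self: "\<alpha> \<in> roots D \<Longrightarrow> refl D \<alpha> \<alpha> = - \<alpha>"
  using zscale_plus_1[of 1 \<alpha>] by (simp add: refl_def pairing_coroot)

lemma refl_refl [simp]: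
  assumes "\<alpha> \<in> roots D"
  shows "refl D \<alpha> (refl D \<alpha> x) = x"
proof -
  have "refl D \<alpha> (refl D \<alpha> x) = refl D \<alpha> x - pairing D x (coroot D \<alpha>) \<bullet> refl D \<alpha> \<alpha>"
    by (subst (2) refl_def)
      (simp add: additive.diff[OF additive_refl] additive_zscale_arg[OF additive_refl])
  then show ?thesis by (simp add: refl_self assms) (simp add: refl_def zscale_minus_right)
qed

lemma refl_comp_refl: "\<alpha> \<in> roots D \<Longrightarrow> refl D \<alpha> \<circ> refl D \<alpha> = id"
  by (simp add: fun_eq_iff)

lemma pairing_refl: "pairing D (refl D \<alpha> x) y = pairing D x (corefl D \<alpha> y)"
  by (simp add: refl_def corefl_def pairing_diff_l pairing_diff_r pairing_zscale_l pairing_zscale_r)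

lemma corefl_corefl [simp]: "\<alpha> \<in> roots D \<Longrightarrow> corefl D \<alpha> (corefl D \<alpha> y) = y"
  by (rule pairing_ext_r) (simp flip: pairing_refl)

lemma neg_root: "\<beta> \<in> roots D \<Longrightarrow> - \<beta> \<in> roots D"
  using refl_root[of \<beta> \<beta>] by (simp add: refl_self)

lemma bij_betw_refl: "\<alpha> \<in> roots D \<Longrightarrow> bij_betw (refl D \<alpha>) (roots D) (roots D)"
  by (rule bij_betwI[where g = "refl D \<alpha>"]) (auto simp: refl_root)

text \<open>
  Both \<open>coroot D (refl D \<alpha> \<beta>)\<close> and \<open>corefl D \<alpha> (coroot D \<beta>)\<close> define reflections in the root
  \<open>refl D \<alpha> \<beta>\<close>; were they different, iterating the product of these two reflections would
  produce infinitely many roots.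
\<close>
lemma coroot_refl:
  assumes "\<alpha> \<in> roots D" "\<beta> \<in> roots D"
  shows "coroot D (refl D \<alpha> \<beta>) = corefl D \<alpha> (coroot D \<beta>)"
proof -
  define \<gamma> where "\<gamma> = refl D \<alpha> \<beta>"
  have \<gamma>: "\<gamma> \<in> roots D" using assms by (simp add: \<gamma>_def refl_root)
  obtain \<delta> where \<delta>: "\<delta> \<in> roots D" "coroot D \<delta> = corefl D \<alpha> (coroot D \<beta>)"
    using corefl_coroot[OF assms] by auto
  have \<gamma>\<delta>: "pairing D \<gamma> (coroot D \<delta>) = 2"
    using assms by (simp add: \<gamma>_def \<delta> pairing_refl pairing_coroot)
  define t where "t x = refl D \<alpha> (refl D \<beta> (refl D \<alpha> x))" for x
  have t: "t x = x - pairing D x (coroot D \<delta>) \<bullet> \<gamma>" for x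
    unfolding t_def refl_def[of D \<beta>] \<gamma>_def \<delta>(2)
    using assms by (simp add: additive.diff[OF additive_refl] additive_zscale_arg[OF additive_refl]
        pairing_refl)
  define f where "f x = pairing D x (coroot D \<gamma>) - pairing D x (coroot D \<delta>)" for x
  define h where "h x = t (refl D \<gamma> x)" for x
  have h: "h x = x + f x \<bullet> \<gamma>" for x
  proof -
    let ?a = "pairing D x (coroot D \<gamma>)" and ?d = "pairing D x (coroot D \<delta>)"
    have *: "pairing D (refl D \<gamma> x) (coroot D \<delta>) = ?d - ?a - ?a"
      by (simp add: refl_def pairing_diff_l pairing_zscale_l \<gamma>\<delta>)
    show ?thesis
      unfolding h_def t f_def * zscale_diff_left by (simp add: refl_def)
  qed
  have f_\<gamma>: "f \<gamma> = 0" using \<gamma> by (simp add: f_def \<gamma>\<delta> pairing_coroot)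
  have f_h: "f (x + k \<bullet> \<gamma>) = f x" for x k
    using f_\<gamma> by (simp add: f_def pairing_add_l pairing_zscale_l)
  have f_0: "f x = 0" if x: "x \<in> roots D" for x
  proof -
    have "(h ^^ n) x = x + (int n * f x) \<bullet> \<gamma>" for n
    proof (induction n)
      case (Suc n)
      have "(h ^^ Suc n) x = x + (int n * f x) \<bullet> \<gamma> + f x \<bullet> \<gamma>"
        by (simp add: Suc h f_h)
      also have "\<dots> = x + (int (Suc n) * f x) \<bullet> \<gamma>"
        by (simp add: zscale_add_left distrib_right add.assoc add.commute)
      finally show ?case .
    qed simp
    moreover have "(h ^^ n) x \<in> roots D" for n
      by (induction n) (use assms \<gamma> x in \<open>auto simp: h_def t_def refl_root\<close>)
    ultimately show ?thesis
      using arithmetic_progression_constant[OF finite_roots, of x "f x" \<gamma>] root_nonzero[OF \<gamma>] by simp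
  qed
  have \<delta>\<gamma>: "pairing D \<delta> (coroot D \<gamma>) = 2"
    using f_0[OF \<delta>(1)] \<delta>(1) by (simp add: f_def pairing_coroot)
  \<comment> \<open>Now both mixed pairings of \<gamma> and \<delta> equal 2. The product of their
    two reflections fixes \<gamma> - \<delta> and moves \<gamma> by twice this difference, so
    finiteness of the roots gives \<gamma> = \<delta>.\<close>
  define g where "g x = refl D \<gamma> (refl D \<delta> x)" for x
  have add_g: "g (x + y) = g x + g y" "g (k \<bullet> x) = k \<bullet> g x" for x y k
    by (simp_all add: g_def additive.add[OF additive_refl] additive_zscale_arg[OF additive_refl])
  have two: "2 \<bullet> x = x + x" for x :: 'x using zscale_plus_1[of 1 x] by simp
  have g_diff: "g (\<gamma> - \<delta>) = \<gamma> - \<delta>"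
    using \<gamma> \<delta>(1)
    by (simp add: g_def refl_def pairing_diff_l pairing_add_l \<gamma>\<delta> \<delta>\<gamma> pairing_coroot two)
  have g_\<gamma>: "g \<gamma> = \<gamma> + 2 \<bullet> (\<gamma> - \<delta>)"
    using \<gamma> \<delta>(1)
    by (simp add: g_def refl_def pairing_diff_l pairing_add_l \<gamma>\<delta> \<delta>\<gamma> pairing_coroot two
        zscale_minus_left)
  have "(g ^^ n) \<gamma> = \<gamma> + (int n * 2) \<bullet> (\<gamma> - \<delta>)" for n
  proof (induction n)
    case (Suc n)
    have "(g ^^ Suc n) \<gamma> = \<gamma> + 2 \<bullet> (\<gamma> - \<delta>) + (int n * 2) \<bullet> (\<gamma> - \<delta>)"
      by (simp add: Suc add_g g_diff g_\<gamma>)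
    also have "\<dots> = \<gamma> + (int (Suc n) * 2) \<bullet> (\<gamma> - \<delta>)"
      by (simp add: zscale_add_left distrib_right add.assoc)
    finally show ?case .
  qed simp
  moreover have "(g ^^ n) \<gamma> \<in> roots D" for n
    by (induction n) (use \<gamma> \<delta> in \<open>auto simp: g_def refl_root\<close>)
  ultimately have "\<gamma> = \<delta>"
    using arithmetic_progression_constant[OF finite_roots, of \<gamma> 2 "\<gamma> - \<delta>"] by simp
  with \<delta> show ?thesis by (simp add: \<gamma>_def)
qed

text \<open>The canonical Weyl-invariant form on characters. Pairing with the coroot of \<alpha>,
  times half the positive number \<open>root_form \<alpha> \<alpha>\<close>, is the form with
  \<alpha> itself; this is the bridge from roots to coroots.\<close>

definition root_form :: "'x \<Rightarrow> 'x \<Rightarrow> int"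
  where "root_form x x' = (\<Sum>\<gamma>\<in>roots D. pairing D x (coroot D \<gamma>) * pairing D x' (coroot D \<gamma>))"

text \<open>Moving the reflection to the other side of the pairing permutes the coroots, and hence
  the summands, by \<open>coroot_refl\<close>.\<close>

lemma root_form_refl:
  assumes "\<alpha> \<in> roots D"
  shows "root_form (refl D \<alpha> x) (refl D \<alpha> x') = root_form x x'"
  unfolding root_form_def
  by (rule sum.reindex_bij_betw[OF bij_betw_refl[OF assms], symmetric, THEN trans, OF _, symmetric])
    (simp add: pairing_refl coroot_refl assms)

lemma root_form_pos:
  assumes "\<alpha> \<in> roots D"
  shows "0 < root_form \<alpha> \<alpha>"
  unfolding root_form_def
  by (rule sum_pos2[OF finite_roots assms]) (use assms in \<open>auto simp: pairing_coroot\<close>)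

text \<open>Invariance replaces x and \<alpha> by their reflections, and the reflection of \<alpha>
  is its negative. Expanding the reflection of x then reproduces the left side with the opposite
  sign.\<close>

lemma two_root_form:
  assumes "\<alpha> \<in> roots D"
  shows "2 * root_form x \<alpha> = pairing D x (coroot D \<alpha>) * root_form \<alpha> \<alpha>"
proof -
  have "root_form x \<alpha> = root_form (refl D \<alpha> x) (- \<alpha>)"
    using root_form_refl[OF assms, of x \<alpha>] by (simp add: refl_self assms)
  also have "\<dots> = - root_form x \<alpha> + pairing D x (coroot D \<alpha>) * root_form \<alpha> \<alpha>"
    unfolding refl_def root_form_def
    by (simp add: pairing_minus_l pairing_diff_l pairing_zscale_l sum_negf sum_distrib_left
        algebra_simps sum.distrib flip: sum_subtractf)
  finally show ?thesis by simp
qed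

section \<open>Coordinates of coroots in the basis of simple coroots\<close>

lemma coroot_coord_unique:
  assumes "y = (\<Sum>\<beta>\<in>simples D. c \<beta> \<bullet> coroot D \<beta>)" "\<beta> \<in> simples D"
  shows "coroot_coord D y \<beta> = c \<beta>"
proof -
  \<comment> \<open>The coordinate function is required to vanish off the simple roots, so c has to
    be cut off there before uniqueness applies.\<close>
  let ?c = "\<lambda>\<beta>. if \<beta> \<in> simples D then c \<beta> else 0"
  have "coroot_coord D y = ?c"
    unfolding coroot_coord_def
    by (rule the1_equality[OF coroot_basis]) (simp add: assms)
  then show ?thesis using assms by simp
qed

lemma coroot_coord_expand: "y = (\<Sum>\<beta>\<in>simples D. coroot_coord D y \<beta> \<bullet> coroot D \<beta>)"
  using theI'[OF coroot_basis[of y]] unfolding coroot_coord_def by blast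

lemma additive_coroot_coord:
  assumes "\<beta> \<in> simples D"
  shows "additive (\<lambda>y. coroot_coord D y \<beta>)"
proof
  fix y y'
  have "y + y' = (\<Sum>\<beta>\<in>simples D. (coroot_coord D y \<beta> + coroot_coord D y' \<beta>) \<bullet> coroot D \<beta>)"
    unfolding zscale_add_left sum.distrib by (simp flip: coroot_coord_expand)
  then show "coroot_coord D (y + y') \<beta> = coroot_coord D y \<beta> + coroot_coord D y' \<beta>"
    using assms by (rule coroot_coord_unique)
qed

lemma coroot_coord_simple:
  assumes "\<alpha> \<in> simples D" "\<beta> \<in> simples D"
  shows "coroot_coord D (coroot D \<alpha>) \<beta> = (if \<beta> = \<alpha> then 1 else 0)"
  using assms(2)
proof (rule coroot_coord_unique[rotated])
  have "(\<Sum>\<beta>\<in>simples D. (if \<beta> = \<alpha> then 1 else 0) \<bullet> coroot D \<beta>)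
      = (\<Sum>\<beta>\<in>simples D. if \<beta> = \<alpha> then coroot D \<beta> else 0)"
    by (rule sum.cong) auto
  then show "coroot D \<alpha> = (\<Sum>\<beta>\<in>simples D. (if \<beta> = \<alpha> then 1 else 0) \<bullet> coroot D \<beta>)"
    using assms by (simp add: finite_simples)
qed

text \<open>By \<open>two_root_form\<close>, pairing x with
  \<open>root_form \<beta> \<beta> \<bullet> coroot D \<beta>\<close> gives twice the form of x and
  \<beta>. The latter is linear in \<beta>, so an expansion of the root in simple roots yields one
  of the rescaled coroot in simple coroots.\<close>

lemma coroot_coord_root:
  assumes "\<beta> \<in> roots D" "\<beta> = (\<Sum>\<delta>\<in>simples D. c \<delta> \<bullet> \<delta>)" "\<delta> \<in> simples D"
  shows "root_form \<beta> \<beta> * coroot_coord D (coroot D \<beta>) \<delta> = c \<delta> * root_form \<delta> \<delta>"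
proof -
  have "root_form \<beta> \<beta> \<bullet> coroot D \<beta> = (\<Sum>\<delta>\<in>simples D. (c \<delta> * root_form \<delta> \<delta>) \<bullet> coroot D \<delta>)"
  proof (rule pairing_ext_r)
    fix x
    have "pairing D x (root_form \<beta> \<beta> \<bullet> coroot D \<beta>) = 2 * root_form x \<beta>"
      by (simp add: two_root_form[OF assms(1)] pairing_zscale_r)
    also have "root_form x \<beta> = (\<Sum>\<delta>\<in>simples D. c \<delta> * root_form x \<delta>)"
      unfolding root_form_def sum_distrib_left
      by (subst assms(2), subst sum.swap)
        (simp add: pairing_sum_l pairing_zscale_l sum_distrib_left algebra_simps)
    also have "2 * \<dots> = (\<Sum>\<delta>\<in>simples D. c \<delta> * (2 * root_form x \<delta>))"
      by (simp add: sum_distrib_left algebra_simps)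
    also have "\<dots> = pairing D x (\<Sum>\<delta>\<in>simples D. (c \<delta> * root_form \<delta> \<delta>) \<bullet> coroot D \<delta>)"
      unfolding pairing_sum_r
      by (rule sum.cong) (simp_all add: two_root_form simple_root pairing_zscale_r)
    finally show "pairing D x (root_form \<beta> \<beta> \<bullet> coroot D \<beta>)
      = pairing D x (\<Sum>\<delta>\<in>simples D. (c \<delta> * root_form \<delta> \<delta>) \<bullet> coroot D \<delta>)" .
  qed
  from coroot_coord_unique[OF this assms(3)] show ?thesis
    using additive_zscale_arg[OF additive_coroot_coord[OF assms(3)], of "root_form \<beta> \<beta>" "coroot D \<beta>"]
    by simp
qed

text \<open>The norms in \<open>coroot_coord_root\<close> are positive, so each coordinate of the
  coroot has the sign of the corresponding coefficient of the root, and those coefficients share one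
  sign.\<close>

lemma coroot_coord_signs:
  assumes "\<beta> \<in> roots D"
  shows "(\<forall>\<delta>\<in>simples D. 0 \<le> coroot_coord D (coroot D \<beta>) \<delta>)
    \<or> (\<forall>\<delta>\<in>simples D. coroot_coord D (coroot D \<beta>) \<delta> \<le> 0)"
proof -
  obtain c where c: "\<forall>\<beta>. 0 \<le> c \<beta>" and
    "\<beta> = (\<Sum>\<beta>\<in>simples D. c \<beta> \<bullet> \<beta>) \<or> \<beta> = - (\<Sum>\<beta>\<in>simples D. c \<beta> \<bullet> \<beta>)"
    using root_pos_or_neg[OF assms] by blast
  from this(2) show ?thesis
  proof
    assume "\<beta> = (\<Sum>\<beta>\<in>simples D. c \<beta> \<bullet> \<beta>)"
    from coroot_coord_root[OF assms this] have "0 \<le> coroot_coord D (coroot D \<beta>) \<delta>" if "\<delta> \<in> simples D" for \<delta>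
      using that c root_form_pos[OF assms] root_form_pos[OF simple_root[OF that]]
      by (smt (verit) mult_nonneg_nonneg mult_pos_neg)
    then show ?thesis by blast
  next
    assume "\<beta> = - (\<Sum>\<beta>\<in>simples D. c \<beta> \<bullet> \<beta>)"
    then have "\<beta> = (\<Sum>\<beta>\<in>simples D. (- c \<beta>) \<bullet> \<beta>)" by (simp add: zscale_minus_left sum_negf)
    from coroot_coord_root[OF assms this] have "coroot_coord D (coroot D \<beta>) \<delta> \<le> 0" if "\<delta> \<in> simples D" for \<delta>
      using that c root_form_pos[OF assms] root_form_pos[OF simple_root[OF that]]
      by (smt (verit) mult_nonneg_nonneg mult_pos_pos mult_minus_left)
    then show ?thesis by blast
  qed
qed

section \<open>The lattice map of a parabolic\<close>

lemma additive_lat_proj: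
  assumes "SP \<subseteq> simples D"
  shows "additive (lat_proj D SP)"
proof
  fix m m' :: "('x, 'y) lat"
  have *: "coroot_coord D (y + y') \<alpha> = coroot_coord D y \<alpha> + coroot_coord D y' \<alpha>"
    if "\<alpha> \<in> simples D" for y y' \<alpha>
    using additive.add[OF additive_coroot_coord[OF that]] .
  have "(\<Sum>\<alpha>\<in>SP. coroot_coord D (y + y') \<alpha>) = (\<Sum>\<alpha>\<in>SP. coroot_coord D y \<alpha>) + (\<Sum>\<alpha>\<in>SP. coroot_coord D y' \<alpha>)" for y y'
    using assms by (auto simp: sum.distrib[symmetric] * intro!: sum.cong)
  moreover have "(\<Sum>\<alpha>\<in>simples D - SP. coroot_coord D (y + y') \<alpha> \<bullet> coroot D \<alpha>)
      = (\<Sum>\<alpha>\<in>simples D - SP. coroot_coord D y \<alpha> \<bullet> coroot D \<alpha>)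
      + (\<Sum>\<alpha>\<in>simples D - SP. coroot_coord D y' \<alpha> \<bullet> coroot D \<alpha>)" for y y'
    by (auto simp: sum.distrib[symmetric] * zscale_add_left intro!: sum.cong)
  ultimately show "lat_proj D SP (m + m') = lat_proj D SP m + lat_proj D SP m'"
    by (cases m; cases m') (simp add: lat_proj_def)
qed

lemma coroot_coord_0: "\<alpha> \<in> simples D \<Longrightarrow> coroot_coord D 0 \<alpha> = 0"
  using additive.zero[OF additive_coroot_coord] .

lemma lat_proj_zz_hb:
  assumes "SP \<subseteq> simples D"
  shows "lat_proj D SP (x, 0, k) = (x, 0, k)"
  using assms by (auto simp: lat_proj_def coroot_coord_0 subset_iff)

text \<open>The hbar-coordinate of the image is minus the sum of the coordinates over SP. As these
  share a sign, it vanishes only if each of them does; the remaining coordinates then make up the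
  whole coroot, which is nonzero. This keeps the denominators of P and Q alive under
  specialization.\<close>

lemma lat_proj_coroot_nonzero:
  assumes "SP \<subseteq> simples D" "\<beta> \<in> roots D"
  shows "lat_proj D SP (la (coroot D \<beta>)) \<noteq> 0"
proof
  let ?c = "coroot_coord D (coroot D \<beta>)"
  assume "lat_proj D SP (la (coroot D \<beta>)) = 0"
  then have 1: "(\<Sum>\<alpha>\<in>simples D - SP. ?c \<alpha> \<bullet> coroot D \<alpha>) = 0" and 2: "(\<Sum>\<alpha>\<in>SP. ?c \<alpha>) = 0"
    by (simp_all add: lat_proj_def la_def zero_prod_def)
  have fin: "finite SP" using assms finite_simples finite_subset by blast
  have 3: "\<forall>\<alpha>\<in>SP. ?c \<alpha> = 0"
  proof (cases "\<forall>\<delta>\<in>simples D. 0 \<le> ?c \<delta>")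
    case True
    then show ?thesis using 2 assms(1) fin by (subst (asm) sum_nonneg_eq_0_iff) auto
  next
    case False
    then have "\<forall>\<delta>\<in>simples D. ?c \<delta> \<le> 0" using coroot_coord_signs[OF assms(2)] by blast
    then show ?thesis using 2 assms(1) sum_nonneg_eq_0_iff[OF fin, of "\<lambda>\<alpha>. - ?c \<alpha>"]
      by (auto simp: sum_negf)
  qed
  have "coroot D \<beta> = (\<Sum>\<alpha>\<in>simples D. ?c \<alpha> \<bullet> coroot D \<alpha>)" by (rule coroot_coord_expand)
  also have "\<dots> = (\<Sum>\<alpha>\<in>simples D - SP. ?c \<alpha> \<bullet> coroot D \<alpha>)"
    using 3 finite_simples by (intro sum.mono_neutral_right) auto
  finally show False using 1 coroot_nonzero[OF assms(2)] by simp
qed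

lemma lat_proj_simple_coroot:
  assumes "SP \<subseteq> simples D" "\<alpha> \<in> SP"
  shows "lat_proj D SP (la (coroot D \<alpha>)) = - hb"
proof -
  have fin: "finite SP" using assms finite_simples finite_subset by blast
  have "(\<Sum>\<beta>\<in>simples D - SP. coroot_coord D (coroot D \<alpha>) \<beta> \<bullet> coroot D \<beta>) = 0"
    using assms by (intro sum.neutral) (auto simp: coroot_coord_simple subset_iff)
  moreover have "(\<Sum>\<beta>\<in>SP. coroot_coord D (coroot D \<alpha>) \<beta>) = (\<Sum>\<beta>\<in>SP. if \<beta> = \<alpha> then 1 else 0)"
    using assms by (intro sum.cong) (auto simp: coroot_coord_simple subset_iff)
  ultimately show ?thesis
    using assms fin by (simp add: lat_proj_def la_def hb_def)
qed

end

subsection \<open>The Weyl group: exchange, Matsumoto's theorem, minimal coset representatives\<close>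

text \<open>The words s t s t ... with k letters, which form the two sides of a braid
  relation.\<close>

fun alternating :: "'a \<Rightarrow> 'a \<Rightarrow> nat \<Rightarrow> 'a list" where
  "alternating s t 0 = []"
| "alternating s t (Suc k) = s # alternating t s k"

lemma length_alternating [simp]: "length (alternating s t k) = k"
  by (induction k arbitrary: s t) simp_all

lemma take_alternating: "n \<le> k \<Longrightarrow> take n (alternating s t k) = alternating s t n"
proof (induction k arbitrary: s t n)
  case (Suc k)
  then show ?case by (cases n) simp_all
qed simp

text \<open>Reversing a word inverts its product. Hence this identity of words makes the braid
  relation of length k equivalent to the relation that the k-th power of s t is 1.\<close>

lemma alternating_append_rev:
  "alternating s t k @ rev (alternating t s k) = concat (replicate k [s, t])"
proof (induction k arbitrary: s t)
  case (Suc k)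
  have *: "s # concat (replicate k [t, s]) @ [t] = concat (replicate (Suc k) [s, t])"
    by (induction k) simp_all
  have "alternating s t (Suc k) @ rev (alternating t s (Suc k))
      = s # (alternating t s k @ rev (alternating s t k)) @ [t]" by simp
  also have "\<dots> = concat (replicate (Suc k) [s, t])" unfolding Suc * ..
  finally show ?case .
qed simp

lemma foldr_concat_replicate: "foldr L (concat (replicate k [s, t])) f = ((L s \<circ> L t) ^^ k) f"
  by (induction k) simp_all

lemma word_prod_concat_replicate:
  "word_prod D (concat (replicate k [s, t])) = (refl D s \<circ> refl D t) ^^ k"
  by (induction k) (simp_all add: comp_assoc)

context simply_connected_root_datum
begin

section \<open>Positive roots\<close>

definition positive :: "'x \<Rightarrow> bool"
  where "positive \<beta> \<longleftrightarrow> \<beta> \<in> roots D \<and> (\<exists>c. (\<forall>\<alpha>. 0 \<le> c \<alpha>) \<and> \<beta> = (\<Sum>\<alpha>\<in>simples D. c \<alpha> \<bullet> \<alpha>))"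

lemma positive_root: "positive \<beta> \<Longrightarrow> \<beta> \<in> roots D"
  by (simp add: positive_def)

lemma positive_or: "\<beta> \<in> roots D \<Longrightarrow> positive \<beta> \<or> positive (- \<beta>)"
  using root_pos_or_neg[of \<beta>] neg_root[of \<beta>] unfolding positive_def by (metis minus_minus)

lemma simples_coeff_unique:
  assumes "(\<Sum>\<alpha>\<in>simples D. c \<alpha> \<bullet> \<alpha>) = (\<Sum>\<alpha>\<in>simples D. d \<alpha> \<bullet> \<alpha>)" "\<alpha> \<in> simples D"
  shows "c \<alpha> = d \<alpha>"
proof -
  have "(\<Sum>\<alpha>\<in>simples D. (c \<alpha> - d \<alpha>) \<bullet> \<alpha>) = 0"
    using assms(1) by (simp add: zscale_diff_left sum_subtractf)
  from simples_independent[OF this assms(2)] show ?thesis by simp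
qed

lemma not_positive_minus:
  assumes "positive \<beta>"
  shows "\<not> positive (- \<beta>)"
proof
  assume "positive (- \<beta>)"
  then obtain d where d: "\<forall>\<alpha>. 0 \<le> d \<alpha>" "- \<beta> = (\<Sum>\<alpha>\<in>simples D. d \<alpha> \<bullet> \<alpha>)"
    by (auto simp: positive_def)
  obtain c where c: "\<forall>\<alpha>. 0 \<le> c \<alpha>" "\<beta> = (\<Sum>\<alpha>\<in>simples D. c \<alpha> \<bullet> \<alpha>)"
    using assms by (auto simp: positive_def)
  have "(\<Sum>\<alpha>\<in>simples D. c \<alpha> \<bullet> \<alpha>) = (\<Sum>\<alpha>\<in>simples D. (- d \<alpha>) \<bullet> \<alpha>)"
    using c(2) d(2) by (simp add: zscale_minus_left sum_negf eq_neg_iff_add_eq_0 neg_eq_iff_add_eq_0)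
  from simples_coeff_unique[OF this] have "c \<alpha> = - d \<alpha>" if "\<alpha> \<in> simples D" for \<alpha> using that by blast
  then have "c \<alpha> = 0" if "\<alpha> \<in> simples D" for \<alpha>
    using that spec[OF c(1), of \<alpha>] spec[OF d(1), of \<alpha>] by fastforce
  then have "\<beta> = 0" using c(2) by simp
  then show False using root_nonzero positive_root[OF assms] by blast
qed

lemma sum_delta_zscale:
  assumes "\<alpha> \<in> simples D"
  shows "(\<Sum>\<beta>\<in>simples D. (if \<beta> = \<alpha> then k else 0) \<bullet> \<beta>) = k \<bullet> \<alpha>"
proof -
  have "(\<Sum>\<beta>\<in>simples D. (if \<beta> = \<alpha> then k else 0) \<bullet> \<beta>) = (\<Sum>\<beta>\<in>simples D. if \<beta> = \<alpha> then k \<bullet> \<beta> else 0)"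
    by (rule sum.cong) auto
  then show ?thesis using assms by (simp add: finite_simples)
qed

lemma positive_simple: "\<alpha> \<in> simples D \<Longrightarrow> positive \<alpha>"
  unfolding positive_def using sum_delta_zscale[of \<alpha> 1]
  by (intro conjI exI[of _ "\<lambda>\<beta>. if \<beta> = \<alpha> then 1 else 0"]) (auto simp: simple_root)

lemma positive_sum:
  assumes "\<And>i. i \<in> I \<Longrightarrow> 0 \<le> k i" "\<And>i. i \<in> I \<Longrightarrow> positive (f i)"
    and "(\<Sum>i\<in>I. k i \<bullet> f i) \<in> roots D"
  shows "positive (\<Sum>i\<in>I. k i \<bullet> f i)"
proof -
  have "\<forall>i\<in>I. \<exists>c. (\<forall>\<alpha>. 0 \<le> c \<alpha>) \<and> f i = (\<Sum>\<alpha>\<in>simples D. c \<alpha> \<bullet> \<alpha>)"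
    using assms(2) by (auto simp: positive_def)
  then obtain c where c: "\<And>i. i \<in> I \<Longrightarrow> (\<forall>\<alpha>. 0 \<le> c i \<alpha>) \<and> f i = (\<Sum>\<alpha>\<in>simples D. c i \<alpha> \<bullet> \<alpha>)"
    by (auto dest!: bchoice)
  have "(\<Sum>i\<in>I. k i \<bullet> f i) = (\<Sum>i\<in>I. \<Sum>\<alpha>\<in>simples D. (k i * c i \<alpha>) \<bullet> \<alpha>)"
    using c by (intro sum.cong) (auto simp: zscale_sum_right zscale_mult)
  also have "\<dots> = (\<Sum>\<alpha>\<in>simples D. (\<Sum>i\<in>I. k i * c i \<alpha>) \<bullet> \<alpha>)"
    by (subst sum.swap) (simp add: additive.sum[OF additive_zscale_left])
  finally have "(\<Sum>i\<in>I. k i \<bullet> f i) = (\<Sum>\<alpha>\<in>simples D. (\<Sum>i\<in>I. k i * c i \<alpha>) \<bullet> \<alpha>)" .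
  moreover have "\<forall>\<alpha>. 0 \<le> (\<Sum>i\<in>I. k i * c i \<alpha>)"
    using c assms(1) by (auto intro!: sum_nonneg)
  ultimately have "\<exists>d. (\<forall>\<alpha>. 0 \<le> d \<alpha>) \<and> (\<Sum>i\<in>I. k i \<bullet> f i) = (\<Sum>\<alpha>\<in>simples D. d \<alpha> \<bullet> \<alpha>)"
    by (intro exI[of _ "\<lambda>\<alpha>. \<Sum>i\<in>I. k i * c i \<alpha>"] conjI)
  with assms(3) show ?thesis unfolding positive_def ..
qed

text \<open>The reflection alters only the coefficient at \<alpha>. If the result were negative, all
  other coefficients of \<beta> would vanish and \<beta> would be a multiple c of \<alpha>. Pairing
  with the coroot of \<beta> shows that c divides 2; here c = 1 is excluded by assumption and c = 2
  by reducedness.\<close>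

lemma positive_refl_simple:
  assumes "\<alpha> \<in> simples D" "positive \<beta>" "\<beta> \<noteq> \<alpha>"
  shows "positive (refl D \<alpha> \<beta>)"
proof (rule ccontr)
  have \<beta>: "\<beta> \<in> roots D" using assms positive_root by blast
  assume "\<not> positive (refl D \<alpha> \<beta>)"
  then have "positive (- refl D \<alpha> \<beta>)"
    using positive_or refl_root[OF simple_root[OF assms(1)] \<beta>] by blast
  then obtain d where d: "\<forall>\<alpha>. 0 \<le> d \<alpha>" "- refl D \<alpha> \<beta> = (\<Sum>\<alpha>\<in>simples D. d \<alpha> \<bullet> \<alpha>)"
    by (auto simp: positive_def)
  obtain c where c: "\<forall>\<alpha>. 0 \<le> c \<alpha>" "\<beta> = (\<Sum>\<alpha>\<in>simples D. c \<alpha> \<bullet> \<alpha>)"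
    using assms by (auto simp: positive_def)
  let ?k = "pairing D \<beta> (coroot D \<alpha>)"
  have "(\<Sum>\<gamma>\<in>simples D. (c \<gamma> + d \<gamma>) \<bullet> \<gamma>) = ?k \<bullet> \<alpha>"
    using c(2)[symmetric] d(2)[symmetric] by (simp add: zscale_add_left sum.distrib refl_def)
  then have "(\<Sum>\<gamma>\<in>simples D. (c \<gamma> + d \<gamma>) \<bullet> \<gamma>) = (\<Sum>\<gamma>\<in>simples D. (if \<gamma> = \<alpha> then ?k else 0) \<bullet> \<gamma>)"
    using sum_delta_zscale[OF assms(1)] by simp
  from simples_coeff_unique[OF this] have "c \<gamma> + d \<gamma> = 0" if "\<gamma> \<in> simples D" "\<gamma> \<noteq> \<alpha>" for \<gamma>
    using that by auto
  then have c0: "c \<gamma> = 0" if "\<gamma> \<in> simples D" "\<gamma> \<noteq> \<alpha>" for \<gamma>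
    using that c(1) d(1) by (metis add_nonneg_eq_0_iff)
  have "\<beta> = (\<Sum>\<gamma>\<in>simples D. (if \<gamma> = \<alpha> then c \<alpha> else 0) \<bullet> \<gamma>)"
    unfolding c(2) by (rule sum.cong) (auto simp: c0)
  then have \<beta>_eq: "\<beta> = c \<alpha> \<bullet> \<alpha>" using sum_delta_zscale[OF assms(1)] by simp
  have "c \<alpha> * pairing D \<alpha> (coroot D \<beta>) = 2"
    using pairing_coroot[OF \<beta>] by (subst (asm) \<beta>_eq) (simp add: pairing_zscale_l)
  then have "c \<alpha> dvd 2" by (metis dvd_triv_left)
  then have "c \<alpha> = 0 \<or> c \<alpha> = 1 \<or> c \<alpha> = 2" using zdvd_imp_le[of "c \<alpha>" 2] spec[OF c(1), of \<alpha>] by linarith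
  moreover have "c \<alpha> \<noteq> 2"
    using reduced_roots[OF simple_root[OF assms(1)]] \<beta> \<beta>_eq zscale_plus_1[of 1 \<alpha>] by auto
  ultimately show False using \<beta>_eq assms(3) root_nonzero[OF \<beta>] by auto
qed

section \<open>The Weyl group and its action on roots and cocharacters\<close>

lemma weylE:
  assumes "w \<in> weyl D"
  obtains as where "as \<in> lists (simples D)" "w = word_prod D as"
  using assms by (auto simp: weyl_gen_def)

lemma word_prod_weyl: "as \<in> lists A \<Longrightarrow> word_prod D as \<in> weyl_gen D A"
  by (simp add: weyl_gen_def)

lemma id_weyl: "id \<in> weyl_gen D A"
  using word_prod_weyl[of "[]"] by simp

lemma refl_weyl: "\<alpha> \<in> A \<Longrightarrow> refl D \<alpha> \<in> weyl_gen D A"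
  using word_prod_weyl[of "[\<alpha>]" A] by simp

lemma comp_weyl:
  assumes "w \<in> weyl_gen D A" "v \<in> weyl_gen D A"
  shows "w \<circ> v \<in> weyl_gen D A"
proof -
  obtain as bs where "as \<in> lists A" "w = word_prod D as" "bs \<in> lists A" "v = word_prod D bs"
    using assms by (auto simp: weyl_gen_def)
  then show ?thesis using word_prod_weyl[of "as @ bs" A] by (simp add: word_prod_append)
qed

lemma weyl_gen_mono: "A \<subseteq> B \<Longrightarrow> weyl_gen D A \<subseteq> weyl_gen D B"
  by (auto simp: weyl_gen_def)

lemma word_prod_rev:
  assumes "as \<in> lists (simples D)"
  shows "word_prod D (rev as) \<circ> word_prod D as = id"
  using assms
proof (induction as)
  case (Cons a as)
  have "word_prod D (rev (a # as)) \<circ> word_prod D (a # as)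
      = word_prod D (rev as) \<circ> (refl D a \<circ> refl D a) \<circ> word_prod D as"
    by (simp add: word_prod_append comp_assoc)
  also have "\<dots> = word_prod D (rev as) \<circ> word_prod D as"
    using Cons.hyps by (simp add: refl_comp_refl simple_root)
  also have "\<dots> = id" by (rule Cons.IH)
  finally show ?case .
qed simp

lemma rev_in_lists [simp]: "rev as \<in> lists A \<longleftrightarrow> as \<in> lists A"
  by (simp add: in_lists_conv_set)

lemma bij_weyl:
  assumes "w \<in> weyl D"
  shows "bij w"
proof -
  obtain as where as: "as \<in> lists (simples D)" "w = word_prod D as" using assms by (rule weylE)
  show ?thesis
    using word_prod_rev[OF as(1)] word_prod_rev[of "rev as"] as
    by (intro o_bij[of "word_prod D (rev as)"]) auto
qed

lemma inv_word_prod: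
  assumes "as \<in> lists (simples D)"
  shows "inv (word_prod D as) = word_prod D (rev as)"
proof (rule inv_unique_comp)
  show "word_prod D (rev as) \<circ> word_prod D as = id" by (rule word_prod_rev[OF assms])
  show "word_prod D as \<circ> word_prod D (rev as) = id" using word_prod_rev[of "rev as"] assms by simp
qed

lemma inv_weyl:
  assumes "SP \<subseteq> simples D" "w \<in> weyl_gen D SP"
  shows "inv w \<in> weyl_gen D SP"
proof -
  obtain as where as: "as \<in> lists SP" "w = word_prod D as" using assms by (auto simp: weyl_gen_def)
  then have "as \<in> lists (simples D)" using assms by auto
  with as show ?thesis using word_prod_weyl[of "rev as" SP] by (simp add: inv_word_prod)
qed

lemma inv_refl: "\<alpha> \<in> roots D \<Longrightarrow> inv (refl D \<alpha>) = refl D \<alpha>"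
  by (rule inv_unique_comp) (simp_all add: refl_comp_refl)

lemma additive_weyl:
  assumes "w \<in> weyl D"
  shows "additive w"
proof -
  obtain as where as: "as \<in> lists (simples D)" "w = word_prod D as" using assms by (rule weylE)
  have "additive (word_prod D as)"
    by (induction as) (simp_all add: additive_def additive.add[OF additive_refl])
  then show ?thesis by (simp add: as)
qed

lemma weyl_root:
  assumes "w \<in> weyl D" "\<beta> \<in> roots D"
  shows "w \<beta> \<in> roots D"
proof -
  obtain as where as: "as \<in> lists (simples D)" "w = word_prod D as" using assms(1) by (rule weylE)
  from as(1) have "word_prod D as \<beta> \<in> roots D"
    by (induction as) (simp_all add: assms refl_root simple_root)
  then show ?thesis by (simp add: as)
qed

lemma weyl_inv_apply [simp]:
  assumes "w \<in> weyl D"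
  shows "inv w (w x) = x" "w (inv w x) = x"
  using bij_weyl[OF assms] by (simp_all add: bij_is_inj bij_is_surj surj_f_inv_f)

lemma coact_eqI:
  assumes "w \<in> weyl D" "\<And>x. pairing D (w x) y' = pairing D x y"
  shows "coact D w y = y'"
  unfolding coact_def
proof (rule the_equality)
  fix y''
  assume *: "\<forall>x. pairing D (w x) y'' = pairing D x y"
  show "y'' = y'"
  proof (rule pairing_ext_r)
    fix x
    show "pairing D x y'' = pairing D x y'"
      using spec[OF *, of "inv w x"] assms(2)[of "inv w x"] assms(1) by simp
  qed
qed (simp add: assms)

lemma coact_refl: "\<alpha> \<in> simples D \<Longrightarrow> coact D (refl D \<alpha>) y = corefl D \<alpha> y"
  by (rule coact_eqI) (simp_all add: refl_weyl pairing_refl simple_root)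

lemma pairing_coact:
  assumes "w \<in> weyl D"
  shows "pairing D (w x) (coact D w y) = pairing D x y"
proof -
  obtain as where as: "as \<in> lists (simples D)" "w = word_prod D as" using assms by (rule weylE)
  have "\<exists>y'. \<forall>x. pairing D (word_prod D as x) y' = pairing D x y"
    using as(1)
  proof (induction as)
    case Nil
    show ?case by auto
  next
    case (Cons a as)
    then obtain y' where "\<forall>x. pairing D (word_prod D as x) y' = pairing D x y" by auto
    then show ?case using Cons.hyps
      by (intro exI[of _ "corefl D a y'"]) (simp add: pairing_refl simple_root)
  qed
  then obtain y' where y': "\<And>x. pairing D (w x) y' = pairing D x y" using as(2) by blast
  with coact_eqI[OF assms this] show ?thesis by simp
qed

lemma coact_id [simp]: "coact D id = id"
  by (rule ext) (simp add: coact_eqI id_weyl)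

lemma coact_comp:
  assumes "w \<in> weyl D" "v \<in> weyl D"
  shows "coact D (w \<circ> v) y = coact D w (coact D v y)"
  using assms by (intro coact_eqI comp_weyl) (simp_all add: pairing_coact)

lemma additive_coact:
  assumes "w \<in> weyl D"
  shows "additive (coact D w)"
  by standard (use assms in \<open>simp add: coact_eqI pairing_add_r pairing_coact\<close>)

lemma coact_coroot:
  assumes "w \<in> weyl D" "\<beta> \<in> roots D"
  shows "coact D w (coroot D \<beta>) = coroot D (w \<beta>)"
proof -
  obtain as where as: "as \<in> lists (simples D)" "w = word_prod D as" using assms(1) by (rule weylE)
  from as(1) have "coact D (word_prod D as) (coroot D \<beta>) = coroot D (word_prod D as \<beta>)"
  proof (induction as)
    case (Cons a as)
    then have a: "a \<in> simples D" "as \<in> lists (simples D)" by auto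
    have "coact D (word_prod D (a # as)) (coroot D \<beta>) = coact D (refl D a) (coact D (word_prod D as) (coroot D \<beta>))"
      unfolding word_prod_Cons using a by (intro coact_comp refl_weyl word_prod_weyl)
    also have "\<dots> = coroot D (refl D a (word_prod D as \<beta>))"
      using Cons.IH a assms(2)
      by (simp add: word_prod_weyl coact_refl coroot_refl simple_root weyl_root)
    also have "\<dots> = coroot D (word_prod D (a # as) \<beta>)" by simp
    finally show ?case .
  qed (simp add: coact_id[unfolded id_def])
  then show ?thesis by (simp add: as)
qed

lemma inj_coact:
  assumes "w \<in> weyl D"
  shows "inj (coact D w)"
proof (rule injI, rule pairing_ext_r)
  fix y y' x
  assume "coact D w y = coact D w y'"
  then show "pairing D x y = pairing D x y'" by (metis pairing_coact[OF assms])
qed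

section \<open>Exchange condition and length\<close>

lemma refl_conjugate:
  assumes "w \<in> weyl D" "\<beta> \<in> roots D"
  shows "refl D (w \<beta>) \<circ> w = w \<circ> refl D \<beta>"
proof
  fix x
  have "refl D (w \<beta>) (w x) = w x - pairing D x (coroot D \<beta>) \<bullet> w \<beta>"
    unfolding refl_def coact_coroot[OF assms, symmetric] pairing_coact[OF assms(1)] ..
  also have "\<dots> = w (refl D \<beta> x)"
    by (simp add: refl_def additive.diff[OF additive_weyl[OF assms(1)]]
        additive_zscale_arg[OF additive_weyl[OF assms(1)]])
  finally show "(refl D (w \<beta>) \<circ> w) x = (w \<circ> refl D \<beta>) x" by simp
qed

text \<open>Apply the letters to \<gamma> one after the other, the leftmost first. A simple
  reflection can make a positive root negative only if that root is the letter itself, so at some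
  letter \<beta> the root reached is exactly \<beta>.\<close>

lemma negative_split:
  assumes "as \<in> lists (simples D)" "positive \<gamma>" "\<not> positive (inv (word_prod D as) \<gamma>)"
  shows "\<exists>xs \<beta> ys. as = xs @ \<beta> # ys \<and> \<gamma> = word_prod D xs \<beta>"
  using assms
proof (induction as arbitrary: \<gamma>)
  case (Cons a as)
  then have a: "a \<in> simples D" "as \<in> lists (simples D)" by auto
  show ?case
  proof (cases "\<gamma> = a")
    case True
    then show ?thesis by (intro exI[of _ "[]"]) simp
  next
    case False
    then have "positive (refl D a \<gamma>)" using a Cons.prems by (intro positive_refl_simple)
    moreover have *: "inv (word_prod D (a # as)) \<gamma> = inv (word_prod D as) (refl D a \<gamma>)"
      using Cons.prems a by (subst (1 2) inv_word_prod) (auto simp: word_prod_append)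
    have "\<not> positive (inv (word_prod D (a # as)) \<gamma>)" by (fact Cons.prems(2))
    then have "\<not> positive (inv (word_prod D as) (refl D a \<gamma>))" unfolding * .
    ultimately obtain xs \<beta> ys where *: "as = xs @ \<beta> # ys" "refl D a \<gamma> = word_prod D xs \<beta>"
      using Cons.IH a by blast
    have "\<gamma> = word_prod D (a # xs) \<beta>" using *(2)[symmetric] a by (simp add: simple_root)
    with * show ?thesis by (intro exI[of _ "a # xs"]) auto
  qed
qed simp

text \<open>The letter \<beta> found by \<open>negative_split\<close> satisfies \<alpha> =
  xs(\<beta>), so conjugation moves the reflection in \<alpha> past xs, where it cancels that
  letter. The conjugation identity is returned as well, because it becomes a braid relation when xs
  is alternating.\<close>

lemma exchange:
  assumes "as \<in> lists (simples D)" "\<alpha> \<in> simples D" "\<not> positive (inv (word_prod D as) \<alpha>)"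
  obtains xs \<beta> ys where "as = xs @ \<beta> # ys" "word_prod D (\<alpha> # xs) = word_prod D (xs @ [\<beta>])"
    "refl D \<alpha> \<circ> word_prod D as = word_prod D (xs @ ys)"
proof -
  obtain xs \<beta> ys where *: "as = xs @ \<beta> # ys" "\<alpha> = word_prod D xs \<beta>"
    using negative_split[OF assms(1) positive_simple[OF assms(2)] assms(3)] by blast
  have \<beta>: "\<beta> \<in> simples D" "xs \<in> lists (simples D)" using assms(1) * by auto
  have 1: "refl D \<alpha> \<circ> word_prod D xs = word_prod D xs \<circ> refl D \<beta>"
    unfolding *(2) using \<beta> by (intro refl_conjugate word_prod_weyl simple_root)
  have "refl D \<alpha> \<circ> word_prod D as = refl D \<alpha> \<circ> word_prod D xs \<circ> refl D \<beta> \<circ> word_prod D ys"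
    by (simp add: * word_prod_append comp_assoc)
  also have "\<dots> = word_prod D xs \<circ> (refl D \<beta> \<circ> refl D \<beta>) \<circ> word_prod D ys"
    by (simp add: 1 comp_assoc)
  also have "\<dots> = word_prod D (xs @ ys)" using \<beta> by (simp add: refl_comp_refl simple_root word_prod_append)
  finally show thesis using that[of xs \<beta> ys] * 1 by (simp add: word_prod_append)
qed

lemma len_le: "as \<in> lists (simples D) \<Longrightarrow> len D (word_prod D as) \<le> length as"
  unfolding len_def by (rule Least_le) blast

lemma ex_reduced_word:
  assumes "w \<in> weyl D"
  shows "\<exists>as. reduced_word D w as"
proof -
  obtain as where "as \<in> lists (simples D)" "w = word_prod D as" using assms by (rule weylE)
  then have "\<exists>n. \<exists>as\<in>lists (simples D). word_prod D as = w \<and> length as = n" by blast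
  from LeastI_ex[OF this] show ?thesis unfolding reduced_word_def len_def by blast
qed

lemma reduced_wordD:
  assumes "reduced_word D w as"
  shows "as \<in> lists (simples D)" "set as \<subseteq> simples D" "w = word_prod D as" "length as = len D w" "w \<in> weyl D"
  using assms word_prod_weyl[of as "simples D"] by (auto simp: reduced_word_def)

lemma len_id: "len D id = 0"
  using len_le[of "[]"] by simp

lemma len_refl_le:
  assumes "w \<in> weyl D" "\<alpha> \<in> simples D"
  shows "len D (refl D \<alpha> \<circ> w) \<le> Suc (len D w)"
proof -
  obtain as where "reduced_word D w as" using ex_reduced_word assms by blast
  note as = reduced_wordD[OF this]
  show ?thesis using len_le[of "\<alpha> # as"] as assms by simp
qed

lemma len_refl_less:
  assumes "w \<in> weyl D" "\<alpha> \<in> simples D" "\<not> positive (inv w \<alpha>)"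
  shows "len D (refl D \<alpha> \<circ> w) < len D w"
proof -
  obtain as where "reduced_word D w as" using ex_reduced_word assms by blast
  note as = reduced_wordD[OF this]
  obtain xs \<beta> ys where *: "as = xs @ \<beta> # ys" "refl D \<alpha> \<circ> word_prod D as = word_prod D (xs @ ys)"
    using exchange[OF as(1) assms(2)] assms(3) as(3) by blast
  show ?thesis using len_le[of "xs @ ys"] as * by simp
qed

lemma len_refl_greater:
  assumes "w \<in> weyl D" "\<alpha> \<in> simples D" "positive (inv w \<alpha>)"
  shows "len D w < len D (refl D \<alpha> \<circ> w)"
proof -
  have "inv (refl D \<alpha> \<circ> w) \<alpha> = inv w (refl D \<alpha> \<alpha>)"
    using assms by (subst o_inv_distrib) (simp_all add: bij_weyl refl_weyl inv_refl simple_root)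
  also have "\<dots> = - inv w \<alpha>"
    using additive.minus[OF additive_weyl[OF inv_weyl[OF order_refl assms(1)]]] assms(2)
    by (simp add: refl_self simple_root)
  finally have "\<not> positive (inv (refl D \<alpha> \<circ> w) \<alpha>)" using not_positive_minus[OF assms(3)] by simp
  from len_refl_less[OF comp_weyl[OF refl_weyl[OF assms(2)] assms(1)] assms(2) this]
  show ?thesis using assms by (simp add: refl_comp_refl simple_root flip: comp_assoc)
qed

lemma reduced_word_Cons:
  assumes "reduced_word D w as" "\<alpha> \<in> simples D" "positive (inv w \<alpha>)"
  shows "reduced_word D (refl D \<alpha> \<circ> w) (\<alpha> # as)"
  using assms len_refl_greater[of w \<alpha>] len_refl_le[of w \<alpha>] reduced_wordD[OF assms(1)]
  by (auto simp: reduced_word_def)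

lemma reduced_word_tail:
  assumes "reduced_word D w (a # as)"
  shows "reduced_word D (refl D a \<circ> w) as" "\<not> positive (inv w a)"
proof -
  note 1 = reduced_wordD[OF assms]
  have a: "a \<in> simples D" "as \<in> lists (simples D)" using 1 by auto
  have w: "refl D a \<circ> w = word_prod D as"
    using a by (simp add: 1(3) refl_comp_refl simple_root flip: comp_assoc)
  have "len D w \<le> Suc (len D (refl D a \<circ> w))"
    using len_refl_le[of "refl D a \<circ> w" a] a 1(5)
    by (simp add: comp_weyl refl_weyl refl_comp_refl simple_root flip: comp_assoc)
  then show "reduced_word D (refl D a \<circ> w) as"
    using len_le[OF a(2)] 1(4) a w by (simp add: reduced_word_def)
  have "len D (refl D a \<circ> w) \<le> length as" using len_le[OF a(2)] w by simp
  then show "\<not> positive (inv w a)" using len_refl_greater[OF 1(5) a(1)] 1(4) by auto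
qed

lemma inv_comp_weyl:
  assumes "w \<in> weyl D" "v \<in> weyl D"
  shows "inv (w \<circ> v) = inv v \<circ> inv w"
  using assms by (intro o_inv_distrib bij_weyl)

lemma len_inv_le:
  assumes "w \<in> weyl D"
  shows "len D (inv w) \<le> len D w"
proof -
  obtain as where "reduced_word D w as" using ex_reduced_word assms by blast
  note as = reduced_wordD[OF this]
  show ?thesis using len_le[of "rev as"] as by (simp add: inv_word_prod)
qed

lemma len_inv:
  assumes "w \<in> weyl D"
  shows "len D (inv w) = len D w"
  using len_inv_le[OF assms] len_inv_le[OF inv_weyl[OF order_refl assms]]
  by (simp add: inv_inv_eq bij_weyl assms)

text \<open>Exchange with s deletes one letter of the given reduced word. If that letter lies in the
  alternating prefix, the conjugation identity of \<open>exchange\<close> is a braid relation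
  between alternating words, which are prefixes of reduced words of w. If it lies in the remainder,
  putting s in front makes the alternating prefix longer by one letter.\<close>

lemma alternating_step:
  assumes "s \<in> simples D" "t \<in> simples D" "r \<in> lists (simples D)"
    and "w = word_prod D (alternating t s k @ r)" "k + length r = len D w" "\<not> positive (inv w s)"
  shows "(\<exists>r'\<in>lists (simples D). w = word_prod D (alternating s t (Suc k) @ r') \<and> Suc k + length r' = len D w)
    \<or> (\<exists>j r'. r' \<in> lists (simples D) \<and> 0 < j \<and> word_prod D (alternating s t j) = word_prod D (alternating t s j)
        \<and> w = word_prod D (alternating s t j @ r') \<and> j + length r' = len D w)"
proof -
  have alt: "alternating t s k \<in> lists (simples D)"
    using assms(1,2) by (induction k arbitrary: s t) auto
  obtain xs \<beta> ys where *: "alternating t s k @ r = xs @ \<beta> # ys"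
    "word_prod D (s # xs) = word_prod D (xs @ [\<beta>])"
    "refl D s \<circ> w = word_prod D (xs @ ys)"
    using exchange[of "alternating t s k @ r" s] assms alt by auto
  have ys: "xs @ \<beta> # ys \<in> lists (simples D)" using assms(3) alt unfolding *(1)[symmetric] by simp
  have len: "length xs + Suc (length ys) = len D w" using arg_cong[OF *(1), of length] assms(5) by simp
  show ?thesis
  proof (cases "length xs < k")
    case True
    have 1: "xs = alternating t s (length xs)"
      using arg_cong[OF *(1), of "take (length xs)"] True by (simp add: take_alternating)
    have 2: "xs @ [\<beta>] = alternating t s (Suc (length xs))"
      using arg_cong[OF *(1), of "take (Suc (length xs))"] True take_alternating[of "Suc (length xs)" k t s]
      by (simp del: alternating.simps)
    have 3: "alternating s t (Suc (length xs)) = s # xs" using 1 by simp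
    have "w = word_prod D ((xs @ [\<beta>]) @ ys)" using assms(4) *(1) by simp
    then have "w = word_prod D (alternating s t (Suc (length xs)) @ ys)"
      unfolding word_prod_append[of D "xs @ [\<beta>]"] *(2)[symmetric] 3 by (simp add: word_prod_append comp_assoc)
    moreover have "word_prod D (alternating s t (Suc (length xs))) = word_prod D (alternating t s (Suc (length xs)))"
      using *(2) 2 3 by simp
    ultimately show ?thesis using len ys by (intro disjI2 exI[of _ "Suc (length xs)"] exI[of _ ys]) auto
  next
    case False
    have "take k xs = alternating t s k"
      using arg_cong[OF *(1), of "take k"] False by simp
    then obtain xs' where xs': "xs = alternating t s k @ xs'"
      using append_take_drop_id[of k xs] by metis
    then have r: "r = xs' @ \<beta> # ys" using *(1) by simp
    have "w = refl D s \<circ> (refl D s \<circ> w)"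
      using assms(1) by (simp add: refl_comp_refl simple_root flip: comp_assoc)
    also have "\<dots> = word_prod D (alternating s t (Suc k) @ xs' @ ys)"
      unfolding *(3) by (simp add: xs')
    finally show ?thesis
      using len ys xs' r by (intro disjI1 bexI[of _ "xs' @ ys"]) auto
  qed
qed

text \<open>If no braid relation ever appeared in \<open>alternating_step\<close>, the alternating
  prefixes starting with s and with t would both grow letter by letter beyond the length of
  w.\<close>

lemma alternating_exchange:
  assumes "s \<in> simples D" "t \<in> simples D" "w \<in> weyl D"
    and "\<not> positive (inv w s)" "\<not> positive (inv w t)"
  obtains j r where "r \<in> lists (simples D)" "0 < j"
    "word_prod D (alternating s t j) = word_prod D (alternating t s j)"
    "w = word_prod D (alternating s t j @ r)" "j + length r = len D w"
proof (rule ccontr)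
  assume contr: "\<not> thesis"
  let ?A = "\<lambda>s t k. \<exists>r\<in>lists (simples D). w = word_prod D (alternating s t k @ r) \<and> k + length r = len D w"
  have no1: "\<not> (\<exists>j r. r \<in> lists (simples D) \<and> 0 < j \<and> word_prod D (alternating s t j) = word_prod D (alternating t s j)
        \<and> w = word_prod D (alternating s t j @ r) \<and> j + length r = len D w)"
    using contr that by blast
  then have no2: "\<not> (\<exists>j r. r \<in> lists (simples D) \<and> 0 < j \<and> word_prod D (alternating t s j) = word_prod D (alternating s t j)
        \<and> w = word_prod D (alternating t s j @ r) \<and> j + length r = len D w)"
    by (metis word_prod_append)
  have "?A s t k \<and> ?A t s k" for k
  proof (induction k)
    case 0
    obtain as where "reduced_word D w as" using ex_reduced_word assms by blast
    note as = reduced_wordD[OF this]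
    then show ?case by auto
  next
    case (Suc k)
    then obtain r r' where r: "r \<in> lists (simples D)" "w = word_prod D (alternating s t k @ r)" "k + length r = len D w"
      and r': "r' \<in> lists (simples D)" "w = word_prod D (alternating t s k @ r')" "k + length r' = len D w"
      by blast
    have "?A s t (Suc k)" using alternating_step[OF assms(1,2) r' assms(4)] no1 by blast
    moreover have "?A t s (Suc k)" using alternating_step[OF assms(2,1) r assms(5)] no2 by blast
    ultimately show ?case by blast
  qed
  from this[of "Suc (len D w)"] show False by auto
qed

text \<open>
  Matsumoto's theorem.  Two reduced words with different first letters s and t are connected through two
  reduced words that differ only in their alternating prefixes in s and t.
\<close>
lemma foldr_reduced_word_unique:
  fixes L :: "'x \<Rightarrow> 'm \<Rightarrow> 'm"
  assumes closed: "\<And>s f. s \<in> simples D \<Longrightarrow> f \<in> A \<Longrightarrow> L s f \<in> A"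
    and relation: "\<And>s t m f. s \<in> simples D \<Longrightarrow> t \<in> simples D \<Longrightarrow> (refl D s \<circ> refl D t) ^^ m = id \<Longrightarrow>
      f \<in> A \<Longrightarrow> ((L s \<circ> L t) ^^ m) f = f"
    and "reduced_word D w as" "reduced_word D w bs" "f \<in> A"
  shows "foldr L as f = foldr L bs f"
proof -
  have foldr_closed: "foldr L xs f \<in> A" if "xs \<in> lists (simples D)" "f \<in> A" for xs f
    using that by (induction xs) (auto simp: closed)
  have involution: "L s (L s f) = f" if "s \<in> simples D" "f \<in> A" for s f
    using relation[of s s 1 f] that by (simp add: refl_comp_refl simple_root)
  have foldr_rev: "foldr L (rev xs) (foldr L xs f) = f" if "xs \<in> lists (simples D)" "f \<in> A" for xs f
    using that
  proof (induction xs)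
    case (Cons x xs)
    then have "x \<in> simples D" "xs \<in> lists (simples D)" by auto
    then show ?case using Cons by (simp add: involution foldr_closed)
  qed simp
  \<comment> \<open>The equality of the two products says that the j-th power of s t is 1. So the
    j-th power of \<open>L s \<circ> L t\<close> fixes the image of f under the second alternating
    word, while the reversed word contained in that power carries the image back to f.\<close>
  have braid: "foldr L (alternating s t j) f = foldr L (alternating t s j) f"
    if "s \<in> simples D" "t \<in> simples D" "f \<in> A"
      "word_prod D (alternating s t j) = word_prod D (alternating t s j)" for s t j f
  proof -
    have alt: "alternating s t j \<in> lists (simples D)" if "s \<in> simples D" "t \<in> simples D" for s t
      using that by (induction j arbitrary: s t) auto
    have "(refl D s \<circ> refl D t) ^^ j = word_prod D (alternating s t j @ rev (alternating t s j))"
      by (simp only: alternating_append_rev word_prod_concat_replicate)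
    also have "\<dots> = word_prod D (rev (rev (alternating t s j))) \<circ> word_prod D (rev (alternating t s j))"
      by (simp add: word_prod_append that)
    also have "\<dots> = id" using alt[of t s] that by (intro word_prod_rev) simp
    finally have "((L s \<circ> L t) ^^ j) (foldr L (alternating t s j) f) = foldr L (alternating t s j) f"
      using that alt by (intro relation foldr_closed)
    moreover have "((L s \<circ> L t) ^^ j) (foldr L (alternating t s j) f)
        = foldr L (alternating s t j) (foldr L (rev (alternating t s j)) (foldr L (alternating t s j) f))"
      by (simp only: foldr_concat_replicate[symmetric] alternating_append_rev[symmetric] foldr_append comp_apply)
    ultimately show ?thesis using foldr_rev[of "alternating t s j" f] alt[of t s] that by simp
  qed
  show ?thesis using assms(3,4)
  proof (induction "len D w" arbitrary: w as bs)
    case 0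
    then show ?case using reduced_wordD(4)[of w] by auto
  next
    case (Suc n)
    note as = reduced_wordD[OF Suc.prems(1)] and bs = reduced_wordD[OF Suc.prems(2)]
    obtain s as' where s: "as = s # as'" using as Suc.hyps(2) by (cases as) auto
    obtain t bs' where t: "bs = t # bs'" using bs Suc.hyps(2) by (cases bs) auto
    have s': "s \<in> simples D" and t': "t \<in> simples D" using as bs s t by auto
    have same_head: "foldr L (x # xs) f = foldr L (x # ys) f"
      if "reduced_word D w (x # xs)" "reduced_word D w (x # ys)" for x xs ys
    proof -
      note xs = reduced_word_tail(1)[OF that(1)] and ys = reduced_word_tail(1)[OF that(2)]
      have "n = len D (refl D x \<circ> w)"
        using reduced_wordD(4)[OF that(1)] reduced_wordD(4)[OF xs] Suc.hyps(2) by simp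
      from Suc.hyps(1)[OF this xs ys] show ?thesis by simp
    qed
    obtain j r where r: "r \<in> lists (simples D)" "0 < j"
      "word_prod D (alternating s t j) = word_prod D (alternating t s j)"
      "w = word_prod D (alternating s t j @ r)" "j + length r = len D w"
      using alternating_exchange[OF s' t' as(5)] reduced_word_tail(2) Suc.prems s t by metis
    obtain i where i: "j = Suc i" using r(2) by (cases j) auto
    have alt: "alternating s t j \<in> lists (simples D)" if "s \<in> simples D" "t \<in> simples D" for s t
      using that by (induction j arbitrary: s t) auto
    have 1: "reduced_word D w (alternating s t j @ r)" "reduced_word D w (alternating t s j @ r)"
      using r alt[OF s' t'] alt[OF t' s'] by (simp_all add: reduced_word_def word_prod_append)
    have "foldr L as f = foldr L (alternating s t j @ r) f"
      using same_head[of s as' "alternating t s i @ r"] Suc.prems(1) 1(1) unfolding s i by simp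
    also have "\<dots> = foldr L (alternating t s j @ r) f"
      using braid[OF s' t' foldr_closed[OF r(1) \<open>f \<in> A\<close>] r(3)] by simp
    also have "\<dots> = foldr L bs f"
      using same_head[of t "alternating s t i @ r" bs'] Suc.prems(2) 1(2) unfolding t i by simp
    finally show ?case .
  qed
qed

section \<open>Minimal coset representatives as elements positive on the simple roots of P\<close>

lemma min_coset_repsD:
  assumes "w \<in> min_coset_reps D SP"
  shows "w \<in> weyl D" "v \<in> weyl_gen D SP \<Longrightarrow> len D w \<le> len D (w \<circ> v)"
  using assms by (auto simp: min_coset_reps_def)

lemma id_min_coset_reps: "id \<in> min_coset_reps D SP"
  by (simp add: min_coset_reps_def id_weyl len_id)

lemma min_coset_reps_positive:
  assumes "SP \<subseteq> simples D" "w \<in> min_coset_reps D SP" "\<alpha> \<in> SP"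
  shows "positive (w \<alpha>)"
proof (rule ccontr)
  note w = min_coset_repsD[OF assms(2)]
  have \<alpha>: "\<alpha> \<in> simples D" using assms by blast
  assume "\<not> positive (w \<alpha>)"
  \<comment> \<open>The length lemmas concern multiplication on the left, while the coset is formed
    on the right; hence the passage to the inverse of w.\<close>
  then have "\<not> positive (inv (inv w) \<alpha>)" by (simp add: inv_inv_eq bij_weyl w)
  from len_refl_less[OF inv_weyl[OF order_refl w(1)] \<alpha> this]
  have "len D (inv (refl D \<alpha> \<circ> inv w)) < len D w"
    by (simp add: len_inv comp_weyl refl_weyl \<alpha> inv_weyl w)
  moreover have "inv (refl D \<alpha> \<circ> inv w) = w \<circ> refl D \<alpha>"
    by (simp add: inv_comp_weyl refl_weyl \<alpha> inv_weyl w inv_inv_eq bij_weyl inv_refl simple_root)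
  ultimately show False using w(2)[OF refl_weyl[OF assms(3)]] by simp
qed

text \<open>Each letter of SP changes a vector by a multiple of that letter, so no coefficient
  outside SP can arise.\<close>

lemma parabolic_span:
  assumes "SP \<subseteq> simples D" "v \<in> weyl_gen D SP" "\<alpha> \<in> SP"
  obtains c where "\<And>\<beta>. \<beta> \<notin> SP \<Longrightarrow> c \<beta> = 0" "v \<alpha> = (\<Sum>\<beta>\<in>simples D. c \<beta> \<bullet> \<beta>)"
proof -
  obtain as where as: "as \<in> lists SP" "v = word_prod D as" using assms by (auto simp: weyl_gen_def)
  from as(1) have "\<exists>c. (\<forall>\<beta>. \<beta> \<notin> SP \<longrightarrow> c \<beta> = 0) \<and> word_prod D as \<alpha> = (\<Sum>\<beta>\<in>simples D. c \<beta> \<bullet> \<beta>)"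
  proof (induction as)
    case Nil
    show ?case using sum_delta_zscale[of \<alpha> 1] assms
      by (intro exI[of _ "\<lambda>\<beta>. if \<beta> = \<alpha> then 1 else 0"]) auto
  next
    case (Cons a as)
    then obtain c where c: "\<forall>\<beta>. \<beta> \<notin> SP \<longrightarrow> c \<beta> = 0" "word_prod D as \<alpha> = (\<Sum>\<beta>\<in>simples D. c \<beta> \<bullet> \<beta>)" by auto
    let ?k = "pairing D (word_prod D as \<alpha>) (coroot D a)"
    have "word_prod D (a # as) \<alpha> = (\<Sum>\<beta>\<in>simples D. (c \<beta> - (if \<beta> = a then ?k else 0)) \<bullet> \<beta>)"
      using sum_delta_zscale[of a ?k] Cons.hyps assms
      by (auto simp: zscale_diff_left sum_subtractf refl_def c(2)[symmetric])
    then show ?case using c(1) Cons.hyps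
      by (intro exI[of _ "\<lambda>\<beta>. c \<beta> - (if \<beta> = a then ?k else 0)"]) auto
  qed
  with as that show thesis by blast
qed

text \<open>The first letter of a shortest word for the inverse of v works, since otherwise exchange
  would shorten that word. The word is taken shortest among words over SP; exchange only deletes
  letters, so the shortened word is again over SP.\<close>

lemma parabolic_ex_negative:
  assumes "SP \<subseteq> simples D" "v \<in> weyl_gen D SP" "v \<noteq> id"
  obtains \<alpha> where "\<alpha> \<in> SP" "positive (- v \<alpha>)"
proof -
  obtain as\<^sub>0 where "as\<^sub>0 \<in> lists SP \<and> word_prod D as\<^sub>0 = inv v"
    using inv_weyl[OF assms(1,2)] unfolding weyl_gen_def by (metis imageE)
  from ex_has_least_nat[of "\<lambda>as. as \<in> lists SP \<and> word_prod D as = inv v", OF this, of length]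
  obtain as where as: "as \<in> lists SP" "word_prod D as = inv v"
    and min: "\<And>bs. bs \<in> lists SP \<Longrightarrow> word_prod D bs = inv v \<Longrightarrow> length as \<le> length bs"
    by auto
  have v: "v \<in> weyl D" using assms(2) weyl_gen_mono[OF assms(1)] by blast
  have inv_v: "inv (inv v) = v" using v by (simp add: inv_inv_eq bij_weyl)
  have "as \<noteq> []" using as inv_v assms(3) by auto
  then obtain a as' where a: "as = a # as'" by (cases as) auto
  have a': "a \<in> SP" "a \<in> simples D" "as' \<in> lists (simples D)" "as' \<in> lists SP"
    using as a assms(1) by auto
  have v_eq: "v = inv (word_prod D as') \<circ> refl D a"
    using as(2) inv_v a a' inv_comp_weyl[of "refl D a" "word_prod D as'"]
    by (simp add: refl_weyl word_prod_weyl inv_refl simple_root)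
  have "positive (inv (word_prod D as') a)"
  proof (rule ccontr)
    assume "\<not> positive (inv (word_prod D as') a)"
    then obtain xs \<beta> ys where *: "as' = xs @ \<beta> # ys" "refl D a \<circ> word_prod D as' = word_prod D (xs @ ys)"
      using exchange[OF a'(3,2)] by metis
    then have "length as \<le> length (xs @ ys)" using as a a' by (intro min) auto
    then show False using a * by simp
  qed
  moreover have "v a = - inv (word_prod D as') a"
    unfolding v_eq using a' additive.minus[OF additive_weyl[OF inv_weyl[OF order_refl word_prod_weyl[OF a'(3)]]]]
    by (simp add: refl_self simple_root)
  ultimately show thesis using that[OF a'(1)] by simp
qed

text \<open>Let w v be shortest in the coset. If the inverse of v were not the identity, it would
  send some \<alpha> of SP to a negative root in the span of SP. Its negative is a nonnegative
  combination of SP, which w v maps to a positive root, and the image is -w(\<alpha>), against the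
  assumption.\<close>

lemma min_coset_repsI:
  assumes "SP \<subseteq> simples D" "w \<in> weyl D" "\<And>\<alpha>. \<alpha> \<in> SP \<Longrightarrow> positive (w \<alpha>)"
  shows "w \<in> min_coset_reps D SP"
proof -
  obtain v where v: "v \<in> weyl_gen D SP"
    and min: "\<And>v'. v' \<in> weyl_gen D SP \<Longrightarrow> len D (w \<circ> v) \<le> len D (w \<circ> v')"
    using ex_has_least_nat[of "\<lambda>v. v \<in> weyl_gen D SP" id "\<lambda>v. len D (w \<circ> v)"] id_weyl by blast
  have v': "v \<in> weyl D" "inv v \<in> weyl_gen D SP"
    using v assms(1) weyl_gen_mono inv_weyl by blast+
  define w\<^sub>0 where "w\<^sub>0 = w \<circ> v"
  have w\<^sub>0: "w\<^sub>0 \<in> min_coset_reps D SP"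
    using min v v' assms(2) unfolding w\<^sub>0_def min_coset_reps_def
    by (auto simp: comp_weyl comp_assoc)
  have "inv v = id"
  proof (rule ccontr)
    assume "inv v \<noteq> id"
    with assms(1) v'(2) obtain \<alpha> where \<alpha>: "\<alpha> \<in> SP" "positive (- inv v \<alpha>)"
      by (rule parabolic_ex_negative)
    obtain c where c: "\<And>\<beta>. \<beta> \<notin> SP \<Longrightarrow> c \<beta> = 0" "inv v \<alpha> = (\<Sum>\<beta>\<in>simples D. c \<beta> \<bullet> \<beta>)"
      using parabolic_span[OF assms(1) v'(2) \<alpha>(1)] by blast
    obtain d where d: "\<forall>\<beta>. 0 \<le> d \<beta>" "- inv v \<alpha> = (\<Sum>\<beta>\<in>simples D. d \<beta> \<bullet> \<beta>)"
      using \<alpha>(2) by (auto simp: positive_def)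
    have "(\<Sum>\<beta>\<in>simples D. d \<beta> \<bullet> \<beta>) = (\<Sum>\<beta>\<in>simples D. (- c \<beta>) \<bullet> \<beta>)"
      using c(2) d(2) by (simp add: zscale_minus_left sum_negf)
    from simples_coeff_unique[OF this] c(1) have "d \<beta> = 0" if "\<beta> \<in> simples D - SP" for \<beta>
      using that by auto
    then have "- inv v \<alpha> = (\<Sum>\<beta>\<in>SP. d \<beta> \<bullet> \<beta>)"
      unfolding d(2) using assms(1) finite_simples by (intro sum.mono_neutral_right) auto
    then have *: "w\<^sub>0 (- inv v \<alpha>) = (\<Sum>\<beta>\<in>SP. d \<beta> \<bullet> w\<^sub>0 \<beta>)"
      using additive_weyl[OF min_coset_repsD(1)[OF w\<^sub>0]] by (simp add: additive.sum additive_zscale_arg)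
    have "w\<^sub>0 (- inv v \<alpha>) \<in> roots D"
      using \<alpha>(2) min_coset_repsD(1)[OF w\<^sub>0] by (simp add: weyl_root positive_root)
    then have "positive (w\<^sub>0 (- inv v \<alpha>))"
      unfolding * using d min_coset_reps_positive[OF assms(1) w\<^sub>0] by (intro positive_sum) auto
    moreover have "w\<^sub>0 (- inv v \<alpha>) = - w \<alpha>"
      using additive.minus[OF additive_weyl[OF min_coset_repsD(1)[OF w\<^sub>0]]] v'
      by (simp add: w\<^sub>0_def)
    ultimately show False using not_positive_minus[OF assms(3)[OF \<alpha>(1)]] by simp
  qed
  then have "v = id" by (metis inv_id inv_inv_eq bij_weyl v'(1))
  then show ?thesis using w\<^sub>0 by (simp add: w\<^sub>0_def)
qed

text \<open>By the positivity criterion some simple root of SP is sent by v to a positive root that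
  \<alpha> reflects to a nonpositive one. The only such root is \<alpha> itself.\<close>

lemma min_coset_reps_refl:
  assumes "SP \<subseteq> simples D" "v \<in> min_coset_reps D SP" "\<alpha> \<in> simples D"
    and "refl D \<alpha> \<circ> v \<notin> min_coset_reps D SP"
  shows "inv v \<alpha> \<in> SP"
proof -
  note v = min_coset_repsD(1)[OF assms(2)]
  obtain \<alpha>' where \<alpha>': "\<alpha>' \<in> SP" "\<not> positive (refl D \<alpha> (v \<alpha>'))"
    using min_coset_repsI[OF assms(1) comp_weyl[OF refl_weyl[OF assms(3)] v]] assms(4) by auto
  have "v \<alpha>' = \<alpha>"
    using positive_refl_simple[OF assms(3) min_coset_reps_positive[OF assms(1,2) \<alpha>'(1)]] \<alpha>'(2) by blast
  then have "inv v \<alpha> = \<alpha>'" using v by auto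
  then show ?thesis using \<alpha>' by simp
qed

end

subsection \<open>The twisted group algebra\<close>

definition pmul :: "('a \<Rightarrow> 'a) \<times> ('b \<Rightarrow> 'b) \<Rightarrow> ('a \<Rightarrow> 'a) \<times> ('b \<Rightarrow> 'b) \<Rightarrow> ('a \<Rightarrow> 'a) \<times> ('b \<Rightarrow> 'b)"
  where "pmul p q = (fst p \<circ> fst q, snd p \<circ> snd q)"

lemma pmul_Pair [simp]: "pmul (a, b) (c, d) = (a \<circ> c, b \<circ> d)"
  by (simp add: pmul_def)

lemma pmul_assoc: "pmul (pmul p q) r = pmul p (pmul q r)"
  by (simp add: pmul_def comp_assoc)

lemma tmul_eq: "tmul D f g = (\<Sum>p\<in>Poly_Mapping.keys f. \<Sum>q\<in>Poly_Mapping.keys g.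
    Poly_Mapping.single (pmul p q) (Poly_Mapping.lookup f p * subst_frac (lat_act D p) (Poly_Mapping.lookup g q)))"
  by (simp add: tmul_def pmul_def)

lemma tmul_0 [simp]: "tmul D 0 g = 0" "tmul D f 0 = 0"
  by (simp_all add: tmul_eq)

lemma zz_la_hb_nonzero [simp]: "zz x + hb \<noteq> 0" "la y + hb \<noteq> 0" "hb \<noteq> 0"
  "zz x = 0 \<longleftrightarrow> x = 0" "la y = 0 \<longleftrightarrow> y = 0"
  by (auto simp: zz_def la_def hb_def zero_prod_def)

text \<open>Stated for a general map fixing hbar, so that it covers both the Weyl group action and
  the specialization to P.\<close>

lemma subst_frac_PP_QQ:
  assumes "additive \<phi>" "\<phi> hb = hb" "\<phi> y + hb \<noteq> 0" "\<phi> x \<noteq> 0"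
  shows "subst_frac \<phi> (PP x y) = PP (\<phi> x) (\<phi> y)" "subst_frac \<phi> (QQ x y) = QQ (\<phi> x) (\<phi> y)"
    "specializable \<phi> (PP x y)" "specializable \<phi> (QQ x y)"
proof -
  have "\<phi> (y + hb) \<noteq> 0" using assms by (simp add: additive.add)
  note * = subst_frac_theta[OF assms(1) this assms(4)]
  show "subst_frac \<phi> (PP x y) = PP (\<phi> x) (\<phi> y)" "subst_frac \<phi> (QQ x y) = QQ (\<phi> x) (\<phi> y)"
    "specializable \<phi> (PP x y)" "specializable \<phi> (QQ x y)"
    using assms by (simp_all add: PP_def QQ_def * additive.add additive.diff)
qed

lemma QQ_mult_swap:
  assumes "x \<noteq> 0" "y \<noteq> 0" "x + hb \<noteq> 0" "y + hb \<noteq> 0"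
  shows "QQ y x * QQ x y = 1"
  using assms by (simp add: QQ_def One_fract_def eq_fract)

text \<open>After cancellation both terms have denominator theta(x + hbar) theta(y), and their
  numerators are opposite because theta is odd.\<close>

lemma PP_QQ_swap:
  assumes "x \<noteq> 0" "y \<noteq> 0" "x + hb \<noteq> 0" "y + hb \<noteq> 0"
  shows "PP y x + QQ y x * PP x y = 0"
proof -
  have "theta (y - x) = - theta (x - y)" using theta_minus[of "x - y"] by simp
  then show ?thesis using assms by (simp add: PP_def QQ_def Zero_fract_def eq_fract)
qed

lemma subseq_lists: "subseq bs as \<Longrightarrow> as \<in> lists A \<Longrightarrow> bs \<in> lists A"
  by (induction rule: list_emb.induct) auto

context simply_connected_root_datum
begin

text \<open>The algebra proper: for pairs in W x W the lattice action is additive, injective and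
  compatible with composition, which is what distributivity and associativity rest on.\<close>

definition twisted_carrier :: "('x, 'y) twisted set"
  where "twisted_carrier = {f. Poly_Mapping.keys f \<subseteq> weyl D \<times> weyl D}"

lemma additive_lat_act: "p \<in> weyl D \<times> weyl D \<Longrightarrow> additive (lat_act D p)"
  by standard (auto simp: lat_act_def additive.add[OF additive_weyl] additive.add[OF additive_coact])

lemma inj_lat_act: "p \<in> weyl D \<times> weyl D \<Longrightarrow> inj (lat_act D p)"
  by (rule injI)
    (auto simp: lat_act_def inj_eq[OF inj_coact] inj_eq[OF bij_is_inj[OF bij_weyl]])

lemma lat_act_pmul:
  "p \<in> weyl D \<times> weyl D \<Longrightarrow> q \<in> weyl D \<times> weyl D \<Longrightarrow> lat_act D (pmul p q) = (\<lambda>m. lat_act D p (lat_act D q m))"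
  by (auto simp: fun_eq_iff lat_act_def coact_comp)

lemma lat_act_id [simp]: "lat_act D (id, id) = (\<lambda>m. m)"
  by (auto simp: fun_eq_iff lat_act_def)

lemma pmul_weyl: "p \<in> weyl D \<times> weyl D \<Longrightarrow> q \<in> weyl D \<times> weyl D \<Longrightarrow> pmul p q \<in> weyl D \<times> weyl D"
  by (auto simp: comp_weyl)

lemma inj_pmul:
  assumes "p \<in> weyl D \<times> weyl D"
  shows "pmul p q = pmul p q' \<longleftrightarrow> q = q'"
proof
  assume *: "pmul p q = pmul p q'"
  obtain w v where p: "p = (w, v)" "inj w" "inj v" using assms bij_is_inj[OF bij_weyl] by blast
  have "w (fst q x) = w (fst q' x)" "v (snd q x) = v (snd q' x)" for x
    using * by (simp_all add: pmul_def p fun_eq_iff)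
  then show "q = q'" using p by (simp add: prod_eq_iff fun_eq_iff inj_eq)
qed simp

lemma additive_subst_act: "p \<in> weyl D \<times> weyl D \<Longrightarrow> additive (subst_frac (lat_act D p))"
  by standard (simp add: subst_frac_add additive_lat_act specializable_inj inj_lat_act)

lemma subst_act_mult: "p \<in> weyl D \<times> weyl D \<Longrightarrow>
    subst_frac (lat_act D p) (c * d) = subst_frac (lat_act D p) c * subst_frac (lat_act D p) d"
  by (simp add: subst_frac_mult additive_lat_act specializable_inj inj_lat_act)

text \<open>The support of a sum may be smaller than the union of the supports, so products are
  compared over common larger index sets.\<close>

lemma tmul_superset:
  assumes "finite S" "Poly_Mapping.keys f \<subseteq> S" "finite T" "Poly_Mapping.keys g \<subseteq> T" "S \<subseteq> weyl D \<times> weyl D"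
  shows "tmul D f g = (\<Sum>p\<in>S. \<Sum>q\<in>T.
    Poly_Mapping.single (pmul p q) (Poly_Mapping.lookup f p * subst_frac (lat_act D p) (Poly_Mapping.lookup g q)))"
proof -
  have "tmul D f g = (\<Sum>p\<in>S. \<Sum>q\<in>Poly_Mapping.keys g.
    Poly_Mapping.single (pmul p q) (Poly_Mapping.lookup f p * subst_frac (lat_act D p) (Poly_Mapping.lookup g q)))"
    unfolding tmul_eq using assms by (intro sum.mono_neutral_left) (auto simp: in_keys_iff)
  also have "\<dots> = (\<Sum>p\<in>S. \<Sum>q\<in>T.
    Poly_Mapping.single (pmul p q) (Poly_Mapping.lookup f p * subst_frac (lat_act D p) (Poly_Mapping.lookup g q)))"
    using assms by (intro sum.cong sum.mono_neutral_left)
      (auto simp: in_keys_iff subst_frac_0 additive_lat_act)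
  finally show ?thesis .
qed

lemma twisted_carrier_single: "p \<in> weyl D \<times> weyl D \<Longrightarrow> Poly_Mapping.single p c \<in> twisted_carrier"
  by (simp add: twisted_carrier_def)

lemma twisted_carrier_0: "0 \<in> twisted_carrier"
  by (simp add: twisted_carrier_def)

lemma twisted_carrier_add: "f \<in> twisted_carrier \<Longrightarrow> g \<in> twisted_carrier \<Longrightarrow> f + g \<in> twisted_carrier"
  using Poly_Mapping.keys_add[of f g] by (auto simp: twisted_carrier_def)

lemma twisted_carrier_sum: "(\<And>i. i \<in> I \<Longrightarrow> f i \<in> twisted_carrier) \<Longrightarrow> sum f I \<in> twisted_carrier"
  by (induction I rule: infinite_finite_induct) (auto simp: twisted_carrier_0 twisted_carrier_add)

lemma twisted_induct [consumes 1, case_names zero single add]: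
  assumes "f \<in> twisted_carrier" "P 0"
    and "\<And>p c. p \<in> weyl D \<times> weyl D \<Longrightarrow> P (Poly_Mapping.single p c)"
    and "\<And>f g. f \<in> twisted_carrier \<Longrightarrow> g \<in> twisted_carrier \<Longrightarrow> P f \<Longrightarrow> P g \<Longrightarrow> P (f + g)"
  shows "P f"
  using assms by (intro poly_mapping_keys_induct[of f "weyl D \<times> weyl D" P]) (auto simp: twisted_carrier_def)

lemma tmul_single:
  assumes "p \<in> weyl D \<times> weyl D"
  shows "tmul D (Poly_Mapping.single p c) (Poly_Mapping.single q d)
    = Poly_Mapping.single (pmul p q) (c * subst_frac (lat_act D p) d)"
  using assms by (subst tmul_superset[of "{p}" _ "{q}"]) auto

lemma tmul_single_left:
  assumes "p \<in> weyl D \<times> weyl D"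
  shows "tmul D (Poly_Mapping.single p c) f = (\<Sum>q\<in>Poly_Mapping.keys f.
    Poly_Mapping.single (pmul p q) (c * subst_frac (lat_act D p) (Poly_Mapping.lookup f q)))"
  using assms by (subst tmul_superset[of "{p}" _ "Poly_Mapping.keys f"]) auto

lemma tmul_add_left:
  assumes "f \<in> twisted_carrier" "g \<in> twisted_carrier"
  shows "tmul D (f + g) h = tmul D f h + tmul D g h"
proof -
  let ?S = "Poly_Mapping.keys f \<union> Poly_Mapping.keys g"
  have "?S \<subseteq> weyl D \<times> weyl D" using assms by (auto simp: twisted_carrier_def)
  then show ?thesis using Poly_Mapping.keys_add[of f g]
    by (subst (1 2 3) tmul_superset[of ?S _ "Poly_Mapping.keys h"])
      (auto simp: lookup_add distrib_right single_add sum.distrib)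
qed

lemma tmul_add_right:
  assumes "f \<in> twisted_carrier"
  shows "tmul D f (g + h) = tmul D f g + tmul D f h"
proof -
  let ?T = "Poly_Mapping.keys g \<union> Poly_Mapping.keys h"
  have f: "Poly_Mapping.keys f \<subseteq> weyl D \<times> weyl D" using assms by (auto simp: twisted_carrier_def)
  have *: "subst_frac (lat_act D p) (c + d) = subst_frac (lat_act D p) c + subst_frac (lat_act D p) d"
    if "p \<in> Poly_Mapping.keys f" for p c d
    using additive.add[OF additive_subst_act] f that by blast
  have "tmul D f (g + h) = (\<Sum>p\<in>Poly_Mapping.keys f. \<Sum>q\<in>?T. Poly_Mapping.single (pmul p q)
      (Poly_Mapping.lookup f p * subst_frac (lat_act D p) (Poly_Mapping.lookup (g + h) q)))"
    using f Poly_Mapping.keys_add[of g h] by (intro tmul_superset) auto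
  also have "\<dots> = (\<Sum>p\<in>Poly_Mapping.keys f. \<Sum>q\<in>?T.
      Poly_Mapping.single (pmul p q) (Poly_Mapping.lookup f p * subst_frac (lat_act D p) (Poly_Mapping.lookup g q))
      + Poly_Mapping.single (pmul p q) (Poly_Mapping.lookup f p * subst_frac (lat_act D p) (Poly_Mapping.lookup h q)))"
    by (intro sum.cong refl) (simp add: lookup_add * distrib_left single_add)
  also have "\<dots> = tmul D f g + tmul D f h"
    unfolding sum.distrib using f
    by (intro arg_cong2[of _ _ _ _ "(+)"] tmul_superset[symmetric]) auto
  finally show ?thesis .
qed

lemma tmul_closed:
  assumes "f \<in> twisted_carrier" "g \<in> twisted_carrier"
  shows "tmul D f g \<in> twisted_carrier"
proof -
  have "Poly_Mapping.keys f \<subseteq> weyl D \<times> weyl D" "Poly_Mapping.keys g \<subseteq> weyl D \<times> weyl D"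
    using assms by (auto simp: twisted_carrier_def)
  then show ?thesis unfolding tmul_eq
    by (intro twisted_carrier_sum twisted_carrier_single pmul_weyl) auto
qed

lemma tmul_assoc:
  assumes "f \<in> twisted_carrier" "g \<in> twisted_carrier" "h \<in> twisted_carrier"
  shows "tmul D (tmul D f g) h = tmul D f (tmul D g h)"
proof -
  have 1: "tmul D (tmul D (Poly_Mapping.single p c) (Poly_Mapping.single q d)) h
      = tmul D (Poly_Mapping.single p c) (tmul D (Poly_Mapping.single q d) h)"
    if "p \<in> weyl D \<times> weyl D" "q \<in> weyl D \<times> weyl D" for p q c d
    using assms(3)
  proof (induction h rule: twisted_induct)
    case (single r e)
    then show ?case using that
      by (simp add: tmul_single pmul_weyl pmul_assoc subst_act_mult lat_act_pmul mult.assoc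
          subst_frac_comp additive_lat_act inj_lat_act)
  next
    case (add f g)
    then show ?case using that
      by (simp add: tmul_add_right tmul_closed twisted_carrier_single)
  qed simp
  have 2: "tmul D (tmul D (Poly_Mapping.single p c) g) h = tmul D (Poly_Mapping.single p c) (tmul D g h)"
    if "p \<in> weyl D \<times> weyl D" for p c
    using assms(2)
  proof (induction g rule: twisted_induct)
    case (add f g)
    then show ?case using that assms(3)
      by (simp add: tmul_add_right tmul_add_left tmul_closed twisted_carrier_single)
  qed (simp_all add: 1 that)
  show ?thesis using assms(1)
  proof (induction f rule: twisted_induct)
    case (add f g')
    then show ?case using assms by (simp add: tmul_add_left tmul_closed)
  qed (simp_all add: 2)
qed

lemma tmul_sum_right:
  assumes "f \<in> twisted_carrier"
  shows "tmul D f (\<Sum>i\<in>I. g i) = (\<Sum>i\<in>I. tmul D f (g i))"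
  by (induction I rule: infinite_finite_induct) (simp_all add: tmul_add_right assms)

section \<open>Scalars and delta elements; action on P and Q\<close>

lemma scal_closed: "scal c \<in> twisted_carrier"
  and delta_closed: "w \<in> weyl D \<Longrightarrow> delta w \<in> twisted_carrier"
  and delta_d_closed: "w \<in> weyl D \<Longrightarrow> delta_d w \<in> twisted_carrier"
  by (simp_all add: scal_def delta_def delta_d_def twisted_carrier_single id_weyl)

lemma scal_add: "scal (c + d) = scal c + scal d"
  by (simp add: scal_def single_add)

lemma tmul_scal_sum: "tmul D (scal (\<Sum>i\<in>I. c i)) f = (\<Sum>i\<in>I. tmul D (scal (c i)) f)"
  by (induction I rule: infinite_finite_induct)
    (simp_all add: scal_add tmul_add_left scal_closed, simp_all add: scal_def)

lemma tmul_scal_scal: "tmul D (scal c) (scal d) = scal (c * d)"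
  by (simp add: scal_def tmul_single id_weyl)

lemma tmul_scal_1:
  assumes "f \<in> twisted_carrier"
  shows "tmul D (scal 1) f = f"
  using assms
proof (induction f rule: twisted_induct)
  case (single p c)
  then show ?case by (cases p) (simp add: scal_def tmul_single id_weyl)
qed (simp_all add: tmul_add_right scal_closed)

lemma tmul_delta_delta: "w \<in> weyl D \<Longrightarrow> tmul D (delta w) (delta v) = delta (w \<circ> v)"
  by (simp add: delta_def tmul_single id_weyl subst_frac_1 additive_lat_act)

lemma tmul_delta_d_delta_d: "w \<in> weyl D \<Longrightarrow> tmul D (delta_d w) (delta_d v) = delta_d (w \<circ> v)"
  by (simp add: delta_d_def tmul_single id_weyl subst_frac_1 additive_lat_act)

lemma tmul_delta_delta_d: "w \<in> weyl D \<Longrightarrow> v \<in> weyl D \<Longrightarrow> tmul D (delta w) (delta_d v) = tmul D (delta_d v) (delta w)"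
  by (simp add: delta_def delta_d_def tmul_single id_weyl subst_frac_1 additive_lat_act)

lemma tmul_delta_scal:
  "w \<in> weyl D \<Longrightarrow> tmul D (delta w) (scal c) = tmul D (scal (subst_frac (lat_act D (w, id)) c)) (delta w)"
  by (simp add: delta_def scal_def tmul_single id_weyl subst_frac_1 additive_lat_act)

lemma tmul_delta_d_scal:
  "w \<in> weyl D \<Longrightarrow> tmul D (delta_d w) (scal c) = tmul D (scal (subst_frac (lat_act D (id, w)) c)) (delta_d w)"
  by (simp add: delta_d_def scal_def tmul_single id_weyl subst_frac_1 additive_lat_act)

lemma lookup_tmul_single:
  assumes "p \<in> weyl D \<times> weyl D"
  shows "Poly_Mapping.lookup (tmul D (Poly_Mapping.single p c) f) (pmul p q)
    = c * subst_frac (lat_act D p) (Poly_Mapping.lookup f q)"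
proof -
  have "Poly_Mapping.lookup (tmul D (Poly_Mapping.single p c) f) (pmul p q)
      = (\<Sum>q'\<in>Poly_Mapping.keys f. if q' = q then c * subst_frac (lat_act D p) (Poly_Mapping.lookup f q') else 0)"
    unfolding tmul_single_left[OF assms] lookup_sum
    by (intro sum.cong) (auto simp: lookup_single when_def inj_pmul[OF assms])
  then show ?thesis by (simp add: in_keys_iff subst_frac_0 additive_lat_act assms)
qed

lemma keys_tmul_single:
  assumes "p \<in> weyl D \<times> weyl D"
  shows "Poly_Mapping.keys (tmul D (Poly_Mapping.single p c) f) \<subseteq> pmul p ` Poly_Mapping.keys f"
proof
  fix r
  assume "r \<in> Poly_Mapping.keys (tmul D (Poly_Mapping.single p c) f)"
  then have "(\<Sum>q\<in>Poly_Mapping.keys f. Poly_Mapping.lookup (Poly_Mapping.single (pmul p q)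
      (c * subst_frac (lat_act D p) (Poly_Mapping.lookup f q))) r) \<noteq> 0"
    unfolding in_keys_iff tmul_single_left[OF assms] lookup_sum .
  then obtain q where "q \<in> Poly_Mapping.keys f" "Poly_Mapping.lookup (Poly_Mapping.single (pmul p q)
      (c * subst_frac (lat_act D p) (Poly_Mapping.lookup f q))) r \<noteq> 0"
    using sum.not_neutral_contains_not_neutral by blast
  then show "r \<in> pmul p ` Poly_Mapping.keys f" by (auto simp: lookup_single when_def split: if_splits)
qed

lemma lat_act_values:
  assumes "w \<in> weyl D" "v \<in> weyl D"
  shows "lat_act D (w, v) hb = hb" "lat_act D (w, v) (zz x) = zz (w x)"
    "lat_act D (w, v) (la y) = la (coact D v y)"
  using assms
  by (simp_all add: lat_act_def additive.zero[OF additive_weyl] additive.zero[OF additive_coact]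
      hb_def zz_def la_def)

lemma coact_nonzero: "v \<in> weyl D \<Longrightarrow> \<beta> \<in> roots D \<Longrightarrow> coact D v (coroot D \<beta>) \<noteq> 0"
  by (simp add: coact_coroot coroot_nonzero weyl_root)

lemma subst_act_PP_QQ:
  assumes "w \<in> weyl D" "v \<in> weyl D" "\<beta> \<in> roots D"
  shows "subst_frac (lat_act D (w, v)) (PP (la (coroot D \<beta>)) (zz x)) = PP (la (coact D v (coroot D \<beta>))) (zz (w x))"
    "subst_frac (lat_act D (w, v)) (QQ (la (coroot D \<beta>)) (zz x)) = QQ (la (coact D v (coroot D \<beta>))) (zz (w x))"
  using assms subst_frac_PP_QQ[of "lat_act D (w, v)" "zz x" "la (coroot D \<beta>)"]
  by (simp_all add: additive_lat_act lat_act_values coact_nonzero)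

text \<open>Both terms have the dual component s, and the coefficient at (s, s) is nonzero because Q
  has an inverse by \<open>QQ_mult_swap\<close>. These two features give the triangularity of the
  elements T_w.\<close>

lemma T_simple_eq:
  assumes "\<alpha> \<in> simples D"
  obtains c d where "T_simple D \<alpha> = Poly_Mapping.single (id, refl D \<alpha>) c
      + Poly_Mapping.single (refl D \<alpha>, refl D \<alpha>) d" "d \<noteq> 0"
proof -
  have s: "refl D \<alpha> \<in> weyl D" using assms by (rule refl_weyl)
  let ?act = "subst_frac (lat_act D (id, refl D \<alpha>))"
  let ?P = "PP (zz \<alpha>) (la (coroot D \<alpha>))" and ?Q = "QQ (zz \<alpha>) (la (coroot D \<alpha>))"
  have "T_simple D \<alpha> = Poly_Mapping.single (id, refl D \<alpha>) (?act ?P)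
      + Poly_Mapping.single (refl D \<alpha>, refl D \<alpha>) (?act ?Q)"
    unfolding T_simple_def delta_d_def delta_def scal_def
    by (simp add: s tmul_single id_weyl subst_frac_1 additive_lat_act tmul_add_right twisted_carrier_single)
  moreover have "?Q \<noteq> 0"
    using QQ_mult_swap[of "zz \<alpha>" "la (coroot D \<alpha>)"] assms
    by (auto simp: root_nonzero coroot_nonzero simple_root)
  then have "?act ?Q \<noteq> 0" by (simp add: subst_frac_eq_0_iff additive_lat_act inj_lat_act s id_weyl)
  ultimately show thesis by (rule that)
qed

lemma T_simple_closed: "\<alpha> \<in> simples D \<Longrightarrow> T_simple D \<alpha> \<in> twisted_carrier"
  by (rule T_simple_eq, assumption)
    (simp add: twisted_carrier_add twisted_carrier_single id_weyl refl_weyl)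

text \<open>The dual reflection squares to 1 and so strips the leading factor of T. Multiplying by
  Q(lambda, z), the inverse of Q(z, lambda), isolates the delta element, and the added P-term
  cancels the remaining scalar by \<open>PP_QQ_swap\<close>.\<close>

lemma delta_refl:
  assumes "\<alpha> \<in> simples D"
  shows "delta (refl D \<alpha>) = scal (PP (la (coroot D \<alpha>)) (zz \<alpha>))
    + tmul D (scal (QQ (la (coroot D \<alpha>)) (zz \<alpha>))) (tmul D (delta_d (refl D \<alpha>)) (T_simple D \<alpha>))"
proof -
  have s: "refl D \<alpha> \<in> weyl D" using assms by (rule refl_weyl)
  let ?P = "PP (zz \<alpha>) (la (coroot D \<alpha>))" and ?Q = "QQ (zz \<alpha>) (la (coroot D \<alpha>))"
  let ?p = "PP (la (coroot D \<alpha>)) (zz \<alpha>)" and ?q = "QQ (la (coroot D \<alpha>)) (zz \<alpha>)"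
  have nz: "zz \<alpha> \<noteq> (0::('x, 'y) lat)" "la (coroot D \<alpha>) \<noteq> (0::('x, 'y) lat)"
    using assms by (simp_all add: root_nonzero coroot_nonzero simple_root)
  let ?X = "scal ?P + tmul D (scal ?Q) (delta (refl D \<alpha>))"
  have X: "?X \<in> twisted_carrier" by (intro twisted_carrier_add tmul_closed scal_closed delta_closed s)
  have "tmul D (delta_d (refl D \<alpha>)) (T_simple D \<alpha>) = tmul D (tmul D (delta_d (refl D \<alpha>)) (delta_d (refl D \<alpha>))) ?X"
    unfolding T_simple_def by (intro tmul_assoc[symmetric] delta_d_closed s X)
  also have "\<dots> = tmul D (scal 1) ?X"
    using assms by (simp add: tmul_delta_d_delta_d s refl_comp_refl simple_root) (simp add: delta_d_def scal_def)
  also have "\<dots> = ?X" by (rule tmul_scal_1[OF X])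
  finally have "tmul D (scal ?q) (tmul D (delta_d (refl D \<alpha>)) (T_simple D \<alpha>)) = tmul D (scal ?q) ?X"
    by simp
  also have "\<dots> = scal (?q * ?P) + tmul D (tmul D (scal ?q) (scal ?Q)) (delta (refl D \<alpha>))"
    by (simp only: tmul_add_right[OF scal_closed] tmul_scal_scal
        tmul_assoc[OF scal_closed scal_closed delta_closed[OF s], symmetric])
  also have "\<dots> = scal (?q * ?P) + delta (refl D \<alpha>)"
    using nz by (simp add: tmul_scal_scal QQ_mult_swap tmul_scal_1 delta_closed s)
  also have "scal ?p + \<dots> = scal (?p + ?q * ?P) + delta (refl D \<alpha>)"
    by (simp add: scal_add add.assoc)
  also have "\<dots> = delta (refl D \<alpha>)" using nz by (simp add: PP_QQ_swap) (simp add: scal_def)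
  finally show ?thesis ..
qed

section \<open>The elements T_w\<close>

definition T_word :: "'x list \<Rightarrow> ('x, 'y) twisted"
  where "T_word as = foldr (\<lambda>\<alpha>. tmul D (T_simple D \<alpha>)) as (scal 1)"

lemma T_word_Nil [simp]: "T_word [] = scal 1"
  and T_word_Cons [simp]: "T_word (\<alpha> # as) = tmul D (T_simple D \<alpha>) (T_word as)"
  by (simp_all add: T_word_def)

lemma T_word_closed: "set as \<subseteq> simples D \<Longrightarrow> T_word as \<in> twisted_carrier"
  by (induction as) (auto intro!: tmul_closed simp: scal_closed T_simple_closed)

lemma T_elt_eq_SOME: "T_elt D w = T_word (SOME \<alpha>s. reduced_word D w \<alpha>s)"
  by (simp add: T_elt_def T_word_def foldr_map comp_def)

lemma T_elt_closed:
  assumes "w \<in> weyl D"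
  shows "T_elt D w \<in> twisted_carrier"
  unfolding T_elt_eq_SOME
  using someI_ex[OF ex_reduced_word[OF assms]] by (intro T_word_closed reduced_wordD(2))

lemma tmul_power_closed:
  "f \<in> twisted_carrier \<Longrightarrow> g \<in> twisted_carrier \<Longrightarrow> (tmul D f ^^ m) g \<in> twisted_carrier"
  by (induction m) (simp_all add: tmul_closed)

text \<open>The relations are stated for powers applied to the unit. Associativity carries them to
  operators on the whole carrier, the form in which Matsumoto's theorem uses them.\<close>

lemma weyl_relation_power:
  assumes "weyl_relations D" "\<alpha> \<in> simples D" "\<beta> \<in> simples D" "(refl D \<alpha> \<circ> refl D \<beta>) ^^ m = id"
    and f: "f \<in> twisted_carrier"
  shows "((tmul D (T_simple D \<alpha>) \<circ> tmul D (T_simple D \<beta>)) ^^ m) f = f"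
proof -
  let ?X = "tmul D (T_simple D \<alpha>) (T_simple D \<beta>)"
  note closed = T_simple_closed[OF assms(2)] T_simple_closed[OF assms(3)]
  have X: "?X \<in> twisted_carrier" by (intro tmul_closed closed)
  have "((tmul D (T_simple D \<alpha>) \<circ> tmul D (T_simple D \<beta>)) ^^ m) f = tmul D ((tmul D ?X ^^ m) (scal 1)) f" for m
  proof (induction m)
    case (Suc m)
    have "((tmul D (T_simple D \<alpha>) \<circ> tmul D (T_simple D \<beta>)) ^^ Suc m) f
        = tmul D (T_simple D \<alpha>) (tmul D (T_simple D \<beta>) (tmul D ((tmul D ?X ^^ m) (scal 1)) f))"
      by (simp add: Suc)
    also have "\<dots> = tmul D ?X (tmul D ((tmul D ?X ^^ m) (scal 1)) f)"
      by (intro tmul_assoc[symmetric] closed tmul_closed tmul_power_closed f scal_closed)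
    also have "\<dots> = tmul D (tmul D ?X ((tmul D ?X ^^ m) (scal 1))) f"
      by (intro tmul_assoc[symmetric] closed tmul_closed tmul_power_closed f scal_closed)
    also have "\<dots> = tmul D ((tmul D ?X ^^ Suc m) (scal 1)) f" by simp
    finally show ?case .
  qed (simp add: tmul_scal_1 f)
  moreover have "(tmul D ?X ^^ m) (scal 1) = scal 1"
    using assms(1-4) unfolding weyl_relations_def by blast
  ultimately show ?thesis by (simp add: tmul_scal_1 f)
qed

lemma T_elt_reduced_word:
  assumes "weyl_relations D" "reduced_word D w as"
  shows "T_elt D w = T_word as"
  unfolding T_elt_eq_SOME T_word_def
proof (rule foldr_reduced_word_unique[where A = twisted_carrier])
  show "reduced_word D w (SOME \<alpha>s. reduced_word D w \<alpha>s)" using assms(2) by (rule someI)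
qed (use assms in \<open>simp_all add: tmul_closed T_simple_closed scal_closed weyl_relation_power\<close>)

text \<open>If s lengthens w, it extends a reduced word of w. Otherwise s lengthens s w, and the
  relation that T_s squares to 1, which is the case m = 1 of equal simple roots, turns that case
  into this one.\<close>

lemma T_simple_T_elt:
  assumes "weyl_relations D" "\<alpha> \<in> simples D" "w \<in> weyl D"
  shows "tmul D (T_simple D \<alpha>) (T_elt D w) = T_elt D (refl D \<alpha> \<circ> w)"
proof -
  have up: "tmul D (T_simple D \<alpha>) (T_elt D v) = T_elt D (refl D \<alpha> \<circ> v)"
    if v: "v \<in> weyl D" "positive (inv v \<alpha>)" for v
  proof -
    obtain as where as: "reduced_word D v as" using ex_reduced_word[OF v(1)] by blast
    from reduced_word_Cons[OF this assms(2) v(2)] show ?thesis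
      using T_elt_reduced_word[OF assms(1)] as by simp
  qed
  show ?thesis
  proof (cases "positive (inv w \<alpha>)")
    case True
    then show ?thesis using up assms by blast
  next
    case False
    have s: "refl D \<alpha> \<in> weyl D" using assms(2) by (rule refl_weyl)
    let ?v = "refl D \<alpha> \<circ> w"
    have v: "?v \<in> weyl D" by (intro comp_weyl s assms)
    have "inv ?v \<alpha> = - inv w \<alpha>"
      using assms additive.minus[OF additive_weyl[OF inv_weyl[OF order_refl assms(3)]]]
      by (simp add: inv_comp_weyl s inv_refl simple_root refl_self)
    then have "positive (inv ?v \<alpha>)"
      using positive_or[of "inv w \<alpha>"] False assms by (simp add: weyl_root inv_weyl simple_root)
    from up[OF v this] have "T_elt D w = tmul D (T_simple D \<alpha>) (T_elt D ?v)"
      using assms by (simp add: refl_comp_refl simple_root flip: comp_assoc)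
    then show ?thesis
      using weyl_relation_power[OF assms(1,2,2), of 1 "T_elt D ?v"] assms
      by (simp add: refl_comp_refl simple_root T_elt_closed v)
  qed
qed

text \<open>All terms of T_w have the dual component w. The factor in front moves it to the
  identity, so these elements are combinations of the elements \<open>delta v\<close> alone.\<close>

definition T_basis :: "('x \<Rightarrow> 'x) \<Rightarrow> ('x, 'y) twisted"
  where "T_basis w = tmul D (delta_d (inv w)) (T_elt D w)"

lemma T_basis_closed: "w \<in> weyl D \<Longrightarrow> T_basis w \<in> twisted_carrier"
  by (simp add: T_basis_def tmul_closed delta_d_closed T_elt_closed inv_weyl)

lemma T_basis_id: "T_basis id = delta id"
proof -
  have "reduced_word D id []" by (simp add: reduced_word_def len_id)
  then have "(SOME as. reduced_word D id as) = []"
    using reduced_wordD(4)[OF someI[of "reduced_word D id"]] len_id by fastforce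
  then have "T_elt D id = scal 1" by (simp add: T_elt_eq_SOME)
  then show ?thesis by (simp add: T_basis_def delta_d_def delta_def scal_def tmul_single id_weyl)
qed

lemma delta_T_basis:
  assumes "weyl_relations D" "\<alpha> \<in> simples D" "v \<in> weyl D"
  shows "tmul D (delta (refl D \<alpha>)) (T_basis v)
    = tmul D (scal (PP (la (coact D (inv v) (coroot D \<alpha>))) (zz \<alpha>))) (T_basis v)
    + tmul D (scal (QQ (la (coact D (inv v) (coroot D \<alpha>))) (zz \<alpha>))) (T_basis (refl D \<alpha> \<circ> v))"
proof -
  have s: "refl D \<alpha> \<in> weyl D" using assms(2) by (rule refl_weyl)
  have iv: "inv v \<in> weyl D" by (intro inv_weyl order_refl assms)
  have sv: "refl D \<alpha> \<circ> v \<in> weyl D" by (intro comp_weyl s assms)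
  have T: "T_elt D v \<in> twisted_carrier" "T_simple D \<alpha> \<in> twisted_carrier" "T_elt D (refl D \<alpha> \<circ> v) \<in> twisted_carrier"
    by (intro T_elt_closed T_simple_closed sv assms)+
  note closed = tmul_closed scal_closed delta_closed[OF s] delta_d_closed[OF s] delta_d_closed[OF iv] T
  let ?p = "PP (la (coroot D \<alpha>)) (zz \<alpha>)" and ?q = "QQ (la (coroot D \<alpha>)) (zz \<alpha>)"
  let ?p' = "PP (la (coact D (inv v) (coroot D \<alpha>))) (zz \<alpha>)" and ?q' = "QQ (la (coact D (inv v) (coroot D \<alpha>))) (zz \<alpha>)"
  have act: "subst_frac (lat_act D (id, inv v)) ?p = ?p'" "subst_frac (lat_act D (id, inv v)) ?q = ?q'"
    using assms by (simp_all add: subst_act_PP_QQ id_weyl iv simple_root)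
  \<comment> \<open>Passing the dual element across a scalar twists only the cocharacter argument;
    this is how the inverse of v comes to act on the coroot of \<alpha>.\<close>
  have move: "tmul D (delta_d (inv v)) (tmul D (scal c) f)
      = tmul D (scal (subst_frac (lat_act D (id, inv v)) c)) (tmul D (delta_d (inv v)) f)"
    if "f \<in> twisted_carrier" for c f
    using that by (simp add: tmul_assoc[symmetric] closed tmul_delta_d_scal iv)
  have "tmul D (delta (refl D \<alpha>)) (T_basis v)
      = tmul D (tmul D (delta (refl D \<alpha>)) (delta_d (inv v))) (T_elt D v)"
    unfolding T_basis_def by (intro tmul_assoc[symmetric] closed)
  also have "\<dots> = tmul D (delta_d (inv v)) (tmul D (delta (refl D \<alpha>)) (T_elt D v))"
    by (simp add: tmul_delta_delta_d s iv tmul_assoc closed)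
  also have "tmul D (delta (refl D \<alpha>)) (T_elt D v) = tmul D (scal ?p) (T_elt D v)
      + tmul D (scal ?q) (tmul D (delta_d (refl D \<alpha>)) (T_elt D (refl D \<alpha> \<circ> v)))"
    by (subst delta_refl[OF assms(2)])
      (simp add: tmul_add_left closed tmul_assoc T_simple_T_elt assms)
  also have "tmul D (delta_d (inv v)) \<dots> = tmul D (scal ?p') (tmul D (delta_d (inv v)) (T_elt D v))
      + tmul D (scal ?q') (tmul D (delta_d (inv v)) (tmul D (delta_d (refl D \<alpha>)) (T_elt D (refl D \<alpha> \<circ> v))))"
    by (simp add: tmul_add_right closed move act)
  also have "tmul D (delta_d (inv v)) (tmul D (delta_d (refl D \<alpha>)) (T_elt D (refl D \<alpha> \<circ> v)))
      = T_basis (refl D \<alpha> \<circ> v)"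
    unfolding T_basis_def using assms
    by (simp add: tmul_assoc[symmetric] closed tmul_delta_d_delta_d iv inv_comp_weyl s inv_refl simple_root)
  finally show ?thesis unfolding T_basis_def[of v] .
qed

text \<open>Each simple factor contributes s to the dual component in every term, but either s or
  the identity to the other component. The former therefore multiply to the whole word, the latter
  to a subword.\<close>

lemma keys_T_word:
  assumes "set as \<subseteq> simples D"
  shows "Poly_Mapping.keys (T_word as) \<subseteq> {(word_prod D bs, word_prod D as) |bs. subseq bs as}"
  using assms
proof (induction as)
  case Nil
  then show ?case by (auto simp: scal_def id_def intro!: exI[of _ "[]"])
next
  case (Cons \<alpha> as)
  then have \<alpha>: "\<alpha> \<in> simples D" "set as \<subseteq> simples D" by auto
  then have s: "refl D \<alpha> \<in> weyl D" by (simp add: refl_weyl)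
  obtain c d where T: "T_simple D \<alpha> = Poly_Mapping.single (id, refl D \<alpha>) c
      + Poly_Mapping.single (refl D \<alpha>, refl D \<alpha>) d"
    using T_simple_eq[OF \<alpha>(1)] by blast
  have "Poly_Mapping.keys (T_word (\<alpha> # as))
      \<subseteq> Poly_Mapping.keys (tmul D (Poly_Mapping.single (id, refl D \<alpha>) c) (T_word as))
      \<union> Poly_Mapping.keys (tmul D (Poly_Mapping.single (refl D \<alpha>, refl D \<alpha>) d) (T_word as))"
    unfolding T_word_Cons T using s
    by (subst tmul_add_left) (simp_all add: twisted_carrier_single id_weyl Poly_Mapping.keys_add)
  also have "\<dots> \<subseteq> pmul (id, refl D \<alpha>) ` Poly_Mapping.keys (T_word as)
      \<union> pmul (refl D \<alpha>, refl D \<alpha>) ` Poly_Mapping.keys (T_word as)"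
    using s by (intro Un_mono keys_tmul_single) (simp_all add: id_weyl)
  also have "\<dots> \<subseteq> {(word_prod D bs, word_prod D (\<alpha> # as)) |bs. subseq bs (\<alpha> # as)}"
  proof
    fix r
    assume "r \<in> pmul (id, refl D \<alpha>) ` Poly_Mapping.keys (T_word as)
      \<union> pmul (refl D \<alpha>, refl D \<alpha>) ` Poly_Mapping.keys (T_word as)"
    then obtain q where q: "q \<in> Poly_Mapping.keys (T_word as)"
      "r = pmul (id, refl D \<alpha>) q \<or> r = pmul (refl D \<alpha>, refl D \<alpha>) q" by auto
    obtain bs where bs: "subseq bs as" "q = (word_prod D bs, word_prod D as)"
      using Cons.IH[OF \<alpha>(2)] q(1) by auto
    from q(2) show "r \<in> {(word_prod D bs, word_prod D (\<alpha> # as)) |bs. subseq bs (\<alpha> # as)}"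
    proof
      assume "r = pmul (id, refl D \<alpha>) q"
      then have "r = (word_prod D bs, word_prod D (\<alpha> # as))" using bs by simp
      then show ?thesis using bs by blast
    next
      assume "r = pmul (refl D \<alpha>, refl D \<alpha>) q"
      then have "r = (word_prod D (\<alpha> # bs), word_prod D (\<alpha> # as))" using bs by simp
      moreover have "subseq (\<alpha> # bs) (\<alpha> # as)" using bs by simp
      ultimately show ?thesis by blast
    qed
  qed
  finally show ?case .
qed

text \<open>In a reduced word, the term of the first factor with identity component cannot reach w,
  since the remaining letters are too few. The coefficient is thus the nonzero coefficient of the
  other term times a twist of the one for the shorter word.\<close>

lemma lookup_T_word:
  assumes "reduced_word D w as"
  shows "Poly_Mapping.lookup (T_word as) (w, w) \<noteq> 0"
  using assms
proof (induction as arbitrary: w)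
  case Nil
  then have "w = id" by (simp add: reduced_word_def)
  then show ?case by (simp add: scal_def id_def)
next
  case (Cons \<alpha> as)
  note w = reduced_wordD[OF Cons.prems]
  have \<alpha>: "\<alpha> \<in> simples D" "set as \<subseteq> simples D" "as \<in> lists (simples D)" using w by auto
  then have s: "refl D \<alpha> \<in> weyl D" by (simp add: refl_weyl)
  let ?v = "refl D \<alpha> \<circ> w"
  have v: "reduced_word D ?v as" using reduced_word_tail(1)[OF Cons.prems] .
  have w_eq: "w = refl D \<alpha> \<circ> ?v" using \<alpha> by (simp add: refl_comp_refl simple_root flip: comp_assoc)
  obtain c d where T: "T_simple D \<alpha> = Poly_Mapping.single (id, refl D \<alpha>) c
      + Poly_Mapping.single (refl D \<alpha>, refl D \<alpha>) d" and d: "d \<noteq> 0"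
    using T_simple_eq[OF \<alpha>(1)] by blast
  have "w \<noteq> word_prod D bs" if "subseq bs as" for bs
  proof
    assume "w = word_prod D bs"
    moreover have "bs \<in> lists (simples D)" using subseq_lists[OF that \<alpha>(3)] .
    ultimately have "len D w \<le> length bs" using len_le by blast
    then show False using list_emb_length[OF that] w(4) by simp
  qed
  then have "(w, ?v) \<notin> Poly_Mapping.keys (T_word as)" using keys_T_word[OF \<alpha>(2)] by auto
  then have 1: "Poly_Mapping.lookup (tmul D (Poly_Mapping.single (id, refl D \<alpha>) c) (T_word as)) (w, w) = 0"
    using lookup_tmul_single[of "(id, refl D \<alpha>)" c "T_word as" "(w, ?v)"] s w_eq
    by (simp add: id_weyl in_keys_iff subst_frac_0 additive_lat_act)
  have "Poly_Mapping.lookup (T_word as) (?v, ?v) \<noteq> 0" by (rule Cons.IH[OF v])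
  have "Poly_Mapping.lookup (tmul D (Poly_Mapping.single (refl D \<alpha>, refl D \<alpha>) d) (T_word as)) (w, w)
      = d * subst_frac (lat_act D (refl D \<alpha>, refl D \<alpha>)) (Poly_Mapping.lookup (T_word as) (?v, ?v))"
    using lookup_tmul_single[of "(refl D \<alpha>, refl D \<alpha>)" d "T_word as" "(?v, ?v)"] s w_eq by simp
  also have "\<dots> \<noteq> 0"
    using d \<open>Poly_Mapping.lookup (T_word as) (?v, ?v) \<noteq> 0\<close> s by (simp add: subst_frac_eq_0_iff additive_lat_act inj_lat_act)
  finally show ?case
    unfolding T_word_Cons T using s 1
    by (subst tmul_add_left) (simp_all add: twisted_carrier_single id_weyl lookup_add)
qed

lemma lookup_scal: "f \<in> twisted_carrier \<Longrightarrow> Poly_Mapping.lookup (tmul D (scal c) f) q = c * Poly_Mapping.lookup f q"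
  using lookup_tmul_single[of "(id, id)" c f q] by (cases q) (simp add: scal_def id_weyl)

lemma lookup_T_basis_self:
  assumes "w \<in> weyl D"
  shows "Poly_Mapping.lookup (T_basis w) (w, id) \<noteq> 0"
proof -
  have iw: "inv w \<in> weyl D" by (intro inv_weyl order_refl assms)
  have "pmul (id, inv w) (w, w) = (w, id)" using assms by (simp add: bij_weyl inv_o_cancel bij_is_inj)
  then have "Poly_Mapping.lookup (T_basis w) (w, id)
      = subst_frac (lat_act D (id, inv w)) (Poly_Mapping.lookup (T_elt D w) (w, w))"
    using lookup_tmul_single[of "(id, inv w)" 1 "T_elt D w" "(w, w)"] iw
    by (simp add: T_basis_def delta_d_def id_weyl)
  moreover have "Poly_Mapping.lookup (T_elt D w) (w, w) \<noteq> 0"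
    unfolding T_elt_eq_SOME using someI_ex[OF ex_reduced_word[OF assms]] by (rule lookup_T_word)
  ultimately show ?thesis by (simp add: subst_frac_eq_0_iff additive_lat_act inj_lat_act iw id_weyl)
qed

text \<open>A subword of a reduced word of v with product w has at least \<open>len D w\<close>
  letters, hence is the whole word, and then v = w.\<close>

lemma lookup_T_basis_other:
  assumes "w \<in> weyl D" "v \<in> weyl D" "len D v \<le> len D w" "v \<noteq> w"
  shows "Poly_Mapping.lookup (T_basis v) (w, id) = 0"
proof (rule ccontr)
  assume *: "Poly_Mapping.lookup (T_basis v) (w, id) \<noteq> 0"
  obtain as where as: "reduced_word D v as" "T_elt D v = T_word as"
    using someI_ex[OF ex_reduced_word[OF assms(2)]] by (auto simp: T_elt_eq_SOME)
  have iv: "inv v \<in> weyl D" by (intro inv_weyl order_refl assms)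
  have "(w, id) \<in> pmul (id, inv v) ` Poly_Mapping.keys (T_word as)"
    using * keys_tmul_single[of "(id, inv v)" 1 "T_word as"] iv as(2)
    by (auto simp: T_basis_def delta_d_def in_keys_iff id_weyl)
  then obtain bs where bs: "subseq bs as" "w = word_prod D bs"
    using keys_T_word[OF reduced_wordD(2)[OF as(1)]] by (auto simp: pmul_def)
  have "bs \<in> lists (simples D)"
    using subseq_lists[OF bs(1) reduced_wordD(1)[OF as(1)]] .
  then have "len D w \<le> length bs" using bs len_le by blast
  then have "length bs = length as"
    using list_emb_length[OF bs(1)] assms(3) reduced_wordD(4)[OF as(1)] by simp
  then have "bs = as" using bs(1) subseq_same_length by blast
  then show False using bs assms(4) reduced_wordD(3)[OF as(1)] by simp
qed

text \<open>Among the elements with nonzero coefficient choose v of maximal length. By triangularity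
  only its own term contributes at the position (v, id).\<close>

lemma T_basis_independent:
  assumes "finite F" "F \<subseteq> weyl D" "(\<Sum>w\<in>F. tmul D (scal (c w)) (T_basis w)) = 0" "w \<in> F"
  shows "c w = 0"
proof (rule ccontr)
  assume "c w \<noteq> 0"
  let ?F = "{w \<in> F. c w \<noteq> 0}"
  have F: "finite ?F" "?F \<noteq> {}" using assms(1,4) \<open>c w \<noteq> 0\<close> by auto
  then have "Max (len D ` ?F) \<in> len D ` ?F" by (intro Max_in) auto
  then obtain v where v: "v \<in> ?F" "Max (len D ` ?F) = len D v" by blast
  have v_max: "len D v' \<le> len D v" if "v' \<in> ?F" for v'
    unfolding v(2)[symmetric] using F(1) that by (intro Max_ge) auto
  have vW: "v \<in> weyl D" using v assms(2) by auto
  have "0 = Poly_Mapping.lookup (\<Sum>w\<in>F. tmul D (scal (c w)) (T_basis w)) (v, id)" using assms(3) by simp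
  also have "\<dots> = (\<Sum>w\<in>F. c w * Poly_Mapping.lookup (T_basis w) (v, id))"
    unfolding lookup_sum using assms(2) by (intro sum.cong) (auto simp: lookup_scal T_basis_closed)
  also have "\<dots> = (\<Sum>w\<in>F. if w = v then c v * Poly_Mapping.lookup (T_basis v) (v, id) else 0)"
    using assms(2) v_max vW lookup_T_basis_other[OF vW] by (intro sum.cong) fastforce+
  also have "\<dots> = c v * Poly_Mapping.lookup (T_basis v) (v, id)" using v assms(1) by simp
  finally show False using lookup_T_basis_self[OF vW] v(1) by simp
qed

end

subsection \<open>Expansion over subwords\<close>

lemma foldr_comp: "foldr (\<circ>) gs h = foldr (\<circ>) gs id \<circ> h"
  by (induction gs) (simp_all add: comp_assoc)

lemma sub_suffix_end: "sub_suffix D \<alpha>s J (Suc (length \<alpha>s)) = id"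
  by (simp add: sub_suffix_def)

lemma sub_suffix_step:
  "j \<le> length \<alpha>s \<Longrightarrow> sub_suffix D \<alpha>s J j = eps_refl D \<alpha>s J j \<circ> sub_suffix D \<alpha>s J (Suc j)"
  by (simp add: sub_suffix_def upt_conv_Cons del: upt_Suc)

lemma sub_suffix_insert: "i < j \<Longrightarrow> sub_suffix D \<alpha>s (insert i J) j = sub_suffix D \<alpha>s J j"
  unfolding sub_suffix_def
  by (intro arg_cong[where f = "\<lambda>gs. foldr (\<circ>) gs id"] map_cong) (auto simp: eps_refl_def)

text \<open>The coroot at j involves only the positions after j, so i = j is allowed, unlike in
  \<open>sub_suffix_insert\<close>.\<close>

lemma gamma_coroot_insert: "i \<le> j \<Longrightarrow> gamma_coroot D \<alpha>s (insert i J) j = gamma_coroot D \<alpha>s J j"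
  unfolding gamma_coroot_def
  by (intro arg_cong[where f = "\<lambda>gs. coact D (foldr (\<circ>) gs id) (coroot D (\<alpha>s ! (j - 1)))"] map_cong)
    (auto simp: eps_refl_def)

lemma sub_suffix_subseq:
  assumes "1 \<le> j" "j \<le> Suc (length \<alpha>s)"
  shows "\<exists>\<beta>s. subseq \<beta>s (drop (j - 1) \<alpha>s) \<and> sub_suffix D \<alpha>s J j = word_prod D \<beta>s"
  using assms(2,1)
proof (induction j rule: inc_induct)
  case base
  show ?case by (intro exI[of _ "[]"]) (simp add: sub_suffix_end)
next
  case (step j)
  then have j: "1 \<le> j" "j \<le> length \<alpha>s" by auto
  obtain \<beta>s where \<beta>s: "subseq \<beta>s (drop j \<alpha>s)" "sub_suffix D \<alpha>s J (Suc j) = word_prod D \<beta>s"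
    using step by auto
  have drop: "drop (j - 1) \<alpha>s = \<alpha>s ! (j - 1) # drop j \<alpha>s"
    using j by (subst Cons_nth_drop_Suc[symmetric]) auto
  show ?case
  proof (cases "j \<in> J")
    case True
    then have "sub_suffix D \<alpha>s J j = word_prod D (\<alpha>s ! (j - 1) # \<beta>s)"
      using \<beta>s j by (simp add: sub_suffix_step eps_refl_def)
    moreover have "subseq (\<alpha>s ! (j - 1) # \<beta>s) (drop (j - 1) \<alpha>s)" using \<beta>s(1) unfolding drop by simp
    ultimately show ?thesis by blast
  next
    case False
    then have "sub_suffix D \<alpha>s J j = word_prod D \<beta>s"
      using \<beta>s j by (simp add: sub_suffix_step eps_refl_def)
    moreover have "subseq \<beta>s (drop (j - 1) \<alpha>s)" using \<beta>s(1) unfolding drop by (rule list_emb_Cons)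
    ultimately show ?thesis by blast
  qed
qed

text \<open>The factor at position i of the expression that starts at position j: the root is built
  from the letters j, ..., i - 1 only. Varying j makes the induction over suffixes possible, and j =
  1 gives the factors of the final formula.\<close>

definition subword_weight ::
  "('x::linordered_ab_group_add, 'y::linordered_ab_group_add) root_datum \<Rightarrow> 'x list \<Rightarrow> nat \<Rightarrow> nat set \<Rightarrow> nat \<Rightarrow> ('x, 'y) ell"
  where "subword_weight D \<alpha>s j J i =
    (let y = la (gamma_coroot D \<alpha>s J i); x = zz (word_prod D (take (i - j) (drop (j - 1) \<alpha>s)) (\<alpha>s ! (i - 1)))
     in if i \<in> J then QQ y x else PP y x)"

lemma subword_weight_1:
  "subword_weight D \<alpha>s 1 J i = (if i \<in> J then QQ (la (gamma_coroot D \<alpha>s J i)) (zz (beta_root D \<alpha>s i))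
    else PP (la (gamma_coroot D \<alpha>s J i)) (zz (beta_root D \<alpha>s i)))"
  by (simp add: subword_weight_def beta_root_def)

lemma sum_Pow_insert:
  assumes "a \<notin> A"
  shows "(\<Sum>J\<in>Pow (insert a A). f J) = (\<Sum>J\<in>Pow A. f J + f (insert a J))"
proof (cases "finite A")
  case True
  have "inj_on (insert a) (Pow A)" using assms by (auto simp: inj_on_def)
  then have "(\<Sum>J\<in>insert a ` Pow A. f J) = (\<Sum>J\<in>Pow A. f (insert a J))" by (simp add: sum.reindex)
  moreover have "(\<Sum>J\<in>Pow (insert a A). f J) = (\<Sum>J\<in>Pow A. f J) + (\<Sum>J\<in>insert a ` Pow A. f J)"
    unfolding Pow_insert using True assms by (intro sum.union_disjoint) auto
  ultimately show ?thesis by (simp add: sum.distrib)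
qed simp

context simply_connected_root_datum
begin

lemma foldr_comp_weyl: "(\<And>i. i \<in> set xs \<Longrightarrow> f i \<in> weyl D) \<Longrightarrow> foldr (\<circ>) (map f xs) id \<in> weyl D"
  by (induction xs) (simp_all add: id_weyl comp_weyl)

lemma inv_foldr_comp:
  assumes "\<And>i. i \<in> set xs \<Longrightarrow> f i \<in> weyl D \<and> inv (f i) = f i"
  shows "inv (foldr (\<circ>) (map f xs) id) = foldr (\<circ>) (map f (rev xs)) id"
  using assms
proof (induction xs)
  case (Cons x xs)
  have "inv (foldr (\<circ>) (map f (x # xs)) id) = inv (foldr (\<circ>) (map f xs) id) \<circ> inv (f x)"
    using Cons.prems by (simp add: inv_comp_weyl foldr_comp_weyl)
  also have "\<dots> = foldr (\<circ>) (map f (rev xs)) id \<circ> f x"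
    using Cons.IH[OF Cons.prems] Cons.prems[of x] by (simp only: list.set_intros)
  also have "\<dots> = foldr (\<circ>) (map f (rev (x # xs))) id"
    using foldr_comp[of "map f (rev xs)" "f x"] by simp
  finally show ?case .
qed simp

context
  fixes \<alpha>s :: "'x list"
  assumes \<alpha>s: "set \<alpha>s \<subseteq> simples D"
begin

lemma letter_simple: "1 \<le> i \<Longrightarrow> i \<le> length \<alpha>s \<Longrightarrow> \<alpha>s ! (i - 1) \<in> simples D"
  using \<alpha>s by (auto simp: subset_iff)

lemma eps_refl_weyl:
  "1 \<le> i \<Longrightarrow> i \<le> length \<alpha>s \<Longrightarrow> eps_refl D \<alpha>s J i \<in> weyl D \<and> inv (eps_refl D \<alpha>s J i) = eps_refl D \<alpha>s J i"
  using letter_simple[of i] by (simp add: eps_refl_def id_weyl refl_weyl inv_refl simple_root)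

lemma sub_suffix_weyl: "1 \<le> j \<Longrightarrow> sub_suffix D \<alpha>s J j \<in> weyl D"
  unfolding sub_suffix_def by (intro foldr_comp_weyl eps_refl_weyl[THEN conjunct1]) auto

text \<open>All factors of a suffix are involutions, so the reversed product in
  \<open>gamma_coroot\<close> is the inverse of the suffix, as it occurs in
  \<open>delta_T_basis\<close>.\<close>

lemma gamma_coroot_eq:
  assumes "1 \<le> j" "j \<le> length \<alpha>s"
  shows "gamma_coroot D \<alpha>s J j = coact D (inv (sub_suffix D \<alpha>s J (Suc j))) (coroot D (\<alpha>s ! (j - 1)))"
proof -
  have "inv (sub_suffix D \<alpha>s J (Suc j)) = foldr (\<circ>) (map (eps_refl D \<alpha>s J) (rev [Suc j..<Suc (length \<alpha>s)])) id"
    unfolding sub_suffix_def using assms by (intro inv_foldr_comp eps_refl_weyl) auto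
  then show ?thesis by (simp only: gamma_coroot_def)
qed

lemma gamma_coroot_coroot:
  assumes "1 \<le> j" "j \<le> length \<alpha>s"
  obtains \<gamma> where "\<gamma> \<in> roots D" "gamma_coroot D \<alpha>s J j = coroot D \<gamma>"
proof -
  have "inv (sub_suffix D \<alpha>s J (Suc j)) \<in> weyl D"
    by (intro inv_weyl order_refl sub_suffix_weyl) simp
  then show thesis using letter_simple[OF assms] assms
    by (intro that[of "inv (sub_suffix D \<alpha>s J (Suc j)) (\<alpha>s ! (j - 1))"])
      (simp_all add: gamma_coroot_eq weyl_root coact_coroot simple_root)
qed

text \<open>Prepending the letter j applies its reflection to the roots at later positions and
  leaves their coroots alone. This is how the reflected roots of the formula build up.\<close>

lemma subst_subword_weight:
  assumes "1 \<le> j" "j < i" "i \<le> length \<alpha>s"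
  shows "subst_frac (lat_act D (refl D (\<alpha>s ! (j - 1)), id)) (subword_weight D \<alpha>s (Suc j) J i)
    = subword_weight D \<alpha>s j J i"
proof -
  obtain \<gamma> where \<gamma>: "\<gamma> \<in> roots D" "gamma_coroot D \<alpha>s J i = coroot D \<gamma>"
    using gamma_coroot_coroot[of i J] assms by auto
  have "drop (j - 1) \<alpha>s = \<alpha>s ! (j - 1) # drop j \<alpha>s"
    using assms by (subst Cons_nth_drop_Suc[symmetric]) auto
  moreover have "i - j = Suc (i - Suc j)" using assms by simp
  ultimately have "word_prod D (take (i - j) (drop (j - 1) \<alpha>s)) x
      = refl D (\<alpha>s ! (j - 1)) (word_prod D (take (i - Suc j) (drop j \<alpha>s)) x)" for x
    by simp
  moreover have "refl D (\<alpha>s ! (j - 1)) \<in> weyl D" using assms letter_simple[of j] by (simp add: refl_weyl)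
  ultimately show ?thesis
    by (simp add: subword_weight_def Let_def \<gamma> subst_act_PP_QQ id_weyl)
qed

lemma delta_expansion:
  assumes "weyl_relations D" "1 \<le> j" "j \<le> Suc (length \<alpha>s)"
  shows "delta (word_prod D (drop (j - 1) \<alpha>s)) = (\<Sum>J\<in>Pow {j..length \<alpha>s}.
    tmul D (scal (\<Prod>i=j..length \<alpha>s. subword_weight D \<alpha>s j J i)) (T_basis (sub_suffix D \<alpha>s J j)))"
  using assms(3,2)
proof (induction j rule: inc_induct)
  case base
  show ?case by (simp add: sub_suffix_end T_basis_id tmul_scal_1 delta_closed id_weyl flip: id_def)
next
  case (step j)
  then have j: "1 \<le> j" "j \<le> length \<alpha>s" by auto
  let ?n = "length \<alpha>s" and ?s = "refl D (\<alpha>s ! (j - 1))"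
  let ?w = "\<lambda>J. \<Prod>i=j..?n. subword_weight D \<alpha>s j J i"
  have \<alpha>: "\<alpha>s ! (j - 1) \<in> simples D" using letter_simple j by blast
  then have s: "?s \<in> weyl D" by (rule refl_weyl)
  have interval: "{j..?n} = insert j {Suc j..?n}" using j by auto
  have "drop (j - 1) \<alpha>s = \<alpha>s ! (j - 1) # drop j \<alpha>s"
    using j by (subst Cons_nth_drop_Suc[symmetric]) auto
  then have "delta (word_prod D (drop (j - 1) \<alpha>s)) = tmul D (delta ?s) (delta (word_prod D (drop (Suc j - 1) \<alpha>s)))"
    using tmul_delta_delta[OF s, of "word_prod D (drop j \<alpha>s)"] by simp
  also have "delta (word_prod D (drop (Suc j - 1) \<alpha>s)) = (\<Sum>J\<in>Pow {Suc j..?n}.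
      tmul D (scal (\<Prod>i=Suc j..?n. subword_weight D \<alpha>s (Suc j) J i)) (T_basis (sub_suffix D \<alpha>s J (Suc j))))"
    by (rule step.IH) simp
  \<comment> \<open>Each subset of the later positions splits in two: position j is left out with a
    factor P, or put in with a factor Q.\<close>
  also have "tmul D (delta ?s) \<dots> = (\<Sum>J\<in>Pow {Suc j..?n}.
      tmul D (scal (?w J)) (T_basis (sub_suffix D \<alpha>s J j))
      + tmul D (scal (?w (insert j J))) (T_basis (sub_suffix D \<alpha>s (insert j J) j)))"
    unfolding tmul_sum_right[OF delta_closed[OF s]]
  proof (rule sum.cong[OF refl])
    fix J
    assume "J \<in> Pow {Suc j..?n}"
    then have jJ: "j \<notin> J" by auto
    let ?v = "sub_suffix D \<alpha>s J (Suc j)"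
    let ?c = "\<Prod>i=Suc j..?n. subword_weight D \<alpha>s (Suc j) J i"
    let ?c' = "\<Prod>i=Suc j..?n. subword_weight D \<alpha>s j J i"
    let ?p = "PP (la (coact D (inv ?v) (coroot D (\<alpha>s ! (j - 1))))) (zz (\<alpha>s ! (j - 1)))"
    let ?q = "QQ (la (coact D (inv ?v) (coroot D (\<alpha>s ! (j - 1))))) (zz (\<alpha>s ! (j - 1)))"
    have v: "?v \<in> weyl D" by (intro sub_suffix_weyl) simp
    have closed: "T_basis ?v \<in> twisted_carrier" "T_basis (?s \<circ> ?v) \<in> twisted_carrier" "delta ?s \<in> twisted_carrier"
      by (intro T_basis_closed comp_weyl v s delta_closed)+
    have p: "(?s, id) \<in> weyl D \<times> weyl D" using s id_weyl by blast
    have "subst_frac (lat_act D (?s, id)) ?c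
        = (\<Prod>i=Suc j..?n. subst_frac (lat_act D (?s, id)) (subword_weight D \<alpha>s (Suc j) J i))"
      by (intro subst_frac_prod(1) additive_lat_act specializable_inj inj_lat_act p)
    also have "\<dots> = ?c'" by (intro prod.cong refl subst_subword_weight) (use j in auto)
    finally have "subst_frac (lat_act D (?s, id)) ?c = ?c'" .
    then have "tmul D (delta ?s) (tmul D (scal ?c) (T_basis ?v))
        = tmul D (scal ?c') (tmul D (delta ?s) (T_basis ?v))"
      using tmul_delta_scal[OF s, of ?c] by (metis tmul_assoc closed scal_closed)
    also have "\<dots> = tmul D (scal (?c' * ?p)) (T_basis ?v) + tmul D (scal (?c' * ?q)) (T_basis (?s \<circ> ?v))"
      unfolding delta_T_basis[OF assms(1) \<alpha> v] tmul_add_right[OF scal_closed]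
      by (simp only: tmul_assoc[OF scal_closed scal_closed closed(1), symmetric]
          tmul_assoc[OF scal_closed scal_closed closed(2), symmetric] tmul_scal_scal)
    also have "\<dots> = tmul D (scal (?w J)) (T_basis (sub_suffix D \<alpha>s J j))
        + tmul D (scal (?w (insert j J))) (T_basis (sub_suffix D \<alpha>s (insert j J) j))"
    proof (intro arg_cong2[of _ _ _ _ "(+)"] arg_cong2[of _ _ _ _ "\<lambda>c w. tmul D (scal c) (T_basis w)"])
      show "?c' * ?p = ?w J"
        using jJ j by (simp add: interval subword_weight_def gamma_coroot_eq mult.commute)
      \<comment> \<open>Putting j into J changes neither the membership of later positions nor their
        coroots.\<close>
      have "?c' = (\<Prod>i=Suc j..?n. subword_weight D \<alpha>s j (insert j J) i)"
        by (intro prod.cong refl) (auto simp: subword_weight_def gamma_coroot_insert)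
      then show "?c' * ?q = ?w (insert j J)"
        using j by (simp add: interval subword_weight_def gamma_coroot_eq sub_suffix_insert mult.commute)
      show "?v = sub_suffix D \<alpha>s J j"
        using j jJ by (simp add: sub_suffix_step eps_refl_def)
      show "?s \<circ> ?v = sub_suffix D \<alpha>s (insert j J) j"
        using j by (simp add: sub_suffix_step eps_refl_def sub_suffix_insert)
    qed
    finally show "tmul D (delta ?s) (tmul D (scal ?c) (T_basis ?v))
      = tmul D (scal (?w J)) (T_basis (sub_suffix D \<alpha>s J j))
      + tmul D (scal (?w (insert j J))) (T_basis (sub_suffix D \<alpha>s (insert j J) j))" .
  qed
  also have "\<dots> = (\<Sum>J\<in>Pow {j..?n}. tmul D (scal (?w J)) (T_basis (sub_suffix D \<alpha>s J j)))"
    unfolding interval by (rule sum_Pow_insert[symmetric]) simp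
  finally show ?case .
qed

definition subword_sum :: "('x \<Rightarrow> 'x) \<Rightarrow> ('x, 'y) ell"
  where "subword_sum w = (\<Sum>J | J \<subseteq> {1..length \<alpha>s} \<and> sub_suffix D \<alpha>s J 1 = w.
    \<Prod>i=1..length \<alpha>s. subword_weight D \<alpha>s 1 J i)"

text \<open>The index set F is left free, so that the expansion can be read over a Bruhat interval
  as well as over a set common to two expressions.\<close>

lemma delta_subword_sum:
  assumes "weyl_relations D" "finite F" "(\<lambda>J. sub_suffix D \<alpha>s J 1) ` Pow {1..length \<alpha>s} \<subseteq> F"
  shows "delta (word_prod D \<alpha>s) = (\<Sum>w\<in>F. tmul D (scal (subword_sum w)) (T_basis w))"
proof -
  let ?n = "length \<alpha>s"
  let ?t = "\<lambda>J. tmul D (scal (\<Prod>i=1..?n. subword_weight D \<alpha>s 1 J i)) (T_basis (sub_suffix D \<alpha>s J 1))"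
  have "delta (word_prod D \<alpha>s) = (\<Sum>J\<in>Pow {1..?n}. ?t J)"
    using delta_expansion[OF assms(1), of 1] by simp
  also have "\<dots> = (\<Sum>w\<in>F. \<Sum>J\<in>{J \<in> Pow {1..?n}. sub_suffix D \<alpha>s J 1 = w}. ?t J)"
    using assms by (intro sum.group[symmetric]) auto
  also have "\<dots> = (\<Sum>w\<in>F. tmul D (scal (subword_sum w)) (T_basis w))"
    unfolding subword_sum_def tmul_scal_sum by (intro sum.cong refl) auto
  finally show ?thesis .
qed

lemma subword_sum_eq_0: "w \<notin> (\<lambda>J. sub_suffix D \<alpha>s J 1) ` Pow {1..length \<alpha>s} \<Longrightarrow> subword_sum w = 0"
  unfolding subword_sum_def by (rule sum.neutral) auto

lemma subword_images: "finite ((\<lambda>J. sub_suffix D \<alpha>s J 1) ` Pow {1..length \<alpha>s})"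
  "(\<lambda>J. sub_suffix D \<alpha>s J 1) ` Pow {1..length \<alpha>s} \<subseteq> weyl D"
  by (auto simp: sub_suffix_weyl)

end

section \<open>Identification of the coefficients b\<close>

lemma T_basis_coeff_unique:
  assumes "finite F" "F \<subseteq> weyl D"
    and "(\<Sum>w\<in>F. tmul D (scal (c w)) (T_basis w)) = (\<Sum>w\<in>F. tmul D (scal (d w)) (T_basis w))" "w \<in> F"
  shows "c w = d w"
proof -
  have "tmul D (scal (c w - d w)) f = tmul D (scal (c w)) f - tmul D (scal (d w)) f" for w f
    using tmul_add_left[OF scal_closed scal_closed, of "c w - d w" "d w" f]
    by (simp add: algebra_simps flip: scal_add)
  then have "(\<Sum>w\<in>F. tmul D (scal (c w - d w)) (T_basis w)) = 0"
    using assms(3) by (simp add: sum_subtractf)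
  from T_basis_independent[OF assms(1,2) this assms(4)] show ?thesis by simp
qed

lemma finite_bruhat: "finite {w. bruhat_le D w u}"
proof -
  have "{w. bruhat_le D w u} \<subseteq> word_prod D ` {\<beta>s. set \<beta>s \<subseteq> simples D \<and> length \<beta>s \<le> len D u}"
  proof
    fix w
    assume "w \<in> {w. bruhat_le D w u}"
    then obtain \<alpha>s \<beta>s where *: "reduced_word D u \<alpha>s" "subseq \<beta>s \<alpha>s" "word_prod D \<beta>s = w"
      by (auto simp: bruhat_le_def)
    have "\<beta>s \<in> lists (simples D)" using subseq_lists[OF *(2) reduced_wordD(1)[OF *(1)]] .
    moreover have "length \<beta>s \<le> len D u" using list_emb_length[OF *(2)] reduced_wordD(4)[OF *(1)] by simp
    ultimately show "w \<in> word_prod D ` {\<beta>s. set \<beta>s \<subseteq> simples D \<and> length \<beta>s \<le> len D u}"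
      using *(3) by (intro image_eqI[of _ _ \<beta>s]) (auto simp: in_lists_conv_set)
  qed
  then show ?thesis
    by (rule finite_subset) (intro finite_imageI finite_lists_length_le finite_simples)
qed

lemma bruhat_weyl:
  assumes "bruhat_le D w u"
  shows "w \<in> weyl D"
proof -
  obtain \<alpha>s \<beta>s where "reduced_word D u \<alpha>s" "subseq \<beta>s \<alpha>s" "word_prod D \<beta>s = w"
    using assms by (auto simp: bruhat_le_def)
  then show ?thesis using word_prod_weyl[OF subseq_lists[OF _ reduced_wordD(1)]] by blast
qed

text \<open>Subwords of a reduced expression lie below u by the definition of the Bruhat order, so
  their sums satisfy the description of \<open>b_coeff\<close>, and independence makes them the only
  solution.\<close>

lemma b_coeff_eq:
  assumes "weyl_relations D" "set \<alpha>s \<subseteq> simples D"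
  shows "b_coeff D (word_prod D \<alpha>s) w = subword_sum \<alpha>s w"
proof -
  define u where "u = word_prod D \<alpha>s"
  have "u \<in> weyl D" unfolding u_def using assms(2) by (intro word_prod_weyl) auto
  then obtain rs where rs: "reduced_word D u rs" using ex_reduced_word by blast
  note rs_simple = reduced_wordD(2)[OF rs]
  let ?B = "{w. bruhat_le D w u}"
  let ?I = "(\<lambda>J. sub_suffix D rs J 1) ` Pow {1..length rs}"
  have B: "finite ?B" "?B \<subseteq> weyl D" using finite_bruhat bruhat_weyl by auto
  have I: "?I \<subseteq> ?B"
  proof (rule image_subsetI, rule CollectI)
    fix J
    obtain \<beta>s where "subseq \<beta>s rs" "sub_suffix D rs J 1 = word_prod D \<beta>s"
      using sub_suffix_subseq[of 1 rs D J] by auto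
    then show "bruhat_le D (sub_suffix D rs J 1) u" unfolding bruhat_le_def using rs by auto
  qed
  have zero: "subword_sum rs v = 0" if "\<not> bruhat_le D v u" for v
    using that I by (intro subword_sum_eq_0[OF rs_simple]) auto
  have expand: "delta u = (\<Sum>w | bruhat_le D w u. tmul D (scal (subword_sum rs w)) (T_basis w))"
    using delta_subword_sum[OF rs_simple assms(1) B(1) I] reduced_wordD(3)[OF rs] by simp
  have "b_coeff D u = subword_sum rs"
    unfolding b_coeff_def T_basis_def[symmetric]
  proof (rule the_equality)
    fix b
    assume b: "(\<forall>w. \<not> bruhat_le D w u \<longrightarrow> b w = 0) \<and>
      delta u = (\<Sum>w | bruhat_le D w u. tmul D (scal (b w)) (T_basis w))"
    show "b = subword_sum rs"
    proof
      fix v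
      show "b v = subword_sum rs v"
      proof (cases "bruhat_le D v u")
        case True
        then show ?thesis
          using b expand by (intro T_basis_coeff_unique[OF B, of b "subword_sum rs"]) simp_all
      next
        case False
        then show ?thesis using b zero by simp
      qed
    qed
  qed (use zero expand in blast)
  \<comment> \<open>The given expression need not be reduced, and its subwords may leave the Bruhat
    interval. Both expansions of the same element are compared over the union of the two index sets,
    so the contributions outside the interval cancel among themselves.\<close>
  moreover have "subword_sum rs w = subword_sum \<alpha>s w"
  proof -
    let ?I' = "(\<lambda>J. sub_suffix D \<alpha>s J 1) ` Pow {1..length \<alpha>s}"
    note I1 = subword_images[OF rs_simple] and I2 = subword_images[OF assms(2)]
    have F: "finite (?I \<union> ?I')" "?I \<union> ?I' \<subseteq> weyl D" using I1 I2 by auto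
    have "(\<Sum>w\<in>?I \<union> ?I'. tmul D (scal (subword_sum rs w)) (T_basis w))
        = (\<Sum>w\<in>?I \<union> ?I'. tmul D (scal (subword_sum \<alpha>s w)) (T_basis w))"
      using delta_subword_sum[OF rs_simple assms(1) F(1)] delta_subword_sum[OF assms(2,1) F(1)]
        reduced_wordD(3)[OF rs] u_def by simp
    note * = T_basis_coeff_unique[OF F this]
    show ?thesis
    proof (cases "w \<in> ?I \<union> ?I'")
      case False
      then show ?thesis using subword_sum_eq_0[OF rs_simple] subword_sum_eq_0[OF assms(2)] by simp
    qed (rule *)
  qed
  ultimately show ?thesis by (simp add: u_def)
qed

text \<open>The projection fixes the root and hbar, so the first denominator factor keeps its
  nonzero argument; the second has a projected coroot as argument, nonzero by
  \<open>lat_proj_coroot_nonzero\<close>.\<close>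

lemma spec_subword_weight:
  assumes "SP \<subseteq> simples D" "set \<alpha>s \<subseteq> simples D" "1 \<le> i" "i \<le> length \<alpha>s"
  shows "specializable (lat_proj D SP) (subword_weight D \<alpha>s 1 J i)"
    "spec_P D SP (subword_weight D \<alpha>s 1 J i) =
      (if i \<in> J then QQ (lat_proj D SP (la (gamma_coroot D \<alpha>s J i))) (zz (beta_root D \<alpha>s i))
       else PP (lat_proj D SP (la (gamma_coroot D \<alpha>s J i))) (zz (beta_root D \<alpha>s i)))"
proof -
  obtain \<gamma> where \<gamma>: "\<gamma> \<in> roots D" "gamma_coroot D \<alpha>s J i = coroot D \<gamma>"
    using gamma_coroot_coroot[OF assms(2-4), of J] by blast
  have hb: "lat_proj D SP hb = hb" and zz: "lat_proj D SP (zz x) = zz x" for x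
    using lat_proj_zz_hb[OF assms(1)] by (simp_all add: hb_def zz_def)
  note * = subst_frac_PP_QQ[OF additive_lat_proj[OF assms(1)] hb _ lat_proj_coroot_nonzero[OF assms(1) \<gamma>(1)],
      of "zz (beta_root D \<alpha>s i)", unfolded zz, OF zz_la_hb_nonzero(1)]
  show "specializable (lat_proj D SP) (subword_weight D \<alpha>s 1 J i)"
    "spec_P D SP (subword_weight D \<alpha>s 1 J i) =
      (if i \<in> J then QQ (lat_proj D SP (la (gamma_coroot D \<alpha>s J i))) (zz (beta_root D \<alpha>s i))
       else PP (lat_proj D SP (la (gamma_coroot D \<alpha>s J i))) (zz (beta_root D \<alpha>s i)))"
    unfolding subword_weight_1 spec_P_def using * \<gamma>(2) by simp_all
qed

lemma spec_subword_weight_prod_eq_0: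
  assumes "SP \<subseteq> simples D" "set \<alpha>s \<subseteq> simples D"
    and "1 \<le> j" "j \<le> Suc (length \<alpha>s)" "sub_suffix D \<alpha>s J j \<notin> min_coset_reps D SP"
  shows "(\<Prod>i=1..length \<alpha>s. spec_P D SP (subword_weight D \<alpha>s 1 J i)) = 0"
  using assms(4,3,5)
proof (induction j rule: inc_induct)
  case base
  \<comment> \<open>The empty suffix is the identity, which is a minimal representative, so a last
    failing position exists.\<close>
  then show ?case by (simp add: sub_suffix_end id_min_coset_reps flip: id_def)
next
  case (step j)
  then have j: "1 \<le> j" "j \<le> length \<alpha>s" by auto
  show ?case
  proof (cases "sub_suffix D \<alpha>s J (Suc j) \<in> min_coset_reps D SP")
    case False
    then show ?thesis using step.IH by simp
  next
    case True
    let ?v = "sub_suffix D \<alpha>s J (Suc j)" and ?\<alpha> = "\<alpha>s ! (j - 1)"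
    have \<alpha>: "?\<alpha> \<in> simples D" using letter_simple[OF assms(2) j] .
    have *: "sub_suffix D \<alpha>s J j \<notin> min_coset_reps D SP" by (rule step.prems(2))
    \<comment> \<open>An omitted letter would leave the suffix unchanged, hence still
      minimal.\<close>
    have jJ: "j \<in> J"
    proof (rule ccontr)
      assume "j \<notin> J"
      then show False using * True j by (simp add: sub_suffix_step eps_refl_def)
    qed
    then have "refl D ?\<alpha> \<circ> ?v \<notin> min_coset_reps D SP"
      using * j by (simp add: sub_suffix_step eps_refl_def)
    with True \<alpha> have "inv ?v ?\<alpha> \<in> SP" by (intro min_coset_reps_refl assms)
    moreover have "gamma_coroot D \<alpha>s J j = coroot D (inv ?v ?\<alpha>)"
      unfolding gamma_coroot_eq[OF assms(2) j]
      by (intro coact_coroot inv_weyl order_refl simple_root \<alpha> min_coset_repsD(1)[OF True])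
    ultimately have "lat_proj D SP (la (gamma_coroot D \<alpha>s J j)) = - hb"
      by (simp add: lat_proj_simple_coroot assms)
    then have "spec_P D SP (subword_weight D \<alpha>s 1 J j) = 0"
      \<comment> \<open>The first argument of Q has become -hbar, so the numerator contains
        theta(-hbar + hbar).\<close>
      using spec_subword_weight(2)[OF assms(1,2) j, of J] jJ by (simp add: QQ_def fract_collapse)
    then show ?thesis using j by (intro prod_zero) auto
  qed
qed

end

theorem theorem4p6:
  fixes D :: "('x::linordered_ab_group_add, 'y::linordered_ab_group_add) root_datum"
    and SP :: "'x set"
    and u w :: "'x \<Rightarrow> 'x"
    and \<alpha>s :: "'x list"
  assumes "simply_connected_root_datum D"
    and "weyl_relations D"
    and "SP \<subseteq> simples D"
    and "u \<in> weyl D"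
    and "w \<in> weyl D"
    and "set \<alpha>s \<subseteq> simples D"
    and "u = word_prod D \<alpha>s"
  shows "ell_class D SP w u =
      (\<Sum>J | J \<subseteq> {1..length \<alpha>s} \<and> sub_suffix D \<alpha>s J 1 = w \<and>
             (\<forall>j\<in>{1..length \<alpha>s}. sub_suffix D \<alpha>s J j \<in> min_coset_reps D SP).
         \<Prod>j=1..length \<alpha>s.
           if j \<in> J then spec_P D SP (QQ (la (gamma_coroot D \<alpha>s J j)) (zz (beta_root D \<alpha>s j)))
           else spec_P D SP (PP (la (gamma_coroot D \<alpha>s J j)) (zz (beta_root D \<alpha>s j))))
    \<and> (w \<notin> min_coset_reps D SP \<longrightarrow> ell_class D SP w u = 0)"
proof -
  interpret simply_connected_root_datum D by (rule assms(1))
  let ?n = "length \<alpha>s"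
  let ?J = "{J. J \<subseteq> {1..?n} \<and> sub_suffix D \<alpha>s J 1 = w}"
  let ?J' = "{J. J \<subseteq> {1..?n} \<and> sub_suffix D \<alpha>s J 1 = w \<and>
    (\<forall>j\<in>{1..?n}. sub_suffix D \<alpha>s J j \<in> min_coset_reps D SP)}"
  let ?t = "\<lambda>J. \<Prod>j=1..?n. spec_P D SP (subword_weight D \<alpha>s 1 J j)"
  note add = additive_lat_proj[OF assms(3)]
  have spec: "specializable (lat_proj D SP) (subword_weight D \<alpha>s 1 J j)" if "j \<in> {1..?n}" for J j
    using spec_subword_weight(1)[OF assms(3,6)] that by simp
  have "ell_class D SP w u = spec_P D SP (\<Sum>J\<in>?J. \<Prod>j=1..?n. subword_weight D \<alpha>s 1 J j)"
    using b_coeff_eq[OF assms(2,6)] subword_sum_def[OF assms(6)] by (simp add: ell_class_def assms(7))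
  also have "\<dots> = (\<Sum>J\<in>?J. spec_P D SP (\<Prod>j=1..?n. subword_weight D \<alpha>s 1 J j))"
    unfolding spec_P_def by (intro subst_frac_sum(1) add subst_frac_prod(2) spec)
  also have "\<dots> = (\<Sum>J\<in>?J. ?t J)"
    unfolding spec_P_def by (intro sum.cong refl subst_frac_prod(1) add spec)
  finally have sum: "ell_class D SP w u = (\<Sum>J\<in>?J. ?t J)" .
  also have "\<dots> = (\<Sum>J\<in>?J'. ?t J)"
  proof (rule sum.mono_neutral_right)
    show "finite ?J" by (rule finite_subset[of _ "Pow {1..?n}"]) auto
    show "\<forall>J\<in>?J - ?J'. ?t J = 0"
    proof
      fix J
      assume "J \<in> ?J - ?J'"
      then obtain j where "1 \<le> j" "j \<le> ?n" "sub_suffix D \<alpha>s J j \<notin> min_coset_reps D SP" by auto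
      then show "?t J = 0" by (intro spec_subword_weight_prod_eq_0[OF assms(3,6)]) auto
    qed
  qed auto
  also have "\<dots> = (\<Sum>J\<in>?J'. \<Prod>j=1..?n.
      if j \<in> J then spec_P D SP (QQ (la (gamma_coroot D \<alpha>s J j)) (zz (beta_root D \<alpha>s j)))
      else spec_P D SP (PP (la (gamma_coroot D \<alpha>s J j)) (zz (beta_root D \<alpha>s j))))"
    by (intro sum.cong prod.cong refl) (simp add: subword_weight_1[unfolded One_nat_def])
  finally have formula: "ell_class D SP w u = \<dots>" .
  \<comment> \<open>The suffix starting at position 1 is w itself, so every term of the unrestricted
    sum vanishes.\<close>
  have "ell_class D SP w u = 0" if "w \<notin> min_coset_reps D SP"
    unfolding sum using that
    by (intro sum.neutral ballI spec_subword_weight_prod_eq_0[OF assms(3,6), of 1]) auto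
  with formula show ?thesis by blast
qed

end
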